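(* Let $1<\gamma<2$ and let $\rho,u$ be a solution in the sense of distributions on $(0,T)\times\mathbb{T}^d$ of the isentropic compressible Euler system $$\partial_t(\rho u)+\operatorname{div}(\rho u\otimes u)+\nabla p(\rho)=0,\qquad \partial_t\rho+\operatorname{div}(\rho u)=0.$$ Assume $$u\in B_r^{\alpha,\infty}((0,T)\times\mathbb{T}^d),\qquad \rho,\ \rho u\in B_q^{\beta,\infty}((0,T)\times\mathbb{T}^d),\qquad 0\le\underline{\rho}\le\rho\le\overline{\rho}\ \text{ a.e. in }(0,T)\times\mathbb{T}^d,$$ for some constants $\underline{\rho},\overline{\rho}$, exponents $r,q$ and $0\le\alpha,\beta\le1$ such that $$\frac1r+\frac2q\le1,\qquad\frac2r+\frac1q\le1,\qquad r,q\ge2,\qquad\alpha+\gamma\beta>1\qquad\text{and}\qquad2\alpha+\beta>1.$$ Define $\mathcal{B}_{\varepsilon^\beta}:=\{y:\ 0<\rho^\varepsilon(y)<\varepsilon^\beta\ \text{and}\ \rho(y)\ne0\}$ and assume that $$\left\|\frac{\rho^\varepsilon-\rho}{\rho^\varepsilon}\right\|_{L^q(\mathcal{B}_{\varepsilon^\beta})}\le C(\rho),$$ where the constant $C(\rho)$ does not depend on $\varepsilon$. Assume further that $p\in C^{1,\gamma-1}([\underline{\rho},\overline{\rho}])$ and, in addition, $p'(0)=0$ as soon as $\underline{\rho}=0$. Then the energy is locally conserved, i.e. $$\partial_t\left(\tfrac12\rho|u|^2+P(\rho)\right)+\operatorname{div}\left[\left(\tfrac12\rho|u|^2+p(\rho)+P(\rho)\right)u\right]=0$$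 in the sense of distributions on $(0,T)\times\mathbb{T}^d$.
   Context: $\mathbb{T}^d$ is the $d$-dimensional torus; $u$ is the velocity, $\rho\ge0$ the density, $p=p(\rho)$ the pressure law. $\operatorname{div}$ and $\nabla$ act in the space variable. The pressure potential is $P(\rho)=\rho\int_1^\rho\frac{p(s)}{s^2}\,ds$, with the value at $\rho=0$ understood as the limit $\rho\to0^+$; the pressure is understood to be given on an interval for which this integral makes sense. For $\Omega=(0,T)\times\mathbb{T}^d$, the Besov space $B_q^{\alpha,\infty}(\Omega)$ consists of those $w$ for which $$\|w\|_{B_q^{\alpha,\infty}(\Omega)}:=\|w\|_{L^q(\Omega)}+\sup_{\xi\in\Omega}\frac{\|w(\cdot+\xi)-w\|_{L^q(\Omega\cap(\Omega-\xi))}}{|\xi|^\alpha}<\infty,$$ where $\xi$ ranges over (nonzero) space-time shifts. Mollification: with $N=1+d$, $\eta\in C_c^\infty(\mathbb{R}^N)$ is a fixed nonnegative radial function of integral $1$ with $\eta(x)=1$ for $|x|\le\frac13$ and $\eta(x)=0$ for $|x|\ge1$; $\eta^\varepsilon(x)=\varepsilon^{-N}\eta(x/\varepsilon)$ and $w^\varepsilon:=\eta^\varepsilon*w$ (mollification in time and space), which is defined on $\Omega^\varepsilon=\{x\in\Omega:\operatorname{dist}(x,\partial\Omega)>\varepsilon\}$. The points $y=(t,x)$ in $\mathcal{B}_{\varepsilon^\beta}$ are space-time points where $\rho^\varepsilon$ is defined. *)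

theory Defs
  imports "HOL-Analysis.Analysis" "HOL-Probability.Essential_Supremum"
begin

text \<open>
  The torus is R^d/Z^d. Functions on (0,T) x T^d are functions on R x R^d that are 1-periodic in
  each space variable; their values at times outside (0,T) play no role. Integrals over
  (0,T) x T^d are taken over (0,T) times the half-open unit cell.
\<close>

definition cell :: "(real ^ 'd) set" where
  "cell = {x. \<forall>i. 0 \<le> x $ i \<and> x $ i < 1}"

definition spacetime :: "real \<Rightarrow> (real \<times> (real ^ 'd)) set" where
  "spacetime T = {0<..<T} \<times> cell"

definition space_periodic :: "(real \<times> (real ^ 'd) \<Rightarrow> 'b) \<Rightarrow> bool" where
  "space_periodic w \<longleftrightarrow> (\<forall>t x i. w (t, x + axis i 1) = w (t, x))"

primrec C_k :: "nat \<Rightarrow> ('a::euclidean_space \<Rightarrow> real) \<Rightarrow> bool" where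
  "C_k 0 f = continuous_on UNIV f"
| "C_k (Suc k) f = ((\<forall>x. f differentiable (at x)) \<and>
     (\<forall>v. C_k k (\<lambda>x. frechet_derivative f (at x) v)))"

definition smooth :: "('a::euclidean_space \<Rightarrow> real) \<Rightarrow> bool" where
  "smooth f \<longleftrightarrow> (\<forall>k. C_k k f)"

text \<open>Smooth functions with compact support in (0,T) x T^d: the torus being compact, this only
  restricts the support in time.\<close>

definition test_functions :: "real \<Rightarrow> (real \<times> (real ^ 'd) \<Rightarrow> real) set" where
  "test_functions T = {\<phi>. smooth \<phi> \<and> space_periodic \<phi> \<and>
     (\<exists>a b. 0 < a \<and> b < T \<and> (\<forall>t x. \<phi> (t, x) \<noteq> 0 \<longrightarrow> a \<le> t \<and> t \<le> b))}"

definition dt :: "(real \<times> (real ^ 'd) \<Rightarrow> real) \<Rightarrow> real \<times> (real ^ 'd) \<Rightarrow> real" where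
  "dt \<phi> y = frechet_derivative \<phi> (at y) (1, 0)"

definition grad :: "(real \<times> (real ^ 'd) \<Rightarrow> real) \<Rightarrow> real \<times> (real ^ 'd) \<Rightarrow> real ^ 'd" where
  "grad \<phi> y = (\<chi> i. frechet_derivative \<phi> (at y) (0, axis i 1))"

definition locally_integrable ::
    "real \<Rightarrow> (real \<times> (real ^ 'd) \<Rightarrow> 'b::{banach, second_countable_topology}) \<Rightarrow> bool" where
  "locally_integrable T f \<longleftrightarrow>
     (\<forall>a b. 0 < a \<and> b < T \<longrightarrow> set_integrable lebesgue ({a..b} \<times> cell) f)"

text \<open>\<open>f\<^sub>t + div F = 0\<close> in the sense of distributions on (0,T) x T^d. Local integrability, which
  makes \<open>f\<close> and \<open>F\<close> distributions, has to be demanded explicitly because the Bochner integral of a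
  non-integrable function is 0.\<close>

definition distributional_conservation_law ::
    "real \<Rightarrow> (real \<times> (real ^ 'd) \<Rightarrow> real) \<Rightarrow> (real \<times> (real ^ 'd) \<Rightarrow> real ^ 'd) \<Rightarrow> bool" where
  "distributional_conservation_law T f F \<longleftrightarrow>
     locally_integrable T f \<and> locally_integrable T F \<and>
     (\<forall>\<phi> \<in> test_functions T.
        set_lebesgue_integral lebesgue (spacetime T) (\<lambda>y. f y * dt \<phi> y + F y \<bullet> grad \<phi> y) = 0)"

text \<open>The momentum equation is stated component by component: the flux of the \<open>i\<close>-th momentum is
  the \<open>i\<close>-th row of \<open>\<rho> u \<otimes> u + p(\<rho>) I\<close>.\<close>

definition isentropic_euler ::
    "real \<Rightarrow> (real \<Rightarrow> real) \<Rightarrow> (real \<times> (real ^ 'd) \<Rightarrow> real) \<Rightarrow> (real \<times> (real ^ 'd) \<Rightarrow> real ^ 'd) \<Rightarrow> bool"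
  where
  "isentropic_euler T p \<rho> u \<longleftrightarrow>
     (\<forall>i. distributional_conservation_law T (\<lambda>y. \<rho> y * u y $ i)
            (\<lambda>y. (\<rho> y * u y $ i) *\<^sub>R u y + p (\<rho> y) *\<^sub>R axis i 1)) \<and>
     distributional_conservation_law T \<rho> (\<lambda>y. \<rho> y *\<^sub>R u y)"

definition ennreal_root :: "ennreal \<Rightarrow> ennreal \<Rightarrow> ennreal" where
  "ennreal_root q x = (if x = \<infinity> then \<infinity> else ennreal (enn2real x powr (1 / enn2real q)))"

definition Lq_norm ::
    "ennreal \<Rightarrow> 'a::euclidean_space set \<Rightarrow> ('a \<Rightarrow> 'b::real_normed_vector) \<Rightarrow> ennreal" where
  "Lq_norm q A w =
     (if q = \<infinity> then esssup (lebesgue_on A) (\<lambda>y. ennreal (norm (w y)))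
      else ennreal_root q (\<integral>\<^sup>+ y. ennreal (norm (w y) powr enn2real q) \<partial>lebesgue_on A))"

text \<open>The shift \<open>\<xi>\<close> runs over all nonzero vectors of R x R^d. Replacing its space part by the
  shortest representative modulo Z^d leaves the difference unchanged and decreases \<open>|\<xi>|\<close>, so this
  is the supremum over nonzero shifts of R x T^d with their torus length. A point of the cell
  belongs to \<open>\<Omega> - \<xi>\<close> iff its shifted time lies in (0,T).\<close>

definition besov_norm ::
    "real \<Rightarrow> real \<Rightarrow> ennreal \<Rightarrow> (real \<times> (real ^ 'd) \<Rightarrow> 'b::real_normed_vector) \<Rightarrow> ennreal" where
  "besov_norm T \<alpha> q w = Lq_norm q (spacetime T) w +
     (SUP \<xi> \<in> - {0}. Lq_norm q {y \<in> spacetime T. fst (y + \<xi>) \<in> {0<..<T}} (\<lambda>y. w (y + \<xi>) - w y)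
        / ennreal (norm \<xi> powr \<alpha>))"

definition besov_space ::
    "real \<Rightarrow> real \<Rightarrow> ennreal \<Rightarrow> (real \<times> (real ^ 'd) \<Rightarrow> 'b::real_normed_vector) set" where
  "besov_space T \<alpha> q = {w. space_periodic w \<and> w \<in> borel_measurable (lebesgue_on (spacetime T)) \<and>
     besov_norm T \<alpha> q w < \<infinity>}"

definition mollifier :: "('a::euclidean_space \<Rightarrow> real) \<Rightarrow> bool" where
  "mollifier \<eta> \<longleftrightarrow> smooth \<eta> \<and> (\<forall>z. 0 \<le> \<eta> z) \<and>
     (\<forall>y z. norm y = norm z \<longrightarrow> \<eta> y = \<eta> z) \<and> integral\<^sup>L lebesgue \<eta> = 1 \<and>
     (\<forall>z. norm z \<le> 1 / 3 \<longrightarrow> \<eta> z = 1) \<and> (\<forall>z. 1 \<le> norm z \<longrightarrow> \<eta> z = 0)"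

definition mollify :: "('a::euclidean_space \<Rightarrow> real) \<Rightarrow> real \<Rightarrow> ('a \<Rightarrow> real) \<Rightarrow> 'a \<Rightarrow> real" where
  "mollify \<eta> \<epsilon> w y = (LINT z|lebesgue. (\<eta> (z /\<^sub>R \<epsilon>) / \<epsilon> ^ DIM('a)) * w (y - z))"

text \<open>The points of (0,T) x T^d whose distance to the boundary exceeds \<open>\<epsilon>\<close> are those with
  time in \<open>(\<epsilon>, T - \<epsilon>)\<close>.\<close>

definition near_vacuum ::
    "real \<Rightarrow> (real \<times> (real ^ 'd) \<Rightarrow> real) \<Rightarrow> real \<Rightarrow> real \<Rightarrow> (real \<times> (real ^ 'd) \<Rightarrow> real) \<Rightarrow>
       (real \<times> (real ^ 'd)) set" where
  "near_vacuum T \<eta> \<epsilon> \<beta> \<rho> = {y \<in> {\<epsilon><..<T - \<epsilon>} \<times> cell.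
     0 < mollify \<eta> \<epsilon> \<rho> y \<and> mollify \<eta> \<epsilon> \<rho> y < \<epsilon> powr \<beta> \<and> \<rho> y \<noteq> 0}"

definition C1_holder_on :: "real \<Rightarrow> real set \<Rightarrow> (real \<Rightarrow> real) \<Rightarrow> bool" where
  "C1_holder_on \<theta> S p \<longleftrightarrow>
     (\<exists>p'. (\<forall>s \<in> S. (p has_real_derivative p' s) (at s within S)) \<and>
           (\<exists>C. \<forall>s \<in> S. \<forall>t \<in> S. \<bar>p' s - p' t\<bar> \<le> C * \<bar>s - t\<bar> powr \<theta>))"

definition pressure_potential :: "(real \<Rightarrow> real) \<Rightarrow> real \<Rightarrow> real" where
  "pressure_potential p r =
     (if r = 0 then Lim (at_right 0) (\<lambda>r. r * (LBINT s=1..ereal r. p s / s\<^sup>2))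
      else r * (LBINT s=1..ereal r. p s / s\<^sup>2))"

text \<open>The integral in the potential makes sense between 1 and every positive point of the interval
  spanned by \<open>[a, b]\<close> and 1; the potential at 0 is a limit from the right, so only positive points
  matter.\<close>

definition potential_defined_on :: "(real \<Rightarrow> real) \<Rightarrow> real \<Rightarrow> real \<Rightarrow> bool" where
  "potential_defined_on p a b \<longleftrightarrow> (\<forall>r \<in> {min a 1..max b 1}. 0 < r \<longrightarrow>
     interval_lebesgue_integrable lborel 1 (ereal r) (\<lambda>s. p s / s\<^sup>2))"

end

theory Submission
  imports Defs
begin

text \<open>
  The theorem holds because mollification at scale \<open>\<epsilon>\<close> almost commutes with the nonlinearities of the
  system. Let \<open>R\<close>, \<open>U\<close>, \<open>M\<close>, \<open>Q\<close> and \<open>\<Pi>\<close> be the mollifications of \<open>\<rho>\<close>, \<open>u\<close>, \<open>\<rho> u\<close>, \<open>\<rho> u \<otimes> u\<close> and \<open>p(\<rho>)\<close>. They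
  satisfy the mollified equations \<open>\<partial>\<^sub>t M + div Q + \<nabla>\<Pi> = 0\<close> and \<open>\<partial>\<^sub>t R + div M = 0\<close>, in which the momentum
  equation may be tested with \<open>\<phi> U\<close> and the mass equation with \<open>\<phi> |U|\<^sup>2 / 2\<close> and \<open>\<phi> A(R)\<close>, where \<open>A\<close> stands for the derivative of the
  potential (lemma \<open>energy_balance\<close>). The result is the energy balance for the mollified fields plus
  the commutators \<open>M - R U\<close>, \<open>Q - M \<otimes> U\<close> and \<open>\<Pi> - p(R)\<close>, each multiplied by one derivative of \<open>U\<close> or
  \<open>R\<close>. The first two are quadratic in the increments of the fields (lemma \<open>commutator_bound\<close>) and
  contribute the order \<open>\<epsilon> powr (2 \<alpha> + \<beta> - 1)\<close>. The third is of order \<open>\<gamma>\<close> in the increments of the density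
  (lemma \<open>pressure_commutator_bound\<close>) and contributes \<open>\<epsilon> powr (\<alpha> + \<gamma> \<beta> - 1)\<close>.

  The delicate term is \<open>P''(R) \<nabla>R \<bullet> (M - R U)\<close>, since \<open>P''(s) = p'(s) / s\<close> is unbounded near vacuum. The
  potential is therefore regularized: \<open>p'(s) / s\<close> is replaced by \<open>p'(s) / max s \<delta>\<close> with \<open>\<delta> = \<epsilon> powr \<beta>\<close>, which is
  at most of order \<open>\<delta> powr (\<gamma> - 2)\<close>. The term then has the order
  \<open>\<beta> (\<gamma> - 2) + (\<beta> - 1) + (\<alpha> + \<beta>) = \<alpha> + \<gamma> \<beta> - 1\<close>. In exchange the pressure that belongs to the regularized
  potential is wrong, but only where the density is below \<open>\<delta>\<close>, and there by at most a multiple of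
  \<open>\<delta> powr \<gamma>\<close>, because the slope of the pressure is of order \<open>\<delta> powr (\<gamma> - 1)\<close> (lemma
  \<open>pressure_regularization\<close>). Against the divergence of \<open>U\<close>, of order \<open>\<alpha> - 1\<close>, this costs once more
  \<open>\<alpha> + \<gamma> \<beta> - 1\<close>.

  The integrability conditions enter through a single weight. For each \<open>\<epsilon>\<close> there is a function \<open>H \<ge> 1\<close>
  whose integral is bounded independently of \<open>\<epsilon>\<close> (lemma \<open>weight_integral\<close>) and such that almost
  everywhere velocity increments at scale \<open>\<epsilon>\<close> are, on average, at most of size
  \<open>\<epsilon> powr \<alpha> * H powr (1 / r)\<close>, and those of density and momentum at most of size
  \<open>\<epsilon> powr \<beta> * H powr (1 / q)\<close>. The conditions on \<open>r\<close> and \<open>q\<close> say that the powers of \<open>H\<close> in each error term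
  add up to at most 1. So all errors are pointwise at most a multiple of \<open>\<epsilon> powr \<kappa> * H\<close> with \<open>\<kappa> > 0\<close>
  (lemma \<open>good_point_bounds\<close>), and they vanish in the limit (theorem \<open>local_energy_balance\<close>).
  Infinite exponents need no separate treatment.

  Finally, the potential of the theorem differs from the one used in the estimates by a multiple of
  the density, whose balance is the mass equation, and the fields are replaced by periodic Borel
  representatives, to which the theorem on iterated integrals applies.
\<close>

section \<open>The pressure near vacuum\<close>

lemma antiderivative_on_halfline:
  fixes f :: "real \<Rightarrow> real" and a :: ereal
  assumes "continuous_on {s. a < ereal s} f" "a < ereal x0"
  shows "\<exists>F. F x0 = y0 \<and> (\<forall>s. a < ereal s \<longrightarrow> (F has_real_derivative f s) (at s))"
proof -
  have op: "open {s. a < ereal s}"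
    by (cases a) (auto simp: open_Collect_less)
  have "\<exists>F. \<forall>x. a < ereal x \<longrightarrow> ereal x < \<infinity> \<longrightarrow> (F has_vector_derivative f x) (at x)"
  proof (rule einterval_antiderivative)
    show "a < \<infinity>" using assms(2) by auto
    show "isCont f x" if "a < ereal x" for x
      using continuous_on_eq_continuous_at[OF op] assms(1) that by blast
  qed
  then obtain F where F: "\<And>x. a < ereal x \<Longrightarrow> (F has_real_derivative f x) (at x)"
    by (auto simp: has_real_derivative_iff_has_vector_derivative)
  show ?thesis
    by (rule exI[of _ "\<lambda>s. F s + (y0 - F x0)"]) (auto intro!: derivative_eq_intros F)
qed

lemma antiderivative_on_line:
  fixes f :: "real \<Rightarrow> real"
  assumes "continuous_on UNIV f"
  obtains F where "F x0 = y0" "\<And>s. (F has_real_derivative f s) (at s)"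
  using antiderivative_on_halfline[of "-\<infinity>" f x0 y0] assms by auto

lemma derivative_bound_on_interval:
  fixes F :: "real \<Rightarrow> real"
  assumes "\<And>x. x \<in> {a..b} \<Longrightarrow> (F has_real_derivative f x) (at x within {a..b})"
    and "\<And>x. x \<in> {a..b} \<Longrightarrow> \<bar>f x\<bar> \<le> B" and "x \<in> {a..b}" "y \<in> {a..b}"
  shows "\<bar>F x - F y\<bar> \<le> B * \<bar>x - y\<bar>"
  using field_differentiable_bound[of "{a..b}" F f B x y] assms by auto

text \<open>
  Comparison with the antiderivative of the majorant. The bound is uniform in the left end point,
  because the majorant is integrable at 0 even though it may be unbounded there.
\<close>
lemma derivative_powr_bound:
  fixes F :: "real \<Rightarrow> real"
  assumes F: "\<And>x. 0 < x \<Longrightarrow> x \<le> b \<Longrightarrow> (F has_real_derivative f x) (at x)"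
    and f: "\<And>x. 0 < x \<Longrightarrow> x \<le> b \<Longrightarrow> \<bar>f x\<bar> \<le> C * x powr (\<theta> - 1)"
    and "0 < \<theta>" "0 \<le> C" "0 < s" "s \<le> b"
  shows "\<bar>F b - F s\<bar> \<le> C / \<theta> * b powr \<theta>"
proof -
  define G where "G x = C / \<theta> * x powr \<theta>" for x
  have G: "(G has_real_derivative C * x powr (\<theta> - 1)) (at x)" if "0 < x" for x
    unfolding G_def using that \<open>0 < \<theta>\<close> by (auto intro!: derivative_eq_intros simp: powr_diff)
  have "G s - F s \<le> G b - F b"
  proof (rule DERIV_nonneg_imp_nondecreasing[OF \<open>s \<le> b\<close>])
    fix x assume "s \<le> x" "x \<le> b"
    then show "\<exists>y. ((\<lambda>x. G x - F x) has_real_derivative y) (at x) \<and> 0 \<le> y"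
      using \<open>0 < s\<close> f[of x] by (intro exI[of _ "C * x powr (\<theta> - 1) - f x"]) (auto intro!: derivative_intros G F)
  qed
  moreover have "G s + F s \<le> G b + F b"
  proof (rule DERIV_nonneg_imp_nondecreasing[OF \<open>s \<le> b\<close>])
    fix x assume "s \<le> x" "x \<le> b"
    then show "\<exists>y. ((\<lambda>x. G x + F x) has_real_derivative y) (at x) \<and> 0 \<le> y"
      using \<open>0 < s\<close> f[of x] by (intro exI[of _ "C * x powr (\<theta> - 1) + f x"]) (auto intro!: derivative_intros G F)
  qed
  moreover have "0 \<le> G s" unfolding G_def using assms by simp
  ultimately show ?thesis unfolding G_def by linarith
qed

text \<open>
  Near 0 the pressure is \<open>p 0 + o(s)\<close>. The constant contributes \<open>r * p 0 * (1 - 1 /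
  r)\<close>, which tends to \<open>- p 0\<close>, and the remainder contributes \<open>r\<close>
  times the integral of \<open>o(1 / s)\<close>, which tends to 0. So the sum of pressure and
  potential vanishes at vacuum, as the energy flux requires there.
\<close>
lemma pressure_potential_at_vacuum:
  assumes p': "(p has_real_derivative 0) (at_right 0)"
    and int: "\<And>r. 0 < r \<Longrightarrow> r \<le> 1 \<Longrightarrow> interval_lebesgue_integrable lborel 1 (ereal r) (\<lambda>s. p s / s\<^sup>2)"
  shows "pressure_potential p 0 = - p 0"
proof -
  define f where "f r = r * (LBINT s=1..ereal r. p s / s\<^sup>2)" for r
  have "((\<lambda>r. f r) \<longlongrightarrow> - p 0) (at_right 0)"
  proof (rule tendstoI)
    fix e :: real assume "0 < e"
    have "((\<lambda>s. (p s - p 0) / s) \<longlongrightarrow> 0) (at_right 0)"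
      using p' unfolding has_field_derivative_iff by simp
    then have "\<forall>\<^sub>F s in at_right 0. \<bar>(p s - p 0) / s\<bar> < e / 2"
      using tendstoD[of _ _ _ "e/2"] \<open>0 < e\<close> by (fastforce simp: dist_real_def)
    then obtain d0 where d0: "0 < d0" "\<And>s. 0 < s \<Longrightarrow> s < d0 \<Longrightarrow> \<bar>(p s - p 0) / s\<bar> < e / 2"
      by (auto simp: eventually_at_right_field)
    define d where "d = min 1 (d0 / 2)"
    have d: "0 < d" "d \<le> 1" "\<And>s. 0 < s \<Longrightarrow> s \<le> d \<Longrightarrow> \<bar>p s - p 0\<bar> \<le> e / 2 * s"
      using d0 by (auto simp: d_def abs_div field_simps) (smt (verit) d0(2) divide_less_eq abs_div abs_of_pos)
    define K where "K = \<bar>LBINT s=1..ereal d. p s / s\<^sup>2\<bar> + \<bar>p 0\<bar> / d"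
    have "0 \<le> K" unfolding K_def using d by simp
    have bound: "\<bar>f r + p 0\<bar> \<le> r * K + e / 2" if r: "0 < r" "r < d" for r
    proof -
      have i1: "interval_lebesgue_integrable lborel (ereal r) (ereal 1) (\<lambda>s. p s / s\<^sup>2)"
        using int[of r] r d by (subst interval_integrable_endpoints_reverse) (auto simp: one_ereal_def)
      have s1: "set_integrable lborel {r..1} (\<lambda>s. p s / s\<^sup>2)"
        using i1 r d unfolding interval_lebesgue_integrable_def
        by (subst set_integrable_discrete_difference[where X="{r, 1}" and B="{r<..<1}"]) auto
      have sd: "set_integrable lborel {r..d} (\<lambda>s. p s / s\<^sup>2)"
        by (rule set_integrable_subset[OF s1]) (use d in auto)
      have c0: "continuous_on {r..d} (\<lambda>s. p 0 / s\<^sup>2)"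
        using r by (auto intro!: continuous_intros)
      then have s0: "set_integrable lborel {r..d} (\<lambda>s. p 0 / s\<^sup>2)"
        by (rule borel_integrable_atLeastAtMost')
      have split: "(LBINT s=1..ereal r. p s / s\<^sup>2) = (LBINT s=1..ereal d. p s / s\<^sup>2) + (LBINT s=ereal d..ereal r. p s / s\<^sup>2)"
      proof (rule interval_integral_sum[symmetric])
        have "min (1::ereal) (min (ereal d) (ereal r)) = ereal r" "max (1::ereal) (max (ereal d) (ereal r)) = ereal 1"
          using r d by (auto simp: one_ereal_def min_def max_def)
        then show "interval_lebesgue_integrable lborel (min 1 (min (ereal d) (ereal r))) (max 1 (max (ereal d) (ereal r))) (\<lambda>s. p s / s\<^sup>2)"
          using i1 by simp
      qed
      have rev: "(LBINT s=ereal d..ereal r. p s / s\<^sup>2) = - (LBINT s:{r..d}. p s / s\<^sup>2)"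
        using r by (subst interval_integral_endpoints_reverse) (simp add: interval_integral_Icc)
      have e1: "(LBINT s:{r..d}. p s / s\<^sup>2) = (LBINT s:{r..d}. (p s / s\<^sup>2 - p 0 / s\<^sup>2)) + (LBINT s:{r..d}. p 0 / s\<^sup>2)"
        using set_integral_diff(2)[OF sd s0] by simp
      have e2: "(LBINT s:{r..d}. p 0 / s\<^sup>2) = p 0 / r - p 0 / d"
      proof -
        have "(LBINT s=ereal r..ereal d. p 0 / s\<^sup>2) = (- (p 0 / d)) - (- (p 0 / r))"
        proof (rule interval_integral_FTC_finite)
          show "continuous_on {min r d..max r d} (\<lambda>s. p 0 / s\<^sup>2)" using c0 r by simp
          fix x assume "min r d \<le> x" "x \<le> max r d"
          then have "x \<noteq> 0" using r by auto
          then have "((\<lambda>x. - (p 0 / x)) has_real_derivative p 0 / x\<^sup>2) (at x within {min r d..max r d})"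
            by (auto intro!: derivative_eq_intros simp: power2_eq_square)
          then show "((\<lambda>x. - (p 0 / x)) has_vector_derivative p 0 / x\<^sup>2) (at x within {min r d..max r d})"
            by (simp add: has_real_derivative_iff_has_vector_derivative)
        qed
        then show ?thesis using r by (simp add: interval_integral_Icc)
      qed
      have e3: "\<bar>LBINT s:{r..d}. (p s / s\<^sup>2 - p 0 / s\<^sup>2)\<bar> \<le> (LBINT s:{r..d}. e / 2 / r)"
      proof -
        have "norm (LBINT s:{r..d}. (p s / s\<^sup>2 - p 0 / s\<^sup>2)) \<le> (LBINT s:{r..d}. norm (p s / s\<^sup>2 - p 0 / s\<^sup>2))"
          by (intro set_integral_norm_bound set_integral_diff sd s0)
        also have "\<dots> \<le> (LBINT s:{r..d}. e / 2 / r)"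
        proof (rule set_integral_mono)
          show "set_integrable lborel {r..d} (\<lambda>s. norm (p s / s\<^sup>2 - p 0 / s\<^sup>2))"
            by (intro set_integrable_norm set_integral_diff sd s0)
          show "set_integrable lborel {r..d} (\<lambda>s. e / 2 / r)"
            by (intro borel_integrable_atLeastAtMost' continuous_intros)
          fix s assume s: "s \<in> {r..d}"
          have "norm (p s / s\<^sup>2 - p 0 / s\<^sup>2) = \<bar>p s - p 0\<bar> / s\<^sup>2"
            by (simp add: diff_divide_distrib[symmetric] abs_div)
          also have "\<dots> \<le> (e / 2 * s) / s\<^sup>2"
            using d(3)[of s] s r by (intro divide_right_mono) auto
          also have "\<dots> = e / 2 / s" using s r by (simp add: power2_eq_square)
          also have "\<dots> \<le> e / 2 / r" using s r \<open>0 < e\<close> by (intro divide_left_mono) auto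
          finally show "norm (p s / s\<^sup>2 - p 0 / s\<^sup>2) \<le> e / 2 / r" .
        qed
        finally show ?thesis by simp
      qed
      have e4: "(LBINT s:{r..d}. e / 2 / r) = (d - r) * (e / 2 / r)"
        using r by (simp add: set_lebesgue_integral_def)
      define I where "I = (LBINT s:{r..d}. (p s / s\<^sup>2 - p 0 / s\<^sup>2))"
      define L where "L = (LBINT s=1..ereal d. p s / s\<^sup>2)"
      have "f r = r * (L - (I + (p 0 / r - p 0 / d)))"
        unfolding f_def split rev e1 e2 I_def L_def by simp
      then have I: "f r + p 0 = r * L - r * I + r * (p 0 / d)"
        using r by (simp add: algebra_simps)
      have I2: "\<bar>I\<bar> \<le> (d - r) * (e / 2 / r)" using e3 unfolding e4 I_def .
      have "r * \<bar>I\<bar> \<le> r * ((d - r) * (e / 2 / r))" using I2 r by (intro mult_left_mono) auto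
      also have "\<dots> = (d - r) * (e / 2)" using r by (simp add: field_simps)
      also have "\<dots> \<le> 1 * (e / 2)" using r d \<open>0 < e\<close> by (intro mult_right_mono) auto
      finally have rI: "\<bar>r * I\<bar> \<le> e / 2" using r by (simp add: abs_mult)
      have "\<bar>f r + p 0\<bar> \<le> \<bar>r * L\<bar> + \<bar>r * I\<bar> + \<bar>r * (p 0 / d)\<bar>" unfolding I
        using abs_triangle_ineq[of "r * L - r * I" "r * (p 0 / d)"] abs_triangle_ineq4[of "r * L" "r * I"] by simp
      also have "\<dots> \<le> r * \<bar>L\<bar> + e / 2 + r * (\<bar>p 0\<bar> / d)" using rI r d by (simp add: abs_mult)
      also have "\<dots> = r * K + e / 2" unfolding K_def L_def by (simp add: algebra_simps)
      finally show ?thesis .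
    qed
    define d1 where "d1 = min d (e / (2 * (K + 1)))"
    have "0 < d1" unfolding d1_def using d \<open>0 < e\<close> \<open>0 \<le> K\<close> by auto
    moreover have "dist (f r) (- p 0) < e" if "0 < r" "r < d1" for r
    proof -
      have "r * K \<le> r * (K + 1)" using that by simp
      also have "\<dots> < e / (2 * (K + 1)) * (K + 1)"
        using that \<open>0 \<le> K\<close> unfolding d1_def by (intro mult_strict_right_mono) auto
      also have "\<dots> = e / 2" using \<open>0 \<le> K\<close> by (simp add: field_simps)
      finally show ?thesis using bound[of r] that unfolding d1_def dist_real_def by auto
    qed
    ultimately show "\<forall>\<^sub>F r in at_right 0. dist (f r) (- p 0) < e"
      by (auto simp: eventually_at_right_field)
  qed
  then have "Lim (at_right 0) f = - p 0" by (intro tendsto_Lim) auto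
  then show ?thesis unfolding pressure_potential_def f_def by simp
qed

text \<open>
  An extension \<open>g\<close> of the derivative of the pressure to the line. The growth bound by
  \<open>s powr (\<gamma> - 1)\<close> comes from the Hoelder condition when the density range starts
  at 0, and from boundedness when it does not; with it the two cases need no further distinction.
\<close>
lemma pressure_slope:
  assumes "C1_holder_on (\<gamma> - 1) {lo..hi} p" "1 < \<gamma>" "\<gamma> < 2" "0 \<le> lo" "lo \<le> hi"
    and vac: "lo = 0 \<Longrightarrow> (p has_real_derivative 0) (at_right 0)"
  shows "\<exists>g C. 0 \<le> C \<and> continuous_on UNIV g \<and>
     (\<forall>s\<in>{lo..hi}. (p has_real_derivative g s) (at s within {lo..hi})) \<and>
     (\<forall>s\<in>{lo..hi}. \<forall>t\<in>{lo..hi}. \<bar>g s - g t\<bar> \<le> C * \<bar>s - t\<bar> powr (\<gamma> - 1)) \<and>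
     (\<forall>s\<ge>0. \<bar>g s\<bar> \<le> C * s powr (\<gamma> - 1))"
proof -
  obtain p1 C0 where p1: "\<forall>s\<in>{lo..hi}. (p has_real_derivative p1 s) (at s within {lo..hi})"
    "\<forall>s\<in>{lo..hi}. \<forall>t\<in>{lo..hi}. \<bar>p1 s - p1 t\<bar> \<le> C0 * \<bar>s - t\<bar> powr (\<gamma> - 1)"
    using assms(1) unfolding C1_holder_on_def by blast
  \<comment> \<open>On the degenerate interval \<open>{0}\<close> every number is a derivative of \<open>p\<close>; 0 is the right choice.\<close>
  define p2 where "p2 = (if hi = 0 then (\<lambda>s. 0) else p1)"
  have p2d: "\<forall>s\<in>{lo..hi}. (p has_real_derivative p2 s) (at s within {lo..hi})"
  proof (cases "hi = 0")
    case True
    then have "lo = 0" using assms by auto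
    then show ?thesis using True unfolding p2_def
      by (auto simp: has_field_derivative_iff at_within_def)
  qed (use p1 in \<open>auto simp: p2_def\<close>)
  define C1 where "C1 = \<bar>C0\<bar>"
  have p2h: "\<bar>p2 s - p2 t\<bar> \<le> C1 * \<bar>s - t\<bar> powr (\<gamma> - 1)" if "s\<in>{lo..hi}" "t\<in>{lo..hi}" for s t
  proof (cases "hi = 0")
    case False
    have "\<bar>p2 s - p2 t\<bar> \<le> C0 * \<bar>s - t\<bar> powr (\<gamma> - 1)" using p1 that False by (auto simp: p2_def)
    also have "\<dots> \<le> C1 * \<bar>s - t\<bar> powr (\<gamma> - 1)" unfolding C1_def by (intro mult_right_mono) auto
    finally show ?thesis .
  qed (auto simp: p2_def C1_def)
  have p20: "p2 0 = 0" if "lo = 0"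
  proof (cases "hi = 0")
    case False
    then have "0 < hi" using assms by auto
    \<comment> \<open>The one-sided derivative at 0 is unique as soon as the interval is nondegenerate.\<close>
    have "(p has_real_derivative p2 0) (at 0 within {0..hi})" using p2d that assms by auto
    then have "(p has_real_derivative p2 0) (at_right 0)"
      using at_within_Icc_at_right[OF \<open>0 < hi\<close>] by simp
    then show ?thesis using vac[OF that] unfolding has_field_derivative_iff
      using tendsto_unique[of "at_right (0::real)"] by (metis trivial_limit_at_right_real)
  qed (auto simp: p2_def)
  define cl where "cl s = max lo (min hi s)" for s
  define m where "m s = (if lo = 0 then 1 else max 0 (min 1 (s / lo)))" for s
  \<comment> \<open>Constant extension above \<open>hi\<close>; the factor \<open>m\<close> extends linearly to 0 below a positive \<open>lo\<close>, which keeps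
     the bound by \<open>s powr (\<gamma> - 1)\<close>.\<close>
  define g where "g s = p2 (cl s) * m s" for s
  have cl: "cl s \<in> {lo..hi}" for s using assms unfolding cl_def by auto
  have "continuous_on {lo..hi} p2"
    unfolding continuous_on_eq_continuous_within
  proof
    fix s assume s: "s \<in> {lo..hi}"
    have "((\<lambda>t. C1 * \<bar>s - t\<bar> powr (\<gamma> - 1)) \<longlongrightarrow> C1 * \<bar>s - s\<bar> powr (\<gamma> - 1)) (at s within {lo..hi})"
      using assms by (intro tendsto_intros tendsto_powr2) auto
    then have "((\<lambda>t. C1 * \<bar>s - t\<bar> powr (\<gamma> - 1)) \<longlongrightarrow> 0) (at s within {lo..hi})" by simp
    then have "((\<lambda>t. p2 t - p2 s) \<longlongrightarrow> 0) (at s within {lo..hi})"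
      by (rule Lim_null_comparison[rotated])
         (use p2h s in \<open>auto simp: eventually_at_filter abs_minus_commute intro!: always_eventually\<close>)
    then show "continuous (at s within {lo..hi}) p2"
      unfolding continuous_within by (simp add: LIM_zero_iff)
  qed
  then have cp2: "continuous_on UNIV (\<lambda>s. p2 (cl s))"
    by (rule continuous_on_compose2) (use cl in \<open>auto simp: cl_def intro!: continuous_intros\<close>)
  have "continuous_on UNIV m"
    unfolding m_def by (cases "lo = 0") (auto intro!: continuous_intros)
  then have cg: "continuous_on UNIV g" unfolding g_def by (intro continuous_intros cp2)
  have geq: "g s = p2 s" if "s \<in> {lo..hi}" for s
    using that assms unfolding g_def m_def cl_def by (auto simp: max_def min_def field_simps)
  have "\<exists>C2\<ge>0. \<forall>s\<in>{lo..hi}. \<bar>p2 s\<bar> \<le> C2 * s powr (\<gamma> - 1)"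
  proof (cases "lo = 0")
    case True
    then show ?thesis using p2h[of _ 0] p20 assms by (intro exI[of _ C1]) (auto simp: C1_def)
  next
    case False
    then have "0 < lo" using assms by auto
    obtain B where B: "\<And>s. s \<in> {lo..hi} \<Longrightarrow> \<bar>p2 s\<bar> \<le> B"
      using compact_imp_bounded[OF compact_continuous_image[OF \<open>continuous_on {lo..hi} p2\<close> compact_Icc]]
      unfolding bounded_iff by (metis image_eqI real_norm_def)
    have "0 \<le> B" using B[of lo] assms by auto
    have "\<bar>p2 s\<bar> \<le> B / lo powr (\<gamma> - 1) * s powr (\<gamma> - 1)" if "s \<in> {lo..hi}" for s
    proof -
      have "B * lo powr (\<gamma> - 1) \<le> B * s powr (\<gamma> - 1)"
        using that \<open>0 < lo\<close> \<open>0 \<le> B\<close> assms by (intro mult_left_mono powr_mono2) auto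
      then show ?thesis using B[OF that] \<open>0 < lo\<close> by (simp add: field_simps) (smt (verit) mult_right_mono powr_ge_zero)
    qed
    then show ?thesis using \<open>0 \<le> B\<close> by (intro exI[of _ "B / lo powr (\<gamma> - 1)"]) auto
  qed
  then obtain C2 where C2: "0 \<le> C2" "\<And>s. s \<in> {lo..hi} \<Longrightarrow> \<bar>p2 s\<bar> \<le> C2 * s powr (\<gamma> - 1)" by auto
  have gb: "\<bar>g s\<bar> \<le> C2 * s powr (\<gamma> - 1)" if "0 \<le> s" for s
  proof (cases "s < lo")
    case True
    then have lo: "0 < lo" "cl s = lo" using that assms unfolding cl_def by auto
    have ms: "m s = s / lo" "0 \<le> s / lo" "s / lo \<le> 1" unfolding m_def using True that lo by auto
    have "s / lo \<le> (s / lo) powr (\<gamma> - 1)"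
      using powr_mono'[of "\<gamma> - 1" 1 "s / lo"] ms assms that lo by (cases "s = 0") auto
    then have "\<bar>p2 lo\<bar> * (s / lo) \<le> (C2 * lo powr (\<gamma> - 1)) * (s / lo) powr (\<gamma> - 1)"
      using C2(2)[of lo] C2(1) assms ms by (intro mult_mono) auto
    also have "\<dots> = C2 * s powr (\<gamma> - 1)" using that lo by (simp add: powr_divide)
    finally show ?thesis unfolding g_def lo ms abs_mult abs_of_nonneg[OF ms(2)] .
  next
    case False
    then have "m s = 1" unfolding m_def using that assms by (auto simp: field_simps)
    then have "\<bar>g s\<bar> \<le> C2 * (cl s) powr (\<gamma> - 1)" unfolding g_def using C2(2)[OF cl] by simp
    also have "\<dots> \<le> C2 * s powr (\<gamma> - 1)"
      using False assms C2(1) unfolding cl_def by (intro mult_left_mono powr_mono2) auto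
    finally show ?thesis .
  qed
  define C where "C = max C1 C2"
  have "0 \<le> C" using C2 unfolding C_def by auto
  have m1: "C1 * x powr (\<gamma> - 1) \<le> C * x powr (\<gamma> - 1)" "C2 * x powr (\<gamma> - 1) \<le> C * x powr (\<gamma> - 1)" for x
    unfolding C_def by (auto intro!: mult_right_mono)
  show ?thesis
  proof (rule exI[of _ g], rule exI[of _ C], intro conjI ballI allI impI)
    fix s t assume st: "s \<in> {lo..hi}" "t \<in> {lo..hi}"
    show "(p has_real_derivative g s) (at s within {lo..hi})" using p2d st geq by simp
    show "\<bar>g s - g t\<bar> \<le> C * \<bar>s - t\<bar> powr (\<gamma> - 1)"
      using p2h[OF st] geq st m1(1)[of "\<bar>s - t\<bar>"] by simp
  next
    fix s :: real assume "0 \<le> s"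
    then show "\<bar>g s\<bar> \<le> C * s powr (\<gamma> - 1)" using gb[of s] m1(2)[of s] by linarith
  qed (use \<open>0 \<le> C\<close> cg in auto)
qed

text \<open>
  The second derivative \<open>p' s / s\<close> of the potential blows up at vacuum. The function
  \<open>k\<close> replaces its denominator by \<open>max s \<delta>\<close>; then \<open>A\<close> is
  a regularized enthalpy (the derivative of the potential), \<open>q\<close> the pressure that belongs
  to it, and \<open>s * A s - q s\<close> its potential. The truncation acts only for \<open>s <
  \<delta>\<close>, where the true slope is at most of order \<open>\<delta> powr (\<gamma> -
  1)\<close>; hence the pressure changes by \<open>\<delta> powr \<gamma>\<close> only, which is the
  decisive gain. The limit potential \<open>P0\<close> solves \<open>s P0' - P0 = p\<close> and
  therefore differs from the given potential by a multiple of the density.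
\<close>
lemma pressure_regularization:
  assumes hol: "C1_holder_on (\<gamma> - 1) {lo..hi} p" and \<gamma>: "1 < \<gamma>" "\<gamma> < 2" and lohi: "0 \<le> lo" "lo \<le> hi"
    and vac: "lo = 0 \<Longrightarrow> (p has_real_derivative 0) (at_right 0)"
    and pot: "potential_defined_on p lo hi"
  obtains g P0 c C where "0 \<le> C"
    "\<And>s. s \<in> {lo..hi} \<Longrightarrow> pressure_potential p s = P0 s + c * s"
    "\<And>s t. s \<in> {lo..hi} \<Longrightarrow> t \<in> {lo..hi} \<Longrightarrow> \<bar>P0 s - P0 t\<bar> \<le> C * \<bar>s - t\<bar>"
    "\<And>s t. s \<in> {lo..hi} \<Longrightarrow> t \<in> {lo..hi} \<Longrightarrow> \<bar>p s - p t\<bar> \<le> C * \<bar>s - t\<bar>"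
    "\<And>s t. s \<in> {lo..hi} \<Longrightarrow> t \<in> {lo..hi} \<Longrightarrow> \<bar>p s - p t - g t * (s - t)\<bar> \<le> C * \<bar>s - t\<bar> powr \<gamma>"
    "\<And>\<delta>. 0 < \<delta> \<Longrightarrow> \<delta> \<le> 1 \<Longrightarrow> \<exists>k A q. continuous_on UNIV k \<and>
        (\<forall>s. (A has_real_derivative k s) (at s)) \<and> (\<forall>s. (q has_real_derivative s * k s) (at s)) \<and>
        (\<forall>s\<in>{lo..hi}. \<bar>k s\<bar> \<le> C * \<delta> powr (\<gamma> - 2) \<and> \<bar>A s\<bar> \<le> C \<and> \<bar>q s - p s\<bar> \<le> C * \<delta> powr \<gamma> \<and>
           \<bar>s * A s - q s - P0 s\<bar> \<le> C * \<delta>)"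
proof -
  obtain g C0 where C0: "0 \<le> C0" and cg: "continuous_on UNIV g"
    and gd: "\<And>s. s\<in>{lo..hi} \<Longrightarrow> (p has_real_derivative g s) (at s within {lo..hi})"
    and gh: "\<And>s t. s\<in>{lo..hi} \<Longrightarrow> t\<in>{lo..hi} \<Longrightarrow> \<bar>g s - g t\<bar> \<le> C0 * \<bar>s - t\<bar> powr (\<gamma> - 1)"
    and gb: "\<And>s. 0 \<le> s \<Longrightarrow> \<bar>g s\<bar> \<le> C0 * s powr (\<gamma> - 1)"
    using pressure_slope[OF hol \<gamma> lohi vac] by metis
  \<comment> \<open>All antiderivatives are normalized at \<open>h \<ge> 1 \<ge> \<delta>\<close>, where truncated and true quantities coincide.\<close>
  define h where "h = hi + 1"
  have h: "1 \<le> h" "0 < h" "hi < h" using lohi unfolding h_def by auto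
  define L where "L = C0 * h powr (\<gamma> - 1)"
  have gL: "\<bar>g s\<bar> \<le> L" if "0 \<le> s" "s \<le> h" for s
  proof -
    have "C0 * s powr (\<gamma> - 1) \<le> C0 * h powr (\<gamma> - 1)"
      using that C0 \<gamma> by (intro mult_left_mono powr_mono2) auto
    then show ?thesis using gb[of s] that unfolding L_def by linarith
  qed
  have L0: "0 \<le> L" unfolding L_def using C0 by simp
  \<comment> \<open>\<open>pt\<close> extends the pressure to the whole line, so that the normalization point \<open>h\<close> may lie above
     the range of the density.\<close>
  obtain pt where pt0: "pt lo = p lo" and ptd: "\<And>s. (pt has_real_derivative g s) (at s)"
    using antiderivative_on_line[OF cg] by blast
  have pteq: "pt s = p s" if "s \<in> {lo..hi}" for s
  proof -
    have "\<bar>(pt s - p s) - (pt lo - p lo)\<bar> \<le> 0 * \<bar>s - lo\<bar>"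
      by (rule derivative_bound_on_interval[of lo hi "\<lambda>s. pt s - p s" "\<lambda>s. g s - g s"])
         (use that lohi DERIV_diff[OF has_field_derivative_at_within[OF ptd] gd] in auto)
    then show ?thesis using pt0 by simp
  qed
  obtain A where Ah: "A h = 0" and Ad: "\<And>s. 0 < s \<Longrightarrow> (A has_real_derivative g s / s) (at s)"
  proof -
    have "continuous_on {s. 0 < ereal s} (\<lambda>s. g s / s)"
      by (intro continuous_intros continuous_on_subset[OF cg]) auto
    from antiderivative_on_halfline[OF this, of h 0] that h show ?thesis by auto
  qed
  define B where "B = C0 / (\<gamma> - 1) * h powr (\<gamma> - 1)"
  have B0: "0 \<le> B" unfolding B_def using C0 \<gamma> by simp
  have AB: "\<bar>A s\<bar> \<le> B" if "0 < s" "s \<le> h" for s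
  proof -
    have "\<bar>A h - A s\<bar> \<le> C0 / (\<gamma> - 1) * h powr (\<gamma> - 1)"
    proof (rule derivative_powr_bound[where f="\<lambda>s. g s / s"])
      fix x :: real assume x: "0 < x" "x \<le> h"
      show "\<bar>g x / x\<bar> \<le> C0 * x powr (\<gamma> - 1 - 1)"
      proof -
        have "\<bar>g x / x\<bar> = \<bar>g x\<bar> / x" using x by simp
        also have "\<dots> \<le> C0 * x powr (\<gamma> - 1) / x" using gb[of x] x by (intro divide_right_mono) auto
        also have "\<dots> = C0 * x powr (\<gamma> - 1 - 1)" using x powr_diff[of x "\<gamma> - 1" 1] by simp
        finally show ?thesis .
      qed
    qed (use Ad \<gamma> C0 that in auto)
    then show ?thesis unfolding B_def Ah by simp
  qed
  define P0 where "P0 s = s * A s - pt s" for s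
  have P0d: "(P0 has_real_derivative A s) (at s)" if "0 < s" for s
    unfolding P0_def using that by (auto intro!: derivative_eq_intros Ad ptd)
  have ptlip: "\<bar>pt s - pt t\<bar> \<le> L * \<bar>s - t\<bar>" if "s \<in> {0..h}" "t \<in> {0..h}" for s t
    by (rule derivative_bound_on_interval[of 0 h pt g])
       (use that gL in \<open>auto intro!: has_field_derivative_at_within[OF ptd]\<close>)
  define C where "C = C0 + L + 3 * B"
  have C: "0 \<le> C" "C0 \<le> C" "L + B \<le> C" "2 * B + C0 \<le> C" "L \<le> C" "B \<le> C"
    unfolding C_def using C0 L0 B0 by auto
  have P0lip: "\<bar>P0 s - P0 t\<bar> \<le> (L + B) * \<bar>s - t\<bar>" if "s \<in> {0..h}" "t \<in> {0..h}" for s t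
  proof -
    have *: "\<bar>P0 s - P0 t\<bar> \<le> (L + B) * \<bar>s - t\<bar>" if "t \<le> s" "s \<in> {0..h}" "t \<in> {0..h}" for s t
    proof (cases "t = 0")
      case True
      have "\<bar>s * A s\<bar> \<le> s * B"
      proof (cases "s = 0")
        case False
        then show ?thesis using AB[of s] that by (auto simp: abs_mult)
      qed auto
      moreover have "\<bar>pt s - pt 0\<bar> \<le> L * s" using ptlip[of s 0] that True by auto
      ultimately show ?thesis using True that unfolding P0_def by (simp add: algebra_simps)
    next
      case False
      have "\<bar>P0 s - P0 t\<bar> \<le> B * \<bar>s - t\<bar>"
        by (rule derivative_bound_on_interval[of t h P0 A])
           (use that False AB in \<open>auto intro!: has_field_derivative_at_within[OF P0d]\<close>)
      also have "\<dots> \<le> (L + B) * \<bar>s - t\<bar>" using L0 by (intro mult_right_mono) auto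
      finally show ?thesis .
    qed
    show ?thesis using *[of s t] *[of t s] that by (cases "t \<le> s") (auto simp: abs_minus_commute)
  qed
  have main: "\<exists>k A q. continuous_on UNIV k \<and>
        (\<forall>s. (A has_real_derivative k s) (at s)) \<and> (\<forall>s. (q has_real_derivative s * k s) (at s)) \<and>
        (\<forall>s\<in>{lo..hi}. \<bar>k s\<bar> \<le> C * \<delta> powr (\<gamma> - 2) \<and> \<bar>A s\<bar> \<le> C \<and> \<bar>q s - p s\<bar> \<le> C * \<delta> powr \<gamma> \<and>
           \<bar>s * A s - q s - P0 s\<bar> \<le> C * \<delta>)" if \<delta>: "0 < \<delta>" "\<delta> \<le> 1" for \<delta>
  proof -
    \<comment> \<open>\<open>k\<close> is the second derivative \<open>p' s / s\<close> of the potential, frozen in its denominator below \<open>\<delta>\<close>.\<close>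
    define k where "k s = g s / max s \<delta>" for s
    have ck: "continuous_on UNIV k" unfolding k_def using \<delta> by (intro continuous_intros cg) auto
    obtain A' where A'h: "A' h = 0" and A'd: "\<And>s. (A' has_real_derivative k s) (at s)"
      using antiderivative_on_line[OF ck] by blast
    have "continuous_on UNIV (\<lambda>s. s * k s)" by (intro continuous_intros ck)
    then obtain q where qh: "q h = pt h" and qd: "\<And>s. (q has_real_derivative s * k s) (at s)"
      using antiderivative_on_line by blast
    have kb: "\<bar>k s\<bar> \<le> C0 * (max s \<delta>) powr (\<gamma> - 2)" if "0 \<le> s" for s
    proof -
      have "\<bar>g s\<bar> \<le> C0 * (max s \<delta>) powr (\<gamma> - 1)"
        using gb[OF that] mult_left_mono[OF powr_mono2[of "\<gamma> - 1" s "max s \<delta>"] C0] that \<gamma> by auto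
      then have "\<bar>k s\<bar> \<le> C0 * (max s \<delta>) powr (\<gamma> - 1) / max s \<delta>"
        unfolding k_def using \<delta> by (auto simp: abs_div intro!: divide_right_mono)
      also have "\<dots> = C0 * (max s \<delta>) powr (\<gamma> - 2)"
        using \<delta> powr_diff[of "max s \<delta>" "\<gamma> - 1" 1] by (auto simp: algebra_simps)
      finally show ?thesis .
    qed
    have k1: "\<bar>k s\<bar> \<le> C0 * \<delta> powr (\<gamma> - 2)" if "0 \<le> s" for s
    proof -
      have "(max s \<delta>) powr (\<gamma> - 2) \<le> \<delta> powr (\<gamma> - 2)" using \<delta> \<gamma> by (intro powr_mono2') auto
      from mult_left_mono[OF this C0] kb[OF that] show ?thesis by linarith
    qed
    have A1: "\<bar>A' s\<bar> \<le> B" if "0 < s" "s \<le> h" for s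
    proof -
      have "\<bar>A' h - A' s\<bar> \<le> C0 / (\<gamma> - 1) * h powr (\<gamma> - 1)"
      proof (rule derivative_powr_bound[where f=k])
        fix x :: real assume x: "0 < x" "x \<le> h"
        have "(max x \<delta>) powr (\<gamma> - 2) \<le> x powr (\<gamma> - 2)" using x \<gamma> by (intro powr_mono2') auto
        from mult_left_mono[OF this C0] kb[of x] x show "\<bar>k x\<bar> \<le> C0 * x powr (\<gamma> - 1 - 1)" by simp
      qed (use A'd \<gamma> C0 that in auto)
      then show ?thesis unfolding B_def A'h by simp
    qed
    have A0: "\<bar>A' 0\<bar> \<le> B"
    proof (rule tendsto_upperbound)
      have "isCont A' 0" using A'd DERIV_isCont by blast
      then have "(A' \<longlongrightarrow> A' 0) (at_right 0)" unfolding isCont_def by (rule tendsto_within_subset) auto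
      then show "((\<lambda>s. \<bar>A' s\<bar>) \<longlongrightarrow> \<bar>A' 0\<bar>) (at_right 0)" by (intro tendsto_intros)
      show "\<forall>\<^sub>F s in at_right 0. \<bar>A' s\<bar> \<le> B"
        unfolding eventually_at_right_field using h A1 by (intro exI[of _ h]) auto
    qed auto
    have Aeq: "A' s = A s" and qeq: "q s = pt s" if s: "\<delta> \<le> s" "s \<le> h" for s
    proof -
      have keq: "k t = g t / t" if "\<delta> \<le> t" for t using that \<delta> unfolding k_def by auto
      have "\<bar>(A' s - A s) - (A' h - A h)\<bar> \<le> 0 * \<bar>s - h\<bar>"
      proof (rule derivative_bound_on_interval[of \<delta> h "\<lambda>s. A' s - A s" "\<lambda>s. k s - g s / s"])
        fix x assume x: "x \<in> {\<delta>..h}"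
        show "((\<lambda>s. A' s - A s) has_real_derivative k x - g x / x) (at x within {\<delta>..h})"
          by (intro DERIV_diff has_field_derivative_at_within[OF A'd] has_field_derivative_at_within[OF Ad])
             (use x \<delta> in auto)
      qed (use s \<delta> keq in auto)
      then show "A' s = A s" using Ah A'h by simp
      have "\<bar>(q s - pt s) - (q h - pt h)\<bar> \<le> 0 * \<bar>s - h\<bar>"
      proof (rule derivative_bound_on_interval[of \<delta> h "\<lambda>s. q s - pt s" "\<lambda>s. s * k s - g s"])
        fix x assume x: "x \<in> {\<delta>..h}"
        show "((\<lambda>s. q s - pt s) has_real_derivative x * k x - g x) (at x within {\<delta>..h})"
          by (intro DERIV_diff has_field_derivative_at_within[OF qd] has_field_derivative_at_within[OF ptd])
        show "\<bar>x * k x - g x\<bar> \<le> 0" using keq[of x] x \<delta> by auto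
      qed (use s \<delta> in auto)
      then show "q s = pt s" using qh by simp
    qed
    have qb: "\<bar>q s - pt s\<bar> \<le> C0 * \<delta> powr \<gamma>" if s: "0 \<le> s" "s \<le> h" for s
    proof (cases "\<delta> \<le> s")
      case True then show ?thesis using qeq s C0 by simp
    next
      case False
      have "\<bar>(q s - pt s) - (q \<delta> - pt \<delta>)\<bar> \<le> (C0 * \<delta> powr (\<gamma> - 1)) * \<bar>s - \<delta>\<bar>"
      proof (rule derivative_bound_on_interval[of 0 \<delta> "\<lambda>s. q s - pt s" "\<lambda>s. s * k s - g s"])
        fix x assume x: "x \<in> {0..\<delta>}"
        show "((\<lambda>s. q s - pt s) has_real_derivative x * k x - g x) (at x within {0..\<delta>})"
          by (auto intro!: DERIV_diff has_field_derivative_at_within[OF qd]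
              has_field_derivative_at_within[OF ptd])
        have "x * k x - g x = - (g x * (1 - x / \<delta>))" unfolding k_def using x \<delta> by (auto simp: field_simps max_def)
        then have "\<bar>x * k x - g x\<bar> = \<bar>g x\<bar> * (1 - x / \<delta>)"
          using x \<delta> by (simp add: abs_mult)
        also have "\<dots> \<le> \<bar>g x\<bar> * 1" using x \<delta> by (intro mult_left_mono) auto
        also have "\<dots> \<le> C0 * x powr (\<gamma> - 1)" using gb x by auto
        also have "\<dots> \<le> C0 * \<delta> powr (\<gamma> - 1)" using x \<gamma> C0 by (intro mult_left_mono powr_mono2) auto
        finally show "\<bar>x * k x - g x\<bar> \<le> C0 * \<delta> powr (\<gamma> - 1)" .
      qed (use False s \<delta> in auto)
      also have "\<dots> \<le> (C0 * \<delta> powr (\<gamma> - 1)) * \<delta>"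
        using False s C0 by (intro mult_left_mono) auto
      also have "\<dots> = C0 * \<delta> powr \<gamma>" using \<delta> by (simp add: powr_diff)
      finally show ?thesis using qeq[of \<delta>] \<delta> h by simp
    qed
    have Pb: "\<bar>s * A' s - q s - P0 s\<bar> \<le> C * \<delta>" if s: "0 \<le> s" "s \<le> h" for s
    proof (cases "\<delta> \<le> s")
      case True then show ?thesis using qeq[of s] Aeq[of s] s C \<delta> unfolding P0_def by simp
    next
      case False
      have "\<bar>s * A' s\<bar> \<le> \<delta> * B"
        using A0 A1[of s] s False \<delta> by (cases "s = 0") (auto simp: abs_mult intro!: mult_mono)
      moreover have "\<bar>s * A s\<bar> \<le> \<delta> * B"
        using AB[of s] s False \<delta> B0 by (cases "s = 0") (auto simp: abs_mult intro!: mult_mono)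
      moreover have "\<bar>q s - pt s\<bar> \<le> C0 * \<delta>"
      proof -
        have "\<delta> powr \<gamma> \<le> \<delta> powr 1" using \<delta> \<gamma> by (intro powr_mono') auto
        from mult_left_mono[OF this C0] qb[OF s] \<delta> show ?thesis by simp
      qed
      ultimately have "\<bar>s * A' s - q s - P0 s\<bar> \<le> (2 * B + C0) * \<delta>"
        unfolding P0_def by (simp add: algebra_simps)
      also have "\<dots> \<le> C * \<delta>" using C \<delta> by (intro mult_right_mono) auto
      finally show ?thesis .
    qed
    have mono: "C0 * x powr y \<le> C * x powr y" for x y using C by (intro mult_right_mono) auto
    show ?thesis
    proof (rule exI[of _ k], rule exI[of _ A'], rule exI[of _ q], intro conjI ballI allI)
      fix s assume s: "s \<in> {lo..hi}"
      then have s': "0 \<le> s" "s \<le> h" using lohi h by auto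
      show "\<bar>k s\<bar> \<le> C * \<delta> powr (\<gamma> - 2)" using k1[OF s'(1)] mono[of \<delta> "\<gamma> - 2"] by linarith
      show "\<bar>A' s\<bar> \<le> C" using A0 A1[of s] s' C by (cases "s = 0") auto
      show "\<bar>q s - p s\<bar> \<le> C * \<delta> powr \<gamma>" using qb[OF s'] mono[of \<delta> \<gamma>] pteq[OF s] by simp
      show "\<bar>s * A' s - q s - P0 s\<bar> \<le> C * \<delta>" by (rule Pb[OF s'])
    qed (use ck A'd qd in auto)
  qed
  \<comment> \<open>On positive densities \<open>(P0 s / s)' = p s / s\<^sup>2\<close>, which fixes the potential up to a multiple of the density.\<close>
  have potdiff: "pressure_potential p s / s - pressure_potential p t / t = P0 s / s - P0 t / t"
    if st: "s \<in> {lo..hi}" "t \<in> {lo..hi}" "0 < s" "0 < t" for s t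
  proof -
    have sub: "{min t s..max t s} \<subseteq> {lo..hi}" "\<And>x. x \<in> {min t s..max t s} \<Longrightarrow> 0 < x" using st by auto
    have cp: "continuous_on {lo..hi} p"
      using gd DERIV_continuous_on by blast
    have "(LBINT x=ereal t..ereal s. p x / x\<^sup>2) = P0 s / s - P0 t / t"
    proof (rule interval_integral_FTC_finite)
      show "continuous_on {min t s..max t s} (\<lambda>x. p x / x\<^sup>2)"
        using sub(2) by (intro continuous_intros continuous_on_subset[OF cp sub(1)]) fastforce
      fix x assume "min t s \<le> x" "x \<le> max t s"
      then have x: "x \<in> {lo..hi}" "0 < x" using sub by auto
      have "((\<lambda>s. P0 s / s) has_real_derivative (A x * x - P0 x * 1) / (x * x)) (at x)"
        by (intro derivative_intros P0d) (use x in auto)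
      moreover have "(A x * x - P0 x * 1) / (x * x) = p x / x\<^sup>2"
        unfolding P0_def using pteq x by (simp add: power2_eq_square)
      ultimately have "((\<lambda>s. P0 s / s) has_real_derivative p x / x\<^sup>2) (at x)" by simp
      then show "((\<lambda>s. P0 s / s) has_vector_derivative p x / x\<^sup>2) (at x within {min t s..max t s})"
        by (simp add: has_real_derivative_iff_has_vector_derivative has_vector_derivative_at_within)
    qed
    moreover have "(LBINT x=1..ereal t. p x / x\<^sup>2) + (LBINT x=ereal t..ereal s. p x / x\<^sup>2) = (LBINT x=1..ereal s. p x / x\<^sup>2)"
    proof (rule interval_integral_sum)
      define m M where "m = min 1 (min t s)" and "M = max 1 (max t s)"
      have mM: "m \<in> {min lo 1..max hi 1}" "M \<in> {min lo 1..max hi 1}" "0 < m" "0 < M" "m \<le> 1" "1 \<le> M"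
        using st unfolding m_def M_def by auto
      have i: "interval_lebesgue_integrable lborel 1 (ereal m) (\<lambda>s. p s / s\<^sup>2)"
        "interval_lebesgue_integrable lborel 1 (ereal M) (\<lambda>s. p s / s\<^sup>2)"
        using pot mM unfolding potential_defined_on_def by auto
      have "set_integrable lborel {m..1} (\<lambda>s. p s / s\<^sup>2)"
        using i(1) mM unfolding interval_integrable_endpoints_reverse[of 1 "ereal m"]
        by (subst set_integrable_discrete_difference[where X="{m, 1}" and B="{m<..<1}"])
           (auto simp: interval_lebesgue_integrable_def one_ereal_def)
      moreover have "set_integrable lborel {1..M} (\<lambda>s. p s / s\<^sup>2)"
        using i(2) mM
        by (subst set_integrable_discrete_difference[where X="{1, M}" and B="{1<..<M}"])
           (auto simp: interval_lebesgue_integrable_def one_ereal_def)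
      ultimately have "set_integrable lborel ({m..1} \<union> {1..M}) (\<lambda>s. p s / s\<^sup>2)"
        by (rule set_integrable_Un) auto
      then have "set_integrable lborel {m<..<M} (\<lambda>s. p s / s\<^sup>2)"
        by (rule set_integrable_subset) (use mM in auto)
      moreover have "min (1::ereal) (min (ereal t) (ereal s)) = ereal m" "max (1::ereal) (max (ereal t) (ereal s)) = ereal M"
        unfolding m_def M_def by (auto simp: one_ereal_def min_def max_def)
      ultimately show "interval_lebesgue_integrable lborel (min 1 (min (ereal t) (ereal s)))
          (max 1 (max (ereal t) (ereal s))) (\<lambda>s. p s / s\<^sup>2)"
        using mM by (simp add: interval_lebesgue_integrable_def)
    qed
    ultimately show ?thesis using st unfolding pressure_potential_def by simp
  qed
  have pot0: "pressure_potential p 0 = P0 0" if "lo = 0"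
  proof -
    have "pressure_potential p 0 = - p 0"
      using pot that lohi vac unfolding potential_defined_on_def
      by (intro pressure_potential_at_vacuum) auto
    then show ?thesis unfolding P0_def using pteq[of 0] that lohi by simp
  qed
  define c where "c = (if hi = 0 then 0 else (pressure_potential p hi - P0 hi) / hi)"
  have potc: "pressure_potential p s = P0 s + c * s" if s: "s \<in> {lo..hi}" for s
  proof (cases "s = 0")
    case True then show ?thesis using pot0 s lohi by auto
  next
    case False
    then have "0 < s" "0 < hi" using s lohi by auto
    then show ?thesis using potdiff[of s hi] s lohi unfolding c_def
      by (simp add: field_simps)
  qed
  have taylor: "\<bar>p s - p t - g t * (s - t)\<bar> \<le> C0 * \<bar>s - t\<bar> powr \<gamma>"
    if st: "s \<in> {lo..hi}" "t \<in> {lo..hi}" for s t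
  proof -
    have sub: "{min s t..max s t} \<subseteq> {lo..hi}" using st by auto
    have "\<bar>(pt s - g t * s) - (pt t - g t * t)\<bar> \<le> (C0 * \<bar>s - t\<bar> powr (\<gamma> - 1)) * \<bar>s - t\<bar>"
    proof (rule derivative_bound_on_interval[of "min s t" "max s t" "\<lambda>s. pt s - g t * s" "\<lambda>s. g s - g t"])
      fix x assume x: "x \<in> {min s t..max s t}"
      show "((\<lambda>s. pt s - g t * s) has_real_derivative g x - g t) (at x within {min s t..max s t})"
        by (auto intro!: derivative_eq_intros has_field_derivative_at_within[OF ptd])
      have "\<bar>g x - g t\<bar> \<le> C0 * \<bar>x - t\<bar> powr (\<gamma> - 1)" using gh x sub st by blast
      also have "\<dots> \<le> C0 * \<bar>s - t\<bar> powr (\<gamma> - 1)"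
        using x \<gamma> C0 by (intro mult_left_mono powr_mono2) auto
      finally show "\<bar>g x - g t\<bar> \<le> C0 * \<bar>s - t\<bar> powr (\<gamma> - 1)" .
    qed auto
    also have "\<dots> = C0 * \<bar>s - t\<bar> powr \<gamma>"
      by (cases "s = t") (simp_all add: powr_diff)
    finally show ?thesis using pteq st by (simp add: algebra_simps)
  qed
  show ?thesis
  proof (rule that[of C P0 c g])
    fix s t assume st: "s \<in> {lo..hi}" "t \<in> {lo..hi}"
    then have st': "s \<in> {0..h}" "t \<in> {0..h}" using lohi h by auto
    show "\<bar>P0 s - P0 t\<bar> \<le> C * \<bar>s - t\<bar>"
      using P0lip[OF st'] mult_right_mono[OF C(3), of "\<bar>s - t\<bar>"] by simp
    show "\<bar>p s - p t\<bar> \<le> C * \<bar>s - t\<bar>"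
      using ptlip[OF st'] mult_right_mono[OF C(5), of "\<bar>s - t\<bar>"] pteq st by simp
    show "\<bar>p s - p t - g t * (s - t)\<bar> \<le> C * \<bar>s - t\<bar> powr \<gamma>"
      using taylor[OF st] mult_right_mono[OF C(2), of "\<bar>s - t\<bar> powr \<gamma>"] by simp
  qed (use C potc main in auto)
qed

section \<open>Lebesgue and Besov norms in terms of integrals\<close>

text \<open>
  The integrand of the \<open>q\<close>-th moment, with the convex indicator of \<open>[0,1]\<close>
  as its limit for \<open>q = \<infinity>\<close>. In terms of it a norm bound becomes the bound of an
  integral for all exponents alike.
\<close>
definition Lq_gauge :: "ennreal \<Rightarrow> real \<Rightarrow> ennreal" where
  "Lq_gauge q t = (if q = \<infinity> then (if t \<le> 1 then 0 else \<infinity>) else ennreal (t powr enn2real q))"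

lemma measurable_gauge[measurable]: "Lq_gauge q \<in> borel_measurable borel"
  unfolding Lq_gauge_def by (cases "q = \<infinity>") auto

lemma Lq_gauge_mono: "0 \<le> s \<Longrightarrow> s \<le> t \<Longrightarrow> Lq_gauge q s \<le> Lq_gauge q t"
  unfolding Lq_gauge_def by (auto intro!: ennreal_leI powr_mono2)

lemma Lq_gauge_0[simp]: "Lq_gauge q 0 = 0"
  unfolding Lq_gauge_def by auto

lemma enn2real_pos_of_ge_2:
  assumes "2 \<le> q" "q \<noteq> \<infinity>" shows "2 \<le> enn2real q"
  using assms by (cases q) (auto simp: ennreal_numeral[symmetric] simp del: ennreal_numeral)

text \<open>
  For \<open>q = \<infinity>\<close> the exponent \<open>1 / enn2real q\<close> is 0, because
  \<open>enn2real \<infinity> = 0\<close> and division by 0 gives 0; so the same formula serves all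
  exponents.
\<close>
lemma Lq_gauge_inverse_bound:
  assumes "2 \<le> q" "0 \<le> t" "Lq_gauge q t \<le> ennreal w" "1 \<le> w"
  shows "t \<le> w powr (1 / enn2real q)"
proof (cases "q = \<infinity>")
  case True
  then show ?thesis using assms by (auto simp: Lq_gauge_def top_unique split: if_splits)
next
  case False
  then have q: "2 \<le> enn2real q" using enn2real_pos_of_ge_2 assms by auto
  have "t powr enn2real q \<le> w" using assms False by (simp add: Lq_gauge_def)
  then have "(t powr enn2real q) powr (1 / enn2real q) \<le> w powr (1 / enn2real q)"
    using q by (intro powr_mono2) auto
  then show ?thesis using q assms by (simp add: powr_powr)
qed

text \<open>
  The passage to a Borel function \<open>w0\<close> makes the integrand usable in iterated integrals.
\<close>
lemma Lq_norm_gauge: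
  fixes w w0 :: "'a::euclidean_space \<Rightarrow> 'b::euclidean_space"
  assumes q: "2 \<le> q" and A: "A \<in> sets borel" and w0[measurable]: "w0 \<in> borel_measurable borel"
    and ae: "AE y in lebesgue_on A. w y = w0 y" and B: "0 < B" and le: "Lq_norm q A w \<le> ennreal B"
  shows "(\<integral>\<^sup>+y. indicator A y * Lq_gauge q (norm (w0 y) / B) \<partial>lborel) \<le> 1"
proof -
  have A': "A \<inter> space lebesgue \<in> sets lebesgue" using A by auto
  have [measurable]: "A \<in> sets lborel" using A by simp
  note A[measurable]
  have eq: "(\<integral>\<^sup>+y. indicator A y * f y \<partial>lborel) = (\<integral>\<^sup>+y. f y \<partial>lebesgue_on A)" for f
    using nn_integral_restrict_space[OF A', of f] by (simp add: nn_integral_completion mult.commute)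
  show ?thesis
  proof (cases "q = \<infinity>")
    case True
    have "AE y in lebesgue_on A. ennreal (norm (w y)) \<le> ennreal B"
      using esssup_AE[of "\<lambda>y. ennreal (norm (w y))" "lebesgue_on A"]
    proof eventually_elim
      case (elim y)
      then show ?case using le True unfolding Lq_norm_def by (auto intro: order_trans)
    qed
    with ae have "AE y in lebesgue_on A. Lq_gauge q (norm (w0 y) / B) = 0"
      by eventually_elim (use True B in \<open>auto simp: Lq_gauge_def\<close>)
    then have "(\<integral>\<^sup>+y. Lq_gauge q (norm (w0 y) / B) \<partial>lebesgue_on A) = 0"
      by (subst nn_integral_cong_AE[where v="\<lambda>_. 0"]) auto
    then show ?thesis unfolding eq by simp
  next
    case False
    define e where "e = enn2real q"
    have e: "2 \<le> e" unfolding e_def using enn2real_pos_of_ge_2 q False by auto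
    define X where "X = (\<integral>\<^sup>+ y. ennreal (norm (w y) powr e) \<partial>lebesgue_on A)"
    have XB: "ennreal_root q X \<le> ennreal B" using le False unfolding Lq_norm_def X_def e_def by simp
    then have X: "X \<noteq> \<infinity>" "enn2real X powr (1 / e) \<le> B"
      using B unfolding ennreal_root_def e_def by (auto simp: top_unique split: if_splits)
    have "(enn2real X powr (1 / e)) powr e \<le> B powr e" using X e by (intro powr_mono2) auto
    then have "enn2real X \<le> B powr e" using e by (simp add: powr_powr)
    then have X2: "X \<le> ennreal (B powr e)" using X(1) by (cases X) (auto simp: ennreal_leI)
    have "(\<integral>\<^sup>+y. indicator A y * Lq_gauge q (norm (w0 y) / B) \<partial>lborel)
        = (\<integral>\<^sup>+y. ennreal (1 / B powr e) * (indicator A y * ennreal (norm (w0 y) powr e)) \<partial>lborel)"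
      using False B by (intro nn_integral_cong)
        (auto simp: Lq_gauge_def e_def powr_divide ennreal_mult[symmetric] split: split_indicator)
    also have "\<dots> = ennreal (1 / B powr e) * (\<integral>\<^sup>+y. indicator A y * ennreal (norm (w0 y) powr e) \<partial>lborel)"
      by (rule nn_integral_cmult) measurable
    also have "(\<integral>\<^sup>+y. indicator A y * ennreal (norm (w0 y) powr e) \<partial>lborel) = X"
      unfolding eq X_def by (rule nn_integral_cong_AE) (use ae in eventually_elim, simp)
    also have "ennreal (1 / B powr e) * X \<le> ennreal (1 / B powr e) * ennreal (B powr e)"
      by (intro mult_left_mono X2) auto
    also have "\<dots> = 1" using B by (simp add: ennreal_mult[symmetric])
    finally show ?thesis .
  qed
qed

lemma besov_bounds:
  fixes w :: "real \<times> (real ^ 'd) \<Rightarrow> 'b::real_normed_vector"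
  assumes "w \<in> besov_space T \<alpha> q"
  obtains B where "1 \<le> B" "Lq_norm q (spacetime T) w \<le> ennreal B"
    "\<And>\<xi>. \<xi> \<noteq> 0 \<Longrightarrow> Lq_norm q {y \<in> spacetime T. fst (y + \<xi>) \<in> {0<..<T}} (\<lambda>y. w (y + \<xi>) - w y)
        \<le> ennreal (B * norm \<xi> powr \<alpha>)"
proof -
  define S where "S = (SUP \<xi> \<in> - {0}. Lq_norm q {y \<in> spacetime T. fst (y + \<xi>) \<in> {0<..<T}} (\<lambda>y. w (y + \<xi>) - w y)
        / ennreal (norm \<xi> powr \<alpha>))"
  have fin: "Lq_norm q (spacetime T) w + S < \<infinity>"
    using assms unfolding besov_space_def besov_norm_def S_def by auto
  define B where "B = enn2real (Lq_norm q (spacetime T) w + S) + 1"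
  have le: "Lq_norm q (spacetime T) w + S \<le> ennreal B"
    using fin unfolding B_def
    by (cases "Lq_norm q (spacetime T) w + S") (auto intro!: ennreal_leI)
  show ?thesis
  proof (rule that[of B])
    show "1 \<le> B" unfolding B_def by simp
    show "Lq_norm q (spacetime T) w \<le> ennreal B"
      by (rule order_trans[OF _ le]) (simp add: add_increasing2)
    fix \<xi> :: "real \<times> (real ^ 'd)" assume "\<xi> \<noteq> 0"
    define N where "N = Lq_norm q {y \<in> spacetime T. fst (y + \<xi>) \<in> {0<..<T}} (\<lambda>y. w (y + \<xi>) - w y)"
    define x where "x = norm \<xi> powr \<alpha>"
    have x: "0 < x" unfolding x_def using \<open>\<xi> \<noteq> 0\<close> by simp
    have "N / ennreal x \<le> S" unfolding S_def N_def x_def using \<open>\<xi> \<noteq> 0\<close> by (intro SUP_upper) auto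
    also have "S \<le> ennreal B" by (rule order_trans[OF _ le]) (simp add: add_increasing)
    finally have "N / ennreal x * ennreal x \<le> ennreal B * ennreal x" by (rule mult_right_mono) auto
    moreover have "N / ennreal x * ennreal x = N"
      using x ennreal_divide_times[of N "ennreal x" "ennreal x"] by (simp add: ennreal_divide_self)
    moreover have "ennreal B * ennreal x = ennreal (B * x)"
      using x unfolding B_def by (simp add: ennreal_mult)
    ultimately show "N \<le> ennreal (B * norm \<xi> powr \<alpha>)" unfolding x_def by simp
  qed
qed

section \<open>Integration over the torus\<close>

text \<open>Integrals over the torus at all times are integrals over this set.\<close>
definition strip :: "(real \<times> (real ^ 'd)) set" where
  "strip = UNIV \<times> cell"

definition lattice_vec :: "int ^ 'd \<Rightarrow> real \<times> (real ^ 'd)" where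
  "lattice_vec k = (0, \<chi> i. real_of_int (k $ i))"

lemma cell_borel[measurable]: "cell \<in> sets borel"
  unfolding cell_def by measurable

lemma strip_borel[measurable]: "strip \<in> sets borel"
  unfolding strip_def using borel_Times[of UNIV cell] by simp

lemma mem_strip: "(t, x) \<in> strip \<longleftrightarrow> (\<forall>i. 0 \<le> x $ i \<and> x $ i < 1)"
  unfolding strip_def cell_def by auto

text \<open>
  The integer part of the space coordinate is the only lattice vector that moves a point into the
  strip.
\<close>
lemma indicator_strip_tiling:
  "(\<integral>\<^sup>+k. indicator strip (y - lattice_vec k) \<partial>count_space UNIV) = 1"
proof -
  obtain t x where y: "y = (t, x)" by (cases y)
  define k0 where "k0 = (\<chi> i. \<lfloor>x $ i\<rfloor>)"
  have "y - lattice_vec k \<in> strip \<longleftrightarrow> k = k0" for k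
    unfolding y lattice_vec_def minus_prod_def fst_conv snd_conv mem_strip k0_def vec_eq_iff
    by (simp add: all_conj_distrib[symmetric]) (metis add.commute diff_ge_0_iff_ge diff_less_eq floor_unique floor_correct less_add_one of_int_floor_le floor_eq_iff)
  then have "(\<lambda>k. indicator strip (y - lattice_vec k) :: ennreal) = indicator {k0}"
    by (auto simp: indicator_def)
  then show ?thesis by simp
qed

lemma space_periodic_lattice:
  assumes "space_periodic f"
  shows "f (y + lattice_vec k) = f y"
proof -
  have nat: "f (t, x + real n *\<^sub>R axis i 1) = f (t, x)" for t x i n
  proof (induction n arbitrary: x)
    case (Suc n)
    have "f (t, x + real (Suc n) *\<^sub>R axis i 1) = f (t, (x + real n *\<^sub>R axis i 1) + axis i 1)"
      by (simp add: algebra_simps)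
    also have "\<dots> = f (t, x + real n *\<^sub>R axis i 1)"
      using assms unfolding space_periodic_def by blast
    finally show ?case using Suc by simp
  qed simp
  have int: "f (t, x + real_of_int n *\<^sub>R axis i 1) = f (t, x)" for t x i n
  proof (cases n)
    case (nonneg m)
    then show ?thesis using nat[of t x m i] by simp
  next
    case (neg m)
    then show ?thesis using nat[of t "x + real_of_int n *\<^sub>R axis i 1" "Suc m" i]
      by (simp add: algebra_simps del: of_nat_Suc)
  qed
  have sum: "f (t, x + (\<Sum>i\<in>S. real_of_int (k $ i) *\<^sub>R axis i 1)) = f (t, x)" for t x and S :: "'a set"
  proof (induction S arbitrary: x rule: infinite_finite_induct)
    case (insert i S)
    have "f (t, x + (\<Sum>i\<in>insert i S. real_of_int (k $ i) *\<^sub>R axis i 1))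
        = f (t, (x + real_of_int (k $ i) *\<^sub>R axis i 1) + (\<Sum>i\<in>S. real_of_int (k $ i) *\<^sub>R axis i 1))"
      using insert by (simp add: algebra_simps)
    then show ?case using insert int by simp
  qed auto
  obtain t x where y: "y = (t, x)" by (cases y)
  have "(\<chi> i. real_of_int (k $ i)) = (\<Sum>i\<in>UNIV. real_of_int (k $ i) *\<^sub>R axis i 1)"
    by (simp add: vec_eq_iff axis_def if_distrib cong: if_cong)
  then show ?thesis using sum[of t x UNIV] unfolding y lattice_vec_def by simp
qed

lemma nn_integral_lborel_translate:
  fixes f :: "'a::euclidean_space \<Rightarrow> ennreal"
  assumes [measurable]: "f \<in> borel_measurable borel"
  shows "(\<integral>\<^sup>+y. f (y + c) \<partial>lborel) = (\<integral>\<^sup>+y. f y \<partial>lborel)"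
  by (subst (2) lborel_distr_plus[of c, symmetric], subst nn_integral_distr) (auto simp: add.commute)

text \<open>
  Both the strip and its translate are fundamental domains of the lattice: inserting the tiling
  identity of either one into the integral over the other gives the same double sum.
\<close>
lemma nn_integral_strip_shift:
  fixes f :: "real \<times> (real ^ 'd) \<Rightarrow> ennreal"
  assumes f[measurable]: "f \<in> borel_measurable borel" and per: "space_periodic f"
  shows "(\<integral>\<^sup>+y. indicator strip y * f (y + \<xi>) \<partial>lborel) = (\<integral>\<^sup>+y. indicator strip y * f y \<partial>lborel)"
proof -
  have "(\<integral>\<^sup>+y. indicator strip y * f (y + \<xi>) \<partial>lborel) = (\<integral>\<^sup>+y. indicator strip (y - \<xi>) * f y \<partial>lborel)"
    using nn_integral_lborel_translate[of "\<lambda>y. indicator strip (y - \<xi>) * f y" \<xi>] by simp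
  also have "\<dots> = (\<integral>\<^sup>+y. (\<integral>\<^sup>+k. indicator strip (y - lattice_vec k) * (indicator strip (y - \<xi>) * f y) \<partial>count_space UNIV) \<partial>lborel)"
    by (simp add: nn_integral_multc indicator_strip_tiling)
  also have "\<dots> = (\<integral>\<^sup>+k. (\<integral>\<^sup>+y. indicator strip (y - lattice_vec k) * (indicator strip (y - \<xi>) * f y) \<partial>lborel) \<partial>count_space UNIV)"
    by (rule nn_integral_count_space_nn_integral) auto
  also have "\<dots> = (\<integral>\<^sup>+k. (\<integral>\<^sup>+y. indicator strip y * (indicator strip (y + lattice_vec k - \<xi>) * f y) \<partial>lborel) \<partial>count_space UNIV)"
  proof (rule nn_integral_cong)
    fix k :: "int ^ 'd"
    show "(\<integral>\<^sup>+y. indicator strip (y - lattice_vec k) * (indicator strip (y - \<xi>) * f y) \<partial>lborel)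
        = (\<integral>\<^sup>+y. indicator strip y * (indicator strip (y + lattice_vec k - \<xi>) * f y) \<partial>lborel)"
      using nn_integral_lborel_translate[of "\<lambda>y. indicator strip (y - lattice_vec k) * (indicator strip (y - \<xi>) * f y)" "lattice_vec k"]
      by (simp add: space_periodic_lattice[OF per])
  qed
  also have "\<dots> = (\<integral>\<^sup>+y. (\<integral>\<^sup>+k. indicator strip y * (indicator strip (y + lattice_vec k - \<xi>) * f y) \<partial>count_space UNIV) \<partial>lborel)"
    by (rule nn_integral_count_space_nn_integral[symmetric]) auto
  also have "\<dots> = (\<integral>\<^sup>+y. (indicator strip y * f y) * (\<integral>\<^sup>+k. indicator strip (y - \<xi> - lattice_vec k) \<partial>count_space UNIV) \<partial>lborel)"
  proof (rule nn_integral_cong)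
    fix y :: "real \<times> (real ^ 'd)"
    have "(\<integral>\<^sup>+k. indicator strip (y - \<xi> - lattice_vec k) \<partial>count_space UNIV)
        = (\<integral>\<^sup>+k. indicator strip (y - \<xi> - lattice_vec (- k)) \<partial>count_space UNIV)"
      by (rule nn_integral_bij_count_space[symmetric]) (auto simp: bij_def inj_def surj_def intro: exI[of _ "- _"])
    moreover have "y - \<xi> - lattice_vec (- k) = y + lattice_vec k - \<xi>" for k
      by (auto simp: lattice_vec_def vec_eq_iff prod_eq_iff)
    ultimately show "(\<integral>\<^sup>+k. indicator strip y * (indicator strip (y + lattice_vec k - \<xi>) * f y) \<partial>count_space UNIV)
      = (indicator strip y * f y) * (\<integral>\<^sup>+k. indicator strip (y - \<xi> - lattice_vec k) \<partial>count_space UNIV)"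
      by (simp add: nn_integral_cmult[symmetric] mult_ac)
  qed
  also have "\<dots> = (\<integral>\<^sup>+y. indicator strip y * f y \<partial>lborel)" by (simp add: indicator_strip_tiling)
  finally show ?thesis .
qed

lemma
  fixes f :: "real \<times> (real ^ 'd) \<Rightarrow> real"
  assumes f[measurable]: "f \<in> borel_measurable borel" and per: "space_periodic f"
  shows set_integrable_strip_shift: "set_integrable lborel strip (\<lambda>y. f (y + \<xi>)) \<longleftrightarrow> set_integrable lborel strip f"
    and set_integral_strip_shift: "(LBINT y:strip. f (y + \<xi>)) = (LBINT y:strip. f y)"
proof -
  have eq: "(\<integral>\<^sup>+y. ennreal (g (indicator strip y *\<^sub>R f (y + \<xi>))) \<partial>lborel)
      = (\<integral>\<^sup>+y. ennreal (g (indicator strip y *\<^sub>R f y)) \<partial>lborel)"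
    if [measurable]: "g \<in> borel_measurable borel" and "g 0 = 0" for g :: "real \<Rightarrow> real"
  proof -
    have *: "ennreal (g (indicator strip y *\<^sub>R f z)) = indicator strip y * ennreal (g (f z))" for y z
      using \<open>g 0 = 0\<close> by (auto split: split_indicator)
    have "space_periodic (\<lambda>y. ennreal (g (f y)))" using per by (simp add: space_periodic_def)
    from nn_integral_strip_shift[OF _ this] show ?thesis unfolding * by simp
  qed
  show i: "set_integrable lborel strip (\<lambda>y. f (y + \<xi>)) \<longleftrightarrow> set_integrable lborel strip f"
    unfolding set_integrable_def integrable_iff_bounded using eq[of norm] by simp
  show "(LBINT y:strip. f (y + \<xi>)) = (LBINT y:strip. f y)"
  proof (cases "set_integrable lborel strip f")
    case True
    have "integrable lborel (\<lambda>y. indicator strip y *\<^sub>R f y)" "integrable lborel (\<lambda>y. indicator strip y *\<^sub>R f (y + \<xi>))"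
      using True i unfolding set_integrable_def by auto
    then show ?thesis unfolding set_lebesgue_integral_def
      using eq[of "\<lambda>x. x"] eq[of uminus] by (simp add: real_lebesgue_integral_def)
  next
    case False
    then show ?thesis using i unfolding set_integrable_def set_lebesgue_integral_def
      by (simp add: not_integrable_integral_eq)
  qed
qed

section \<open>Mollification\<close>

definition dir_deriv :: "'a \<Rightarrow> ('a::euclidean_space \<Rightarrow> real) \<Rightarrow> 'a \<Rightarrow> real" where
  "dir_deriv v f y = frechet_derivative f (at y) v"

text \<open>
  Continuity is required of all directional derivatives, which is what the classical notion amounts to
  in finite dimension.
\<close>
definition C1 :: "('a::euclidean_space \<Rightarrow> real) \<Rightarrow> bool" where
  "C1 f \<longleftrightarrow> (\<forall>y. f differentiable (at y)) \<and> (\<forall>v. continuous_on UNIV (dir_deriv v f))"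

lemma dir_deriv_eqI: "(f has_derivative f') (at y) \<Longrightarrow> dir_deriv v f y = f' v"
  unfolding dir_deriv_def using frechet_derivative_at by metis

lemma has_derivative_dir_deriv:
  assumes "f differentiable (at y)" shows "(f has_derivative (\<lambda>v. dir_deriv v f y)) (at y)"
  using assms unfolding dir_deriv_def frechet_derivative_works .

lemma C1_has_derivative: "C1 f \<Longrightarrow> (f has_derivative (\<lambda>v. dir_deriv v f y)) (at y)"
  unfolding C1_def by (auto intro: has_derivative_dir_deriv)

lemma C1_continuous: "C1 f \<Longrightarrow> continuous_on UNIV f"
  using C1_has_derivative has_derivative_continuous by (metis continuous_at_imp_continuous_on)

lemma C1_dir_deriv_continuous: "C1 f \<Longrightarrow> continuous_on UNIV (dir_deriv v f)"
  unfolding C1_def by auto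

lemma C1_I:
  assumes "\<And>y. (f has_derivative f' y) (at y)" "\<And>v. continuous_on UNIV (\<lambda>y. f' y v)"
  shows "C1 f"
proof -
  have "dir_deriv v f = (\<lambda>y. f' y v)" for v using dir_deriv_eqI[OF assms(1)] by auto
  then show ?thesis unfolding C1_def using assms differentiableI by metis
qed

lemma dir_deriv_mult:
  assumes "C1 f" "C1 g"
  shows "dir_deriv v (\<lambda>y. f y * g y) y = f y * dir_deriv v g y + dir_deriv v f y * g y"
  by (rule dir_deriv_eqI) (rule has_derivative_mult[OF C1_has_derivative[OF assms(1)] C1_has_derivative[OF assms(2)]])

lemma C1_mult:
  assumes "C1 f" "C1 g" shows "C1 (\<lambda>y. f y * g y)"
  by (rule C1_I[OF has_derivative_mult[OF C1_has_derivative[OF assms(1)] C1_has_derivative[OF assms(2)]]])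
     (intro continuous_intros C1_continuous C1_dir_deriv_continuous assms)

lemma dir_deriv_sum:
  assumes "\<And>i. i \<in> I \<Longrightarrow> C1 (f i)"
  shows "dir_deriv v (\<lambda>y. \<Sum>i\<in>I. f i y) y = (\<Sum>i\<in>I. dir_deriv v (f i) y)"
  by (rule dir_deriv_eqI) (intro has_derivative_sum C1_has_derivative assms)

lemma C1_sum:
  assumes "\<And>i. i \<in> I \<Longrightarrow> C1 (f i)" shows "C1 (\<lambda>y. \<Sum>i\<in>I. f i y)"
  by (rule C1_I[where f'="\<lambda>y v. \<Sum>i\<in>I. dir_deriv v (f i) y"])
     (intro has_derivative_sum continuous_intros C1_has_derivative C1_dir_deriv_continuous assms; assumption)+

lemma has_derivative_real_compose:
  fixes G :: "real \<Rightarrow> real"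
  assumes "\<And>s. (G has_real_derivative G' s) (at s)" "(f has_derivative f') (at y)"
  shows "((\<lambda>y. G (f y)) has_derivative (\<lambda>v. G' (f y) * f' v)) (at y)"
proof -
  have "(G has_derivative (\<lambda>h. G' (f y) * h)) (at (f y))"
    using assms(1) by (simp add: has_field_derivative_def)
  from has_derivative_compose[OF assms(2) this] show ?thesis .
qed

lemma dir_deriv_compose:
  fixes G :: "real \<Rightarrow> real"
  assumes "\<And>s. (G has_real_derivative G' s) (at s)" "C1 f"
  shows "dir_deriv v (\<lambda>y. G (f y)) y = G' (f y) * dir_deriv v f y"
  by (rule dir_deriv_eqI) (rule has_derivative_real_compose[OF assms(1) C1_has_derivative[OF assms(2)]])

lemma C1_compose:
  fixes G :: "real \<Rightarrow> real"
  assumes "\<And>s. (G has_real_derivative G' s) (at s)" "continuous_on UNIV G'" "C1 f"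
  shows "C1 (\<lambda>y. G (f y))"
  by (rule C1_I[OF has_derivative_real_compose[OF assms(1) C1_has_derivative[OF assms(3)]]])
     (intro continuous_intros continuous_on_compose2[OF assms(2) C1_continuous[OF assms(3)]] C1_dir_deriv_continuous assms; simp)

lemma smooth_C1: "smooth f \<Longrightarrow> C1 f"
  unfolding smooth_def C1_def dir_deriv_def by (metis C_k.simps)

lemma smooth_dir_deriv: "smooth f \<Longrightarrow> smooth (dir_deriv v f)"
  unfolding smooth_def dir_deriv_def[abs_def] by (metis C_k.simps(2))

lemma C_k_cmult: "C_k k f \<Longrightarrow> C_k k (\<lambda>x. c * f x)"
proof (induction k arbitrary: f)
  case 0 then show ?case by (auto intro!: continuous_intros)
next
  case (Suc k)
  have "frechet_derivative (\<lambda>x. c * f x) (at x) v = c * frechet_derivative f (at x) v" for x v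
    using Suc.prems frechet_derivative_works has_derivative_mult_right frechet_derivative_at
    by (metis (mono_tags, lifting) C_k.simps(2))
  then show ?case using Suc by (auto intro!: derivative_intros)
qed

lemma smooth_cmult: "smooth f \<Longrightarrow> smooth (\<lambda>x. c * f x)"
  unfolding smooth_def using C_k_cmult by blast

lemma dir_deriv_zero_outside:
  assumes "open S" "\<And>z. z \<in> S \<Longrightarrow> f z = 0" "y \<in> S"
  shows "dir_deriv v f y = 0"
proof (rule dir_deriv_eqI)
  have "((\<lambda>z. 0) has_derivative (\<lambda>_. 0)) (at y)" by simp
  then show "(f has_derivative (\<lambda>_. 0)) (at y)"
    by (rule has_derivative_transform_within_open[OF _ assms(1,3)]) (use assms in auto)
qed

lemma linear_dir_deriv: "f differentiable (at y) \<Longrightarrow> linear (\<lambda>v. dir_deriv v f y)"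
  using has_derivative_dir_deriv has_derivative_linear by blast

text \<open>Closed under directional derivatives, which makes mollifications smooth by induction.\<close>
definition bump_kernel :: "('a::euclidean_space \<Rightarrow> real) \<Rightarrow> bool" where
  "bump_kernel K \<longleftrightarrow> smooth K \<and> (\<forall>z. 1 < norm z \<longrightarrow> K z = 0)"

lemma bump_kernel_dir_deriv: "bump_kernel K \<Longrightarrow> bump_kernel (dir_deriv v K)"
  unfolding bump_kernel_def using smooth_dir_deriv
  by (auto intro!: dir_deriv_zero_outside[where S="{z. 1 < norm z}"] open_Collect_less continuous_intros)

lemma bump_kernel_cmult: "bump_kernel K \<Longrightarrow> bump_kernel (\<lambda>z. c * K z)"
  unfolding bump_kernel_def using smooth_cmult by auto

lemma bump_kernel_C1: "bump_kernel K \<Longrightarrow> C1 K"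
  unfolding bump_kernel_def using smooth_C1 by auto

lemma bump_kernel_borel: "bump_kernel K \<Longrightarrow> K \<in> borel_measurable borel"
  by (rule borel_measurable_continuous_onI[OF C1_continuous[OF bump_kernel_C1]])

lemma bump_kernel_bounded:
  assumes "bump_kernel K"
  shows "\<exists>c\<ge>0. \<forall>z. \<bar>K z\<bar> \<le> c * indicator (cball 0 1) z"
proof -
  have "compact (K ` cball 0 1)"
    by (rule compact_continuous_image[OF continuous_on_subset[OF C1_continuous[OF bump_kernel_C1[OF assms]]]]) auto
  from compact_imp_bounded[OF this] obtain c where c: "\<And>x. x \<in> K ` cball 0 1 \<Longrightarrow> norm x \<le> c"
    unfolding bounded_iff by auto
  have "\<bar>K 0\<bar> \<le> c" using c[of "K 0"] by auto
  then have "0 \<le> c" by linarith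
  moreover have "\<bar>K z\<bar> \<le> c * indicator (cball 0 1) z" for z
  proof (cases "z \<in> cball 0 1")
    case True then show ?thesis using c[of "K z"] by auto
  next
    case False then show ?thesis using assms unfolding bump_kernel_def by auto
  qed
  ultimately show ?thesis by blast
qed

text \<open>
  The mean value theorem and the uniform continuity of the directional derivatives in the basis
  directions; the support makes the estimate global.
\<close>
lemma bump_kernel_uniform_derivative:
  fixes K :: "'a::euclidean_space \<Rightarrow> real"
  assumes K: "bump_kernel K" and "0 < e"
  shows "\<exists>d>0. d \<le> 1 \<and>
    (\<forall>z h. norm h < d \<longrightarrow> \<bar>K (z + h) - K z - dir_deriv h K z\<bar> \<le> e * norm h * indicator (cball 0 2) z)"
proof -
  define N where "N = real DIM('a)"
  have N: "0 < N" unfolding N_def by simp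
  have "\<exists>d>0. \<forall>z\<in>cball 0 3. \<forall>w\<in>cball 0 3. dist w z < d \<longrightarrow> dist (dir_deriv b K w) (dir_deriv b K z) < e / N" for b
  proof -
    have "uniformly_continuous_on (cball 0 3) (dir_deriv b K)"
      by (intro compact_uniformly_continuous continuous_on_subset[OF C1_dir_deriv_continuous[OF bump_kernel_C1[OF K]]]) auto
    moreover have "0 < e / N" using \<open>0 < e\<close> N by simp
    ultimately show ?thesis unfolding uniformly_continuous_on_def by simp
  qed
  then obtain D where D: "\<And>b. 0 < D b"
    "\<And>b z w. z \<in> cball 0 3 \<Longrightarrow> w \<in> cball 0 3 \<Longrightarrow> dist w z < D b \<Longrightarrow> dist (dir_deriv b K w) (dir_deriv b K z) < e / N"
    by metis
  define d where "d = min 1 (Min (D ` Basis))"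
  have d: "0 < d" "d \<le> 1" "\<And>b. b \<in> Basis \<Longrightarrow> d \<le> D b"
    unfolding d_def using D(1) by (auto simp: min_le_iff_disj)
  show ?thesis
  proof (rule exI[of _ d], intro conjI allI impI d)
    fix z h :: 'a assume h: "norm h < d"
    show "\<bar>K (z + h) - K z - dir_deriv h K z\<bar> \<le> e * norm h * indicator (cball 0 2) z"
    proof (cases "norm z \<le> 2")
      case False
      have "norm z \<le> norm (z + h) + norm h" using norm_triangle_ineq4[of "z + h" h] by simp
      then have "1 < norm z" "1 < norm (z + h)" using False h d by linarith+
      then show ?thesis using K bump_kernel_dir_deriv[OF K, of h] False \<open>0 < e\<close> unfolding bump_kernel_def by auto
    next
      case True
      have der: "((\<lambda>t. K (z + t *\<^sub>R h)) has_real_derivative dir_deriv h K (z + t *\<^sub>R h)) (at t)" for t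
      proof -
        have "((\<lambda>t. z + t *\<^sub>R h) has_derivative (\<lambda>s. s *\<^sub>R h)) (at t)"
          by (auto intro!: derivative_eq_intros)
        from has_derivative_compose[OF this C1_has_derivative[OF bump_kernel_C1[OF K]]]
        have "((\<lambda>t. K (z + t *\<^sub>R h)) has_derivative (\<lambda>s. dir_deriv (s *\<^sub>R h) K (z + t *\<^sub>R h))) (at t)" .
        moreover have "dir_deriv (s *\<^sub>R h) K (z + t *\<^sub>R h) = dir_deriv h K (z + t *\<^sub>R h) * s" for s
          using linear_cmul[OF linear_dir_deriv[of K "z + t *\<^sub>R h"], of s h] bump_kernel_C1[OF K] unfolding C1_def by simp
        ultimately show ?thesis unfolding has_field_derivative_def by simp
      qed
      obtain t where t: "0 < t" "t < 1" "K (z + 1 *\<^sub>R h) - K (z + 0 *\<^sub>R h) = (1 - 0) * dir_deriv h K (z + t *\<^sub>R h)"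
        using MVT2[of 0 1 "\<lambda>t. K (z + t *\<^sub>R h)" "\<lambda>t. dir_deriv h K (z + t *\<^sub>R h)"] der by auto
      define w where "w = z + t *\<^sub>R h"
      have th: "norm (t *\<^sub>R h) \<le> norm h" using t by (simp add: mult_left_le_one_le)
      have w3: "w \<in> cball 0 3" "z \<in> cball 0 3" "dist w z < d"
      proof -
        have "norm w \<le> 3" using norm_triangle_ineq[of z "t *\<^sub>R h"] th True h d unfolding w_def by linarith
        then show "w \<in> cball 0 3" "z \<in> cball 0 3" using True by auto
        show "dist w z < d" using th h unfolding w_def dist_norm by simp
      qed
      have exp: "dir_deriv h K y = (\<Sum>b\<in>Basis. (h \<bullet> b) * dir_deriv b K y)" for y
      proof -
        have "linear (\<lambda>v. dir_deriv v K y)" using linear_dir_deriv bump_kernel_C1[OF K] unfolding C1_def by blast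
        from linear_sum[OF this, of "\<lambda>b. (h \<bullet> b) *\<^sub>R b" Basis]
        have "dir_deriv (\<Sum>b\<in>Basis. (h \<bullet> b) *\<^sub>R b) K y = (\<Sum>b\<in>Basis. (h \<bullet> b) * dir_deriv b K y)"
          by (simp add: linear_cmul[OF \<open>linear (\<lambda>v. dir_deriv v K y)\<close>])
        then show ?thesis by (simp add: euclidean_representation)
      qed
      have "K (z + h) - K z - dir_deriv h K z = (\<Sum>b\<in>Basis. (h \<bullet> b) * (dir_deriv b K w - dir_deriv b K z))"
        using t(3) exp[of w] exp[of z] unfolding w_def by (simp add: algebra_simps sum_subtractf)
      also have "\<bar>\<dots>\<bar> \<le> (\<Sum>b\<in>(Basis::'a set). norm h * (e / N))"
      proof (rule order_trans[OF sum_abs], rule sum_mono)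
        fix b :: 'a assume b: "b \<in> Basis"
        have "\<bar>dir_deriv b K w - dir_deriv b K z\<bar> \<le> e / N"
          using D(2)[OF w3(2,1), of b] w3(3) d(3)[OF b] by (simp add: dist_real_def)
        then show "\<bar>(h \<bullet> b) * (dir_deriv b K w - dir_deriv b K z)\<bar> \<le> norm h * (e / N)"
          using Basis_le_norm[OF b, of h] unfolding abs_mult by (intro mult_mono) auto
      qed
      also have "\<dots> = e * norm h" using N unfolding N_def by simp
      finally show ?thesis using True by simp
    qed
  qed
qed

text \<open>
  Integration over the rescaled variable keeps the kernel fixed while \<open>\<epsilon>\<close>
  varies.
\<close>
definition mol :: "('a::euclidean_space \<Rightarrow> real) \<Rightarrow> real \<Rightarrow> ('a \<Rightarrow> real) \<Rightarrow> 'a \<Rightarrow> real" where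
  "mol K \<epsilon> f y = (LINT z|lborel. K z * f (y - \<epsilon> *\<^sub>R z))"

definition loc_int :: "('a::euclidean_space \<Rightarrow> real) \<Rightarrow> bool" where
  "loc_int f \<longleftrightarrow> f \<in> borel_measurable borel \<and> (\<forall>r. set_integrable lborel (cball 0 r) f)"

lemma loc_int_borel: "loc_int f \<Longrightarrow> f \<in> borel_measurable borel"
  unfolding loc_int_def by simp

lemma
  fixes g :: "'a::euclidean_space \<Rightarrow> real"
  assumes [measurable]: "g \<in> borel_measurable borel" and "0 < \<epsilon>"
  shows lborel_integral_rescale: "(LINT x|lborel. g x) = \<epsilon> ^ DIM('a) * (LINT z|lborel. g (y - \<epsilon> *\<^sub>R z))"
    and lborel_integrable_rescale: "integrable lborel g \<longleftrightarrow> integrable lborel (\<lambda>z. g (y - \<epsilon> *\<^sub>R z))"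
proof -
  have lb: "lborel = density (distr lborel borel (\<lambda>x. y + (-\<epsilon>) *\<^sub>R x)) (\<lambda>_. ennreal (\<epsilon> ^ DIM('a)))"
    using lborel_affine[of "-\<epsilon>" y] \<open>0 < \<epsilon>\<close> by simp
  show "(LINT x|lborel. g x) = \<epsilon> ^ DIM('a) * (LINT z|lborel. g (y - \<epsilon> *\<^sub>R z))"
    by (subst lb) (use \<open>0 < \<epsilon>\<close> in \<open>simp add: integral_density integral_distr\<close>)
  show "integrable lborel g \<longleftrightarrow> integrable lborel (\<lambda>z. g (y - \<epsilon> *\<^sub>R z))"
    by (subst lb) (use \<open>0 < \<epsilon>\<close> in \<open>simp add: integrable_density integrable_distr_eq\<close>)
qed

lemma loc_int_cball:
  assumes "loc_int f" shows "set_integrable lborel (cball y r) f"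
proof -
  have "cball y r \<subseteq> cball 0 (norm y + r)"
  proof
    fix x assume "x \<in> cball y r"
    then show "x \<in> cball 0 (norm y + r)"
      using norm_triangle_sub[of x y] by (simp add: dist_norm norm_minus_commute)
  qed
  moreover have "set_integrable lborel (cball 0 (norm y + r)) f" using assms unfolding loc_int_def by simp
  ultimately show ?thesis by (rule set_integrable_subset[rotated 2]) simp
qed

lemma loc_int_kernel_integrable:
  assumes K: "bump_kernel K" and f: "loc_int f" and "0 < \<epsilon>"
  shows "integrable lborel (\<lambda>z. K z * f (y - \<epsilon> *\<^sub>R z))"
    and "integrable lborel (\<lambda>x. K ((y - x) /\<^sub>R \<epsilon>) * f x)"
proof -
  note [measurable] = bump_kernel_borel[OF K] loc_int_borel[OF f]
  have meas: "(\<lambda>x. K ((y - x) /\<^sub>R \<epsilon>) * f x) \<in> borel_measurable borel" by measurable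
  obtain c where c: "0 \<le> c" "\<And>z. \<bar>K z\<bar> \<le> c * indicator (cball 0 1) z"
    using bump_kernel_bounded[OF K] by metis
  show i: "integrable lborel (\<lambda>x. K ((y - x) /\<^sub>R \<epsilon>) * f x)"
  proof (rule Bochner_Integration.integrable_bound)
    show "integrable lborel (\<lambda>x. c * (indicator (cball y \<epsilon>) x *\<^sub>R \<bar>f x\<bar>))"
      using set_integrable_norm[OF loc_int_cball[OF f, of y \<epsilon>]] unfolding set_integrable_def
      by (intro integrable_mult_right) simp
    show "AE x in lborel. norm (K ((y - x) /\<^sub>R \<epsilon>) * f x) \<le> norm (c * (indicator (cball y \<epsilon>) x *\<^sub>R \<bar>f x\<bar>))"
    proof (rule AE_I2)
      fix x
      have "indicator (cball 0 1) ((y - x) /\<^sub>R \<epsilon>) = (indicator (cball y \<epsilon>) x :: real)"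
        using \<open>0 < \<epsilon>\<close> by (auto simp: indicator_def dist_norm divide_simps)
      then have "\<bar>K ((y - x) /\<^sub>R \<epsilon>)\<bar> * \<bar>f x\<bar> \<le> c * indicator (cball y \<epsilon>) x * \<bar>f x\<bar>"
        using c(2)[of "(y - x) /\<^sub>R \<epsilon>"] by (intro mult_right_mono) auto
      then show "norm (K ((y - x) /\<^sub>R \<epsilon>) * f x) \<le> norm (c * (indicator (cball y \<epsilon>) x *\<^sub>R \<bar>f x\<bar>))"
        using c(1) by (simp add: abs_mult)
    qed
  qed measurable
  then show "integrable lborel (\<lambda>z. K z * f (y - \<epsilon> *\<^sub>R z))"
    using lborel_integrable_rescale[OF meas \<open>0 < \<epsilon>\<close>, of y] \<open>0 < \<epsilon>\<close> by simp
qed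

lemma mol_convolution:
  fixes f :: "'a::euclidean_space \<Rightarrow> real"
  assumes K: "bump_kernel K" and f: "loc_int f" and "0 < \<epsilon>"
  shows "mol K \<epsilon> f y = (1 / \<epsilon> ^ DIM('a)) * (LINT x|lborel. K ((y - x) /\<^sub>R \<epsilon>) * f x)"
proof -
  note [measurable] = bump_kernel_borel[OF K] loc_int_borel[OF f]
  have meas: "(\<lambda>x. K ((y - x) /\<^sub>R \<epsilon>) * f x) \<in> borel_measurable borel" by measurable
  show ?thesis unfolding mol_def
    using lborel_integral_rescale[OF meas \<open>0 < \<epsilon>\<close>, of y] \<open>0 < \<epsilon>\<close> by simp
qed

text \<open>
  In convolution form the variable \<open>y\<close> sits in the kernel, whose difference quotients
  converge uniformly; local integrability of \<open>f\<close> then suffices.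
\<close>
lemma mol_has_derivative:
  fixes f :: "'a::euclidean_space \<Rightarrow> real"
  assumes K: "bump_kernel K" and f: "loc_int f" and \<epsilon>: "0 < \<epsilon>"
  shows "(mol K \<epsilon> f has_derivative (\<lambda>v. mol (\<lambda>z. (1 / \<epsilon>) * dir_deriv v K z) \<epsilon> f y)) (at y)"
proof -
  have fm[measurable]: "f \<in> borel_measurable borel" using f unfolding loc_int_def by auto
  define N where "N = \<epsilon> ^ DIM('a)"
  have N: "0 < N" unfolding N_def using \<epsilon> by simp
  define L where "L v = mol (\<lambda>z. (1 / \<epsilon>) * dir_deriv v K z) \<epsilon> f y" for v
  have Kd: "bump_kernel (dir_deriv v K)" "bump_kernel (\<lambda>z. (1 / \<epsilon>) * dir_deriv v K z)" for v
    by (intro bump_kernel_dir_deriv bump_kernel_cmult K)+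
  have lin: "linear (\<lambda>v. dir_deriv v K z)" for z using linear_dir_deriv bump_kernel_C1[OF K] unfolding C1_def by blast
  have Lc: "L v = (1 / N) * (LINT x|lborel. dir_deriv (v /\<^sub>R \<epsilon>) K ((y - x) /\<^sub>R \<epsilon>) * f x)" for v
  proof -
    have "dir_deriv (v /\<^sub>R \<epsilon>) K z = (1 / \<epsilon>) * dir_deriv v K z" for z
      using linear_cmul[OF lin[of z], of "inverse \<epsilon>" v] by (simp add: divide_inverse)
    then show ?thesis unfolding L_def N_def mol_convolution[OF Kd(2) f \<epsilon>] by simp
  qed
  have "linear L"
  proof (rule linearI)
    fix v w :: 'a and c :: real
    have d: "dir_deriv (v + w) K z = dir_deriv v K z + dir_deriv w K z" "dir_deriv (c *\<^sub>R v) K z = c * dir_deriv v K z" for z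
      using linear_add[OF lin[of z], of v w] linear_cmul[OF lin[of z], of c v] by auto
    note i = loc_int_kernel_integrable(1)[OF Kd(2) f \<epsilon>]
    show "L (v + w) = L v + L w"
      unfolding L_def mol_def d using Bochner_Integration.integral_add[OF i[of v y] i[of w y]]
      by (simp add: algebra_simps)
    show "L (c *\<^sub>R v) = c *\<^sub>R L v"
      unfolding L_def mol_def d using integral_mult_right_zero[of lborel c] by (simp add: mult_ac)
  qed
  have "bounded_linear L" using \<open>linear L\<close> linear_conv_bounded_linear by blast
  moreover have "\<exists>d>0. \<forall>w. norm (w - y) < d \<longrightarrow> norm (mol K \<epsilon> f w - mol K \<epsilon> f y - L (w - y)) \<le> e * norm (w - y)"
    if "0 < e" for e
  proof -
    define I where "I = (LINT x|lborel. indicator (cball y (2 * \<epsilon>)) x * \<bar>f x\<bar>)"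
    have Ii: "integrable lborel (\<lambda>x. indicator (cball y (2 * \<epsilon>)) x * \<bar>f x\<bar>)"
      using set_integrable_norm[OF loc_int_cball[OF f, of y "2 * \<epsilon>"]] unfolding set_integrable_def
      by simp
    have "0 \<le> I" unfolding I_def by (rule integral_nonneg_AE) auto
    define e' where "e' = e * \<epsilon> * N / (I + 1)"
    have "0 < e'" unfolding e'_def using \<open>0 < e\<close> \<epsilon> N \<open>0 \<le> I\<close> by (auto intro!: divide_pos_pos)
    obtain d where d: "0 < d" "d \<le> 1"
      "\<And>z h. norm h < d \<Longrightarrow> \<bar>K (z + h) - K z - dir_deriv h K z\<bar> \<le> e' * norm h * indicator (cball 0 2) z"
      using bump_kernel_uniform_derivative[OF K \<open>0 < e'\<close>] by auto
    have "norm (mol K \<epsilon> f w - mol K \<epsilon> f y - L (w - y)) \<le> e * norm (w - y)" if w: "norm (w - y) < d * \<epsilon>" for w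
    proof -
      define h where "h = (w - y) /\<^sub>R \<epsilon>"
      have nh: "norm h = norm (w - y) / \<epsilon>" unfolding h_def using \<epsilon> by (simp add: divide_inverse mult.commute)
      have h: "norm h < d" unfolding nh using w \<epsilon> by (simp add: field_simps)
      define F where "F x = (K ((w - x) /\<^sub>R \<epsilon>) - K ((y - x) /\<^sub>R \<epsilon>) - dir_deriv h K ((y - x) /\<^sub>R \<epsilon>)) * f x" for x
      note i = loc_int_kernel_integrable(2)[OF K f \<epsilon>] loc_int_kernel_integrable(2)[OF Kd(1) f \<epsilon>]
      have F: "mol K \<epsilon> f w - mol K \<epsilon> f y - L (w - y) = (1 / N) * (LINT x|lborel. F x)"
        unfolding Lc mol_convolution[OF K f \<epsilon>] F_def N_def[symmetric] h_def[symmetric]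
        using i(1)[of w] i(1)[of y] i(2)[of h y]
        by (simp add: left_diff_distrib Bochner_Integration.integral_diff right_diff_distrib diff_divide_distrib)
      have "norm (LINT x|lborel. F x) \<le> (LINT x|lborel. (e' * norm h) * (indicator (cball y (2 * \<epsilon>)) x * \<bar>f x\<bar>))"
      proof (rule Bochner_Integration.integral_norm_bound_integral)
        show "integrable lborel F" unfolding F_def left_diff_distrib using i by auto
        show "integrable lborel (\<lambda>x. (e' * norm h) * (indicator (cball y (2 * \<epsilon>)) x * \<bar>f x\<bar>))"
          using Ii by auto
        fix x
        have "(w - x) /\<^sub>R \<epsilon> = (y - x) /\<^sub>R \<epsilon> + h" unfolding h_def by (simp add: algebra_simps)
        moreover have "indicator (cball 0 2) ((y - x) /\<^sub>R \<epsilon>) = (indicator (cball y (2 * \<epsilon>)) x :: real)"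
          using \<epsilon> by (auto simp: indicator_def dist_norm divide_simps)
        ultimately have "\<bar>K ((w - x) /\<^sub>R \<epsilon>) - K ((y - x) /\<^sub>R \<epsilon>) - dir_deriv h K ((y - x) /\<^sub>R \<epsilon>)\<bar>
            \<le> e' * norm h * indicator (cball y (2 * \<epsilon>)) x"
          using d(3)[OF h, of "(y - x) /\<^sub>R \<epsilon>"] by simp
        then show "norm (F x) \<le> (e' * norm h) * (indicator (cball y (2 * \<epsilon>)) x * \<bar>f x\<bar>)"
          unfolding F_def real_norm_def abs_mult mult.assoc[symmetric] by (intro mult_right_mono) auto
      qed
      also have "\<dots> = e' * norm h * I" unfolding I_def by simp
      also have "\<dots> \<le> e' * norm h * (I + 1)" using \<open>0 < e'\<close> by (intro mult_left_mono) auto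
      also have "\<dots> = N * (e * norm (w - y))"
        unfolding e'_def nh using \<epsilon> \<open>0 \<le> I\<close> by (simp add: field_simps)
      finally show ?thesis unfolding F using N by (simp add: abs_mult field_simps)
    qed
    then show ?thesis using d \<epsilon> by (intro exI[of _ "d * \<epsilon>"]) auto
  qed
  ultimately show ?thesis unfolding has_derivative_at_alt L_def by blast
qed

lemma mol_smooth:
  assumes "bump_kernel K" "loc_int f" "0 < \<epsilon>"
  shows "smooth (mol K \<epsilon> f)"
  unfolding smooth_def
proof
  fix k show "C_k k (mol K \<epsilon> f)" using assms(1)
  proof (induction k arbitrary: K)
    case 0
    then show ?case
      using has_derivative_continuous[OF mol_has_derivative[OF 0 assms(2,3)]]
      by (simp add: continuous_on_eq_continuous_at)
  next
    case (Suc k)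
    have d: "frechet_derivative (mol K \<epsilon> f) (at x) v = mol (\<lambda>z. (1 / \<epsilon>) * dir_deriv v K z) \<epsilon> f x" for x v
      using frechet_derivative_at[OF mol_has_derivative[OF Suc.prems assms(2,3)]] by metis
    show ?case unfolding C_k.simps d
    proof (intro conjI allI)
      show "mol K \<epsilon> f differentiable at x" for x
        using mol_has_derivative[OF Suc.prems assms(2,3)] differentiableI by blast
      show "C_k k (mol (\<lambda>z. (1 / \<epsilon>) * dir_deriv v K z) \<epsilon> f)" for v
        by (rule Suc.IH) (intro bump_kernel_cmult bump_kernel_dir_deriv Suc.prems)
    qed
  qed
qed

lemma dir_deriv_mol:
  assumes "bump_kernel K" "loc_int f" "0 < \<epsilon>"
  shows "dir_deriv v (mol K \<epsilon> f) y = (1 / \<epsilon>) * mol (dir_deriv v K) \<epsilon> f y"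
  using dir_deriv_eqI[OF mol_has_derivative[OF assms], of v y] unfolding mol_def by (simp add: mult.assoc)

section \<open>Periodic functions, integration by parts and duality\<close>

definition time_supp :: "real \<Rightarrow> real \<Rightarrow> (real \<times> (real ^ 'd) \<Rightarrow> real) \<Rightarrow> bool" where
  "time_supp a b f \<longleftrightarrow> (\<forall>t x. f (t, x) \<noteq> 0 \<longrightarrow> a \<le> t \<and> t \<le> b)"

lemma time_suppD: "time_supp a b f \<Longrightarrow> \<not> (a \<le> fst y \<and> fst y \<le> b) \<Longrightarrow> f y = 0"
  unfolding time_supp_def by (cases y) auto

lemma cell_subset_cbox: "cell \<subseteq> cbox 0 (1 :: real ^ 'd)"
  unfolding cell_def by (auto simp: mem_box_cart less_imp_le)

lemma emeasure_slab_finite: fixes a b :: real shows "emeasure lborel ({a..b} \<times> (cell :: (real ^ 'd) set)) < \<infinity>"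
proof (rule emeasure_bounded_finite)
  show "bounded ({a..b} \<times> (cell :: (real ^ 'd) set))"
    by (intro bounded_Times bounded_subset[OF bounded_cbox cell_subset_cbox] compact_imp_bounded[OF compact_Icc])
qed

lemma slab_borel[measurable]: fixes a b :: real shows "{a..b} \<times> (cell :: (real ^ 'd) set) \<in> sets borel"
  using borel_Times[of "{a..b}" cell] by simp

lemma strip_integrable_bounded:
  assumes [measurable]: "f \<in> borel_measurable borel" and "time_supp a b f" "\<And>y. \<bar>f y\<bar> \<le> B"
  shows "set_integrable lborel strip f"
proof -
  have "integrable lborel (\<lambda>y. indicator ({a..b} \<times> cell) y *\<^sub>R f y)"
    by (rule integrableI_bounded_set_indicator[where B=B]) (use assms(3) emeasure_slab_finite in auto)
  moreover have "(\<lambda>y. indicator ({a..b} \<times> cell) y *\<^sub>R f y) = (\<lambda>y. indicator strip y *\<^sub>R f y)"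
    using assms(2) unfolding strip_def time_supp_def by (auto simp: indicator_def fun_eq_iff)
  ultimately show ?thesis unfolding set_integrable_def by simp
qed

lemma lattice_translate_into_strip: "\<exists>k. y - lattice_vec k \<in> strip"
proof -
  obtain t x where y: "y = (t, x)" by (cases y)
  have "y - lattice_vec (\<chi> i. \<lfloor>x $ i\<rfloor>) \<in> strip"
    unfolding y lattice_vec_def minus_prod_def fst_conv snd_conv mem_strip by (auto simp: algebra_simps) linarith
  then show ?thesis by blast
qed

text \<open>A lattice translation moves every point of the time slab into a compact set.\<close>
lemma periodic_bounded:
  assumes cont: "continuous_on UNIV f" and per: "space_periodic f" and supp: "time_supp a b f"
  shows "\<exists>B\<ge>0. \<forall>y. \<bar>f y\<bar> \<le> B"
proof -
  have "compact (f ` ({a..b} \<times> cbox 0 1))"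
    by (rule compact_continuous_image[OF continuous_on_subset[OF cont]]) (auto intro!: compact_Times)
  from compact_imp_bounded[OF this] obtain B where B: "\<And>y. y \<in> {a..b} \<times> cbox 0 1 \<Longrightarrow> \<bar>f y\<bar> \<le> B"
    unfolding bounded_iff by auto
  have "\<bar>f y\<bar> \<le> max 0 B" for y
  proof (cases "a \<le> fst y \<and> fst y \<le> b")
    case True
    obtain k where k: "y - lattice_vec k \<in> strip" using lattice_translate_into_strip by blast
    have "fst (y - lattice_vec k) = fst y" unfolding lattice_vec_def by simp
    then have "y - lattice_vec k \<in> {a..b} \<times> cbox 0 1"
      using k True cell_subset_cbox unfolding strip_def by (cases "y - lattice_vec k") auto
    then have "\<bar>f (y - lattice_vec k)\<bar> \<le> B" by (rule B)
    then show ?thesis using space_periodic_lattice[OF per, of "y - lattice_vec k" k] by simp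
  next
    case False
    then show ?thesis using time_suppD[OF supp False] by simp
  qed
  then show ?thesis by (intro exI[of _ "max 0 B"]) auto
qed

lemma dir_deriv_translate: "C1 f \<Longrightarrow> dir_deriv v (\<lambda>y. f (y + c)) y = dir_deriv v f (y + c)"
proof (rule dir_deriv_eqI)
  assume "C1 f"
  have "((\<lambda>y. y + c) has_derivative (\<lambda>h. h)) (at y)" by (auto intro!: derivative_eq_intros)
  from has_derivative_compose[OF this C1_has_derivative[OF \<open>C1 f\<close>]]
  show "((\<lambda>y. f (y + c)) has_derivative (\<lambda>v. dir_deriv v f (y + c))) (at y)" .
qed

lemma space_periodic_dir_deriv:
  assumes "C1 f" "space_periodic f" shows "space_periodic (dir_deriv v f)"
  unfolding space_periodic_def
proof (intro allI)
  fix t x i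
  have "(\<lambda>y. f (y + (0, axis i 1))) = f"
    using assms(2) unfolding space_periodic_def by (auto simp: fun_eq_iff)
  then show "dir_deriv v f (t, x + axis i 1) = dir_deriv v f (t, x)"
    using dir_deriv_translate[OF assms(1), of v "(0, axis i 1)" "(t, x)"] by simp
qed

lemma time_supp_dir_deriv:
  fixes f :: "real \<times> (real ^ 'd) \<Rightarrow> real"
  assumes "time_supp a b f" shows "time_supp a b (dir_deriv v f)"
proof -
  have "dir_deriv v f (t, x) = 0" if "\<not> (a \<le> t \<and> t \<le> b)" for t x
  proof (rule dir_deriv_zero_outside)
    show "open ((- {a..b}) \<times> (UNIV :: (real ^ 'd) set))" by (intro open_Times) auto
    show "f z = 0" if "z \<in> (- {a..b}) \<times> UNIV" for z using that time_suppD[OF assms, of z] by (cases z) auto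
  qed (use that in auto)
  then show ?thesis unfolding time_supp_def by blast
qed

lemma strip_integrable_C1:
  assumes "continuous_on UNIV f" "space_periodic f" "time_supp a b f"
  shows "set_integrable lborel strip f"
proof -
  obtain B where "\<And>y. \<bar>f y\<bar> \<le> B" using periodic_bounded[OF assms] by auto
  then show ?thesis using strip_integrable_bounded[OF borel_measurable_continuous_onI[OF assms(1)] assms(3)] by blast
qed

text \<open>
  The difference quotients have integral 0 by translation invariance, and they are dominated on a time
  slab.
\<close>
lemma integral_dir_deriv_zero:
  assumes C1: "C1 f" and per: "space_periodic f" and supp: "time_supp a b f"
  shows "(LBINT y:strip. dir_deriv v f y) = 0"
proof -
  have fc: "continuous_on UNIV f" "continuous_on UNIV (dir_deriv v f)"
    by (rule C1_continuous[OF C1], rule C1_dir_deriv_continuous[OF C1])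
  have fm[measurable]: "f \<in> borel_measurable borel" by (rule borel_measurable_continuous_onI[OF fc(1)])
  have dm[measurable]: "dir_deriv v f \<in> borel_measurable borel" by (rule borel_measurable_continuous_onI[OF fc(2)])
  obtain B where B: "0 \<le> B" "\<And>y. \<bar>dir_deriv v f y\<bar> \<le> B"
    using periodic_bounded[OF fc(2) space_periodic_dir_deriv[OF C1 per] time_supp_dir_deriv[OF supp]] by auto
  define r where "r n = inverse (real (Suc n))" for n
  have r: "0 < r n" "r n \<le> 1" for n
    unfolding r_def by (auto simp: field_simps)
  define Q where "Q n y = (f (y + r n *\<^sub>R v) - f y) / r n" for n y
  have der: "((\<lambda>s. f (y + s *\<^sub>R v)) has_real_derivative dir_deriv v f (y + s *\<^sub>R v)) (at s)" for y s
  proof -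
    have "((\<lambda>s. y + s *\<^sub>R v) has_derivative (\<lambda>h. h *\<^sub>R v)) (at s)" by (auto intro!: derivative_eq_intros)
    from has_derivative_compose[OF this C1_has_derivative[OF C1]]
    have "((\<lambda>s. f (y + s *\<^sub>R v)) has_derivative (\<lambda>h. dir_deriv (h *\<^sub>R v) f (y + s *\<^sub>R v))) (at s)" .
    moreover have "dir_deriv (h *\<^sub>R v) f (y + s *\<^sub>R v) = dir_deriv v f (y + s *\<^sub>R v) * h" for h
      using linear_cmul[OF linear_dir_deriv[of f "y + s *\<^sub>R v"], of h v] C1 unfolding C1_def by simp
    ultimately show ?thesis unfolding has_field_derivative_def by simp
  qed
  define c where "c = \<bar>fst v\<bar>"
  have Qb: "\<bar>Q n y\<bar> \<le> B" for n y
  proof -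
    obtain s where s: "f (y + r n *\<^sub>R v) - f (y + 0 *\<^sub>R v) = (r n - 0) * dir_deriv v f (y + s *\<^sub>R v)"
      using MVT2[OF r(1)[of n], of "\<lambda>s. f (y + s *\<^sub>R v)" "\<lambda>s. dir_deriv v f (y + s *\<^sub>R v)"] der by auto
    then have "Q n y = dir_deriv v f (y + s *\<^sub>R v)" unfolding Q_def using r(1)[of n] by (simp add: field_simps)
    then show ?thesis using B by simp
  qed
  have Qs: "time_supp (a - c) (b + c) (Q n)" for n
    unfolding time_supp_def
  proof (intro allI impI, rule ccontr)
    fix t x assume ne: "Q n (t, x) \<noteq> 0" and out: "\<not> (a - c \<le> t \<and> t \<le> b + c)"
    have "\<bar>r n * fst v\<bar> \<le> c" unfolding c_def using r[of n] by (simp add: abs_mult mult_left_le_one_le)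
    then have "\<not> (a \<le> fst ((t, x) + r n *\<^sub>R v) \<and> fst ((t, x) + r n *\<^sub>R v) \<le> b)"
      "\<not> (a \<le> fst (t, x) \<and> fst (t, x) \<le> b)" using out unfolding c_def by auto
    then have "Q n (t, x) = 0" unfolding Q_def using time_suppD[OF supp] by (metis diff_0_right div_0)
    then show False using ne by simp
  qed
  have Qm[measurable]: "Q n \<in> borel_measurable borel" for n unfolding Q_def by measurable
  have Q0: "(LBINT y:strip. Q n y) = 0" for n
  proof -
    have i: "set_integrable lborel strip f" by (rule strip_integrable_C1[OF fc(1) per supp])
    have i': "set_integrable lborel strip (\<lambda>y. f (y + r n *\<^sub>R v))"
      using i set_integrable_strip_shift[OF fm per] by simp
    have "(LBINT y:strip. Q n y) = (LBINT y:strip. (f (y + r n *\<^sub>R v) - f y)) / r n"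
      unfolding Q_def set_lebesgue_integral_def by simp
    also have "(LBINT y:strip. (f (y + r n *\<^sub>R v) - f y)) = 0"
      using set_integral_diff(2)[OF i' i] set_integral_strip_shift[OF fm per] by simp
    finally show ?thesis by simp
  qed
  have "(\<lambda>n. (LBINT y:strip. Q n y)) \<longlonglongrightarrow> (LBINT y:strip. dir_deriv v f y)"
    unfolding set_lebesgue_integral_def
  proof (rule integral_dominated_convergence)
    show "integrable lborel (\<lambda>y. indicator ({a - c..b + c} \<times> cell) y * B)"
      using emeasure_slab_finite[of "a - c" "b + c"] by (intro integrable_mult_left integrable_real_indicator) auto
    show "AE y in lborel. norm (indicator strip y *\<^sub>R Q n y) \<le> indicator ({a - c..b + c} \<times> cell) y * B" for n
    proof (rule AE_I2)
      fix y :: "real \<times> (real ^ 'a)"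
      show "norm (indicator strip y *\<^sub>R Q n y) \<le> indicator ({a - c..b + c} \<times> cell) y * B"
        using Qb[of n y] time_suppD[OF Qs[of n], of y] B(1) unfolding strip_def
        by (cases y) (auto simp: indicator_def)
    qed
    show "AE y in lborel. (\<lambda>n. indicator strip y *\<^sub>R Q n y) \<longlonglongrightarrow> indicator strip y *\<^sub>R dir_deriv v f y"
    proof (rule AE_I2)
      fix y :: "real \<times> (real ^ 'a)"
      have "((\<lambda>h. (f (y + h *\<^sub>R v) - f (y + 0 *\<^sub>R v)) / (h - 0)) \<longlongrightarrow> dir_deriv v f (y + 0 *\<^sub>R v)) (at 0)"
        using der[of y 0] unfolding has_field_derivative_iff by simp
      moreover have "filterlim r (at 0) sequentially"
        unfolding filterlim_at
      proof
        show "\<forall>\<^sub>F n in sequentially. r n \<in> UNIV \<and> r n \<noteq> 0" using r(1) by (auto simp: less_imp_neq[symmetric])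
        show "r \<longlonglongrightarrow> 0" unfolding r_def by (rule LIMSEQ_inverse_real_of_nat)
      qed
      ultimately have "((\<lambda>n. (f (y + r n *\<^sub>R v) - f (y + 0 *\<^sub>R v)) / (r n - 0)) \<longlongrightarrow> dir_deriv v f (y + 0 *\<^sub>R v)) sequentially"
        by (rule filterlim_compose)
      then have "(\<lambda>n. Q n y) \<longlonglongrightarrow> dir_deriv v f y" unfolding Q_def by simp
      then show "(\<lambda>n. indicator strip y *\<^sub>R Q n y) \<longlonglongrightarrow> indicator strip y *\<^sub>R dir_deriv v f y"
        by (intro tendsto_intros)
    qed
  qed measurable
  then show ?thesis unfolding Q0 using LIMSEQ_unique tendsto_const by blast
qed

text \<open>
  For every \<open>y\<close> in a unit cell, a large ball around \<open>y\<close> contains the given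
  ball. Averaging the integral over the large ball with respect to \<open>y\<close> gives, by
  translation invariance, the integral over the strip times the volume of the ball.
\<close>
lemma loc_int_periodic:
  fixes f :: "real \<times> (real ^ 'd) \<Rightarrow> real"
  assumes fm[measurable]: "f \<in> borel_measurable borel" and per: "space_periodic f" and int: "set_integrable lborel strip f"
  shows "loc_int f"
  unfolding loc_int_def
proof (intro conjI allI fm)
  fix r :: real
  define S where "S = {0..1::real} \<times> (cell :: (real ^ 'd) set)"
  have [measurable]: "S \<in> sets borel" unfolding S_def by simp
  have [measurable]: "cball (0 :: real \<times> (real ^ 'd)) s \<in> sets borel" for s by simp
  obtain c where c: "\<And>y. y \<in> S \<Longrightarrow> norm y \<le> c"
  proof -
    have "bounded S" unfolding S_def
      by (intro bounded_Times bounded_subset[OF bounded_cbox cell_subset_cbox] compact_imp_bounded[OF compact_Icc])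
    then show ?thesis using that unfolding bounded_iff by auto
  qed
  define L where "L = r + c"
  define I where "I = (\<integral>\<^sup>+z. indicator (cball 0 r) z * ennreal \<bar>f z\<bar> \<partial>lborel)"
  define J where "J = (\<integral>\<^sup>+y. indicator strip y * ennreal \<bar>f y\<bar> \<partial>lborel)"
  have J: "J < \<infinity>" using int unfolding J_def set_integrable_def integrable_iff_bounded
    by (simp add: ennreal_mult ennreal_indicator abs_mult)
  have Spos: "emeasure lborel S \<noteq> 0"
  proof -
    define h where "h = (1 / 2 :: real, (\<chi> i. 1 / 2) :: real ^ 'd)"
    have "cbox (0, 0) h \<subseteq> S"
      unfolding S_def h_def cbox_Pair_eq cell_def by (auto simp: mem_box_cart intro: le_less_trans[where y="1 / 2"])
    then have "emeasure lborel (cbox (0, 0) h) \<le> emeasure lborel S" by (intro emeasure_mono) auto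
    moreover have "emeasure lborel (cbox (0, 0) h) \<noteq> 0"
    proof -
      have "0 < measure lborel (cbox (0, 0) h)"
        by (rule content_pos_lt) (auto simp: h_def Basis_prod_def Basis_vec_def inner_axis)
      then show ?thesis by (auto simp: measure_def)
    qed
    ultimately show ?thesis by auto
  qed
  have sub: "I \<le> (\<integral>\<^sup>+z. indicator (cball 0 L) z * ennreal \<bar>f (y + z)\<bar> \<partial>lborel)" if "y \<in> S" for y
  proof -
    have "I = (\<integral>\<^sup>+z. indicator (cball 0 r) (z + y) * ennreal \<bar>f (z + y)\<bar> \<partial>lborel)"
      unfolding I_def by (rule nn_integral_lborel_translate[symmetric]) measurable
    also have "\<dots> \<le> (\<integral>\<^sup>+z. indicator (cball 0 L) z * ennreal \<bar>f (y + z)\<bar> \<partial>lborel)"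
    proof (rule nn_integral_mono)
      fix z :: "real \<times> (real ^ 'd)"
      have "norm z \<le> norm (z + y) + norm y" using norm_triangle_ineq4[of "z + y" y] by simp
      then have "z + y \<in> cball 0 r \<Longrightarrow> z \<in> cball 0 L" using c[OF that] unfolding L_def by simp
      then show "indicator (cball 0 r) (z + y) * ennreal \<bar>f (z + y)\<bar> \<le> indicator (cball 0 L) z * ennreal \<bar>f (y + z)\<bar>"
        by (auto simp: indicator_def add.commute)
    qed
    finally show ?thesis .
  qed
  have per': "space_periodic (\<lambda>y. ennreal \<bar>f y\<bar>)" using per by (simp add: space_periodic_def)
  have "I * emeasure lborel S = (\<integral>\<^sup>+y. I * indicator S y \<partial>lborel)" by (simp add: nn_integral_cmult_indicator)
  also have "\<dots> \<le> (\<integral>\<^sup>+y. indicator strip y * (\<integral>\<^sup>+z. indicator (cball 0 L) z * ennreal \<bar>f (y + z)\<bar> \<partial>lborel) \<partial>lborel)"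
    using sub by (intro nn_integral_mono) (auto simp: indicator_def S_def strip_def)
  also have "\<dots> = (\<integral>\<^sup>+y. (\<integral>\<^sup>+z. indicator strip y * (indicator (cball 0 L) z * ennreal \<bar>f (y + z)\<bar>) \<partial>lborel) \<partial>lborel)"
    by (intro nn_integral_cong nn_integral_cmult[symmetric]) measurable
  also have "\<dots> = (\<integral>\<^sup>+z. (\<integral>\<^sup>+y. indicator strip y * (indicator (cball 0 L) z * ennreal \<bar>f (y + z)\<bar>) \<partial>lborel) \<partial>lborel)"
    by (rule lborel_pair.Fubini') measurable
  also have "\<dots> = (\<integral>\<^sup>+z. indicator (cball (0 :: real \<times> (real ^ 'd)) L) z * J \<partial>lborel)"
  proof (rule nn_integral_cong)
    fix z :: "real \<times> (real ^ 'd)"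
    have "(\<integral>\<^sup>+y. indicator strip y * (indicator (cball 0 L) z * ennreal \<bar>f (y + z)\<bar>) \<partial>lborel)
       = indicator (cball 0 L) z * (\<integral>\<^sup>+y. indicator strip y * ennreal \<bar>f (y + z)\<bar> \<partial>lborel)"
      by (subst nn_integral_cmult[symmetric]) (auto simp: mult_ac)
    also have "(\<integral>\<^sup>+y. indicator strip y * ennreal \<bar>f (y + z)\<bar> \<partial>lborel) = J"
      unfolding J_def by (rule nn_integral_strip_shift[OF _ per']) measurable
    finally show "(\<integral>\<^sup>+y. indicator strip y * (indicator (cball 0 L) z * ennreal \<bar>f (y + z)\<bar>) \<partial>lborel)
       = indicator (cball 0 L) z * J" .
  qed
  also have "\<dots> = emeasure lborel (cball (0 :: real \<times> (real ^ 'd)) L) * J" by (simp add: nn_integral_multc)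
  also have "\<dots> < \<infinity>"
    using J emeasure_bounded_finite[OF bounded_cball, of "0 :: real \<times> (real ^ 'd)" L] by (simp add: ennreal_mult_less_top)
  finally have "I < \<infinity>" using Spos by (auto simp: ennreal_mult_less_top)
  then show "set_integrable lborel (cball 0 r) f"
    unfolding I_def set_integrable_def integrable_iff_bounded by (simp add: ennreal_mult ennreal_indicator abs_mult)
qed

lemma space_periodic_mol: "space_periodic f \<Longrightarrow> space_periodic (mol K \<epsilon> f)"
  unfolding space_periodic_def mol_def
proof (intro allI)
  fix t x i assume per: "\<forall>t x i. f (t, x + axis i 1) = f (t, x)"
  have "f ((t, x + axis i 1) - \<epsilon> *\<^sub>R z) = f ((t, x) - \<epsilon> *\<^sub>R z)" for z
    using per[rule_format, of "t - \<epsilon> * fst z" "x - \<epsilon> *\<^sub>R snd z" i] by (cases z) (simp add: algebra_simps)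
  then show "(LINT z|lborel. K z * f ((t, x + axis i 1) - \<epsilon> *\<^sub>R z)) = (LINT z|lborel. K z * f ((t, x) - \<epsilon> *\<^sub>R z))"
    by simp
qed

lemma time_supp_mol:
  assumes K: "bump_kernel K" and supp: "time_supp a b f" and \<epsilon>: "0 < \<epsilon>"
  shows "time_supp (a - \<epsilon>) (b + \<epsilon>) (mol K \<epsilon> f)"
  unfolding time_supp_def
proof (intro allI impI, rule ccontr)
  fix t x assume ne: "mol K \<epsilon> f (t, x) \<noteq> 0" and out: "\<not> (a - \<epsilon> \<le> t \<and> t \<le> b + \<epsilon>)"
  have "K z * f ((t, x) - \<epsilon> *\<^sub>R z) = 0" for z
  proof (cases "1 < norm z")
    case True
    then have "K z = 0" using K unfolding bump_kernel_def by blast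
    then show ?thesis by simp
  next
    case False
    then have "\<bar>fst z\<bar> \<le> 1" using norm_fst_le[of "fst z" "snd z"] by simp
    then have "\<bar>\<epsilon> * fst z\<bar> \<le> \<epsilon>" using \<epsilon> by (simp add: abs_mult)
    then have "\<not> (a \<le> fst ((t, x) - \<epsilon> *\<^sub>R z) \<and> fst ((t, x) - \<epsilon> *\<^sub>R z) \<le> b)" using out by auto
    then show ?thesis using time_suppD[OF supp] by simp
  qed
  then have "(\<lambda>z. K z * f ((t, x) - \<epsilon> *\<^sub>R z)) = (\<lambda>z. 0)" by (rule ext)
  then have "mol K \<epsilon> f (t, x) = 0" unfolding mol_def by simp
  then show False using ne by simp
qed

text \<open>
  Fubini and the invariance of the strip integral under the shift by \<open>\<epsilon> z\<close>.
\<close>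
lemma mol_adjoint:
  fixes f \<psi> :: "real \<times> (real ^ 'd) \<Rightarrow> real"
  assumes K: "bump_kernel K" and fm[measurable]: "f \<in> borel_measurable borel" and perf: "space_periodic f"
    and int: "set_integrable lborel strip f"
    and pm[measurable]: "\<psi> \<in> borel_measurable borel" and perp: "space_periodic \<psi>" and B: "\<And>y. \<bar>\<psi> y\<bar> \<le> B"
  shows "(LBINT y:strip. f y * mol K \<epsilon> \<psi> y) = (LBINT y:strip. mol (\<lambda>z. K (- z)) \<epsilon> f y * \<psi> y)"
proof -
  note [measurable] = bump_kernel_borel[OF K]
  obtain c where c: "0 \<le> c" "\<And>z. \<bar>K z\<bar> \<le> c * indicator (cball 0 1) z"
    using bump_kernel_bounded[OF K] by metis
  have B0: "0 \<le> B" using B[of 0] by linarith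
  define J where "J = (\<integral>\<^sup>+y. indicator strip y * ennreal \<bar>f y\<bar> \<partial>lborel)"
  have J: "J < \<infinity>" using int unfolding J_def set_integrable_def integrable_iff_bounded
    by (simp add: ennreal_mult ennreal_indicator abs_mult)
  have per': "space_periodic (\<lambda>y. ennreal \<bar>f y\<bar>)" using perf by (simp add: space_periodic_def)
  have int2: "integrable (lborel \<Otimes>\<^sub>M lborel) (\<lambda>(y, z). indicator strip y * (K z * f (y + s *\<^sub>R z) * g y z))"
    if [measurable]: "case_prod g \<in> borel_measurable (lborel \<Otimes>\<^sub>M lborel)" and g: "\<And>y z. \<bar>g y z\<bar> \<le> B"
    for s and g :: "real \<times> (real ^ 'd) \<Rightarrow> real \<times> (real ^ 'd) \<Rightarrow> real"
  proof (rule integrableI_bounded)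
    show "(\<lambda>(y, z). indicator strip y * (K z * f (y + s *\<^sub>R z) * g y z)) \<in> borel_measurable (lborel \<Otimes>\<^sub>M lborel)"
      by measurable
    define G where "G p = (c * B) * (indicator (cball 0 1) (snd p) * (indicator strip (fst p) * \<bar>f (fst p + s *\<^sub>R snd p)\<bar>))" for p
    have [measurable]: "cball (0 :: real \<times> (real ^ 'd)) 1 \<in> sets borel" by simp
    have [measurable]: "G \<in> borel_measurable (lborel \<Otimes>\<^sub>M lborel)" unfolding G_def by measurable
    have "(\<integral>\<^sup>+p. ennreal (norm (case p of (y, z) \<Rightarrow> indicator strip y * (K z * f (y + s *\<^sub>R z) * g y z))) \<partial>(lborel \<Otimes>\<^sub>M lborel))
      \<le> (\<integral>\<^sup>+p. ennreal (G p) \<partial>(lborel \<Otimes>\<^sub>M lborel))"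
    proof (intro nn_integral_mono ennreal_leI)
      fix p :: "(real \<times> (real ^ 'd)) \<times> (real \<times> (real ^ 'd))"
      obtain y z where p: "p = (y, z)" by (cases p)
      have "\<bar>K z\<bar> * \<bar>f (y + s *\<^sub>R z)\<bar> * \<bar>g y z\<bar> \<le> (c * indicator (cball 0 1) z) * \<bar>f (y + s *\<^sub>R z)\<bar> * B"
        using c g by (intro mult_mono) auto
      then show "norm (case p of (y, z) \<Rightarrow> indicator strip y * (K z * f (y + s *\<^sub>R z) * g y z)) \<le> G p"
        unfolding p G_def by (auto simp: indicator_def abs_mult mult_ac split: if_splits)
    qed
    also have "\<dots> = (\<integral>\<^sup>+z. (\<integral>\<^sup>+y. ennreal (G (y, z)) \<partial>lborel) \<partial>lborel)"
      by (subst lborel_pair.nn_integral_snd[symmetric]) auto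
    also have "\<dots> = (\<integral>\<^sup>+z. (\<integral>\<^sup>+y. ennreal (c * B) * (indicator (cball 0 1) z * (indicator strip y * ennreal \<bar>f (y + s *\<^sub>R z)\<bar>)) \<partial>lborel) \<partial>lborel)"
      unfolding G_def using c(1) B0 by (simp add: ennreal_mult ennreal_indicator)
    also have "\<dots> = (\<integral>\<^sup>+z. ennreal (c * B) * (indicator (cball (0 :: real \<times> (real ^ 'd)) 1) z * J) \<partial>lborel)"
    proof (rule nn_integral_cong)
      fix z :: "real \<times> (real ^ 'd)"
      have "(\<integral>\<^sup>+y. indicator strip y * ennreal \<bar>f (y + s *\<^sub>R z)\<bar> \<partial>lborel) = J"
        unfolding J_def by (rule nn_integral_strip_shift[OF _ per']) measurable
      then show "(\<integral>\<^sup>+y. ennreal (c * B) * (indicator (cball 0 1) z * (indicator strip y * ennreal \<bar>f (y + s *\<^sub>R z)\<bar>)) \<partial>lborel)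
        = ennreal (c * B) * (indicator (cball 0 1) z * J)"
        by (simp add: nn_integral_cmult)
    qed
    also have "\<dots> = ennreal (c * B) * (emeasure lborel (cball (0 :: real \<times> (real ^ 'd)) 1) * J)"
      by (simp add: nn_integral_cmult nn_integral_multc)
    also have "\<dots> < \<infinity>"
      using J emeasure_bounded_finite[OF bounded_cball, of "0 :: real \<times> (real ^ 'd)" 1] by (simp add: ennreal_mult_less_top)
    finally show "(\<integral>\<^sup>+p. ennreal (norm (case p of (y, z) \<Rightarrow> indicator strip y * (K z * f (y + s *\<^sub>R z) * g y z))) \<partial>(lborel \<Otimes>\<^sub>M lborel)) < \<infinity>" .
  qed
  have "(LBINT y:strip. f y * mol K \<epsilon> \<psi> y)
      = (LINT y|lborel. LINT z|lborel. indicator strip y * (K z * f (y + 0 *\<^sub>R z) * \<psi> (y - \<epsilon> *\<^sub>R z)))"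
    unfolding set_lebesgue_integral_def mol_def by (simp flip: integral_mult_right_zero add: mult_ac)
  also have "\<dots> = (LINT z|lborel. LINT y|lborel. indicator strip y * (K z * f (y + 0 *\<^sub>R z) * \<psi> (y - \<epsilon> *\<^sub>R z)))"
    by (rule lborel_pair.Fubini_integral[symmetric], rule int2) (use B in auto)
  also have "\<dots> = (LINT z|lborel. LINT y|lborel. indicator strip y * (K z * f (y + \<epsilon> *\<^sub>R z) * \<psi> y))"
  proof (rule Bochner_Integration.integral_cong[OF refl])
    fix z :: "real \<times> (real ^ 'd)"
    define h where "h y = K z * f (y + \<epsilon> *\<^sub>R z) * \<psi> y" for y
    have hm: "h \<in> borel_measurable borel" unfolding h_def by measurable
    have hp: "space_periodic h" unfolding space_periodic_def h_def
    proof (intro allI)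
      fix t x i
      have "f ((t, x + axis i 1) + \<epsilon> *\<^sub>R z) = f ((t, x) + \<epsilon> *\<^sub>R z)"
        using perf[unfolded space_periodic_def, rule_format, of "t + \<epsilon> * fst z" "x + \<epsilon> *\<^sub>R snd z" i]
        by (cases z) (simp add: algebra_simps)
      moreover have "\<psi> (t, x + axis i 1) = \<psi> (t, x)" using perp unfolding space_periodic_def by blast
      ultimately show "K z * f ((t, x + axis i 1) + \<epsilon> *\<^sub>R z) * \<psi> (t, x + axis i 1) = K z * f ((t, x) + \<epsilon> *\<^sub>R z) * \<psi> (t, x)" by simp
    qed
    have "(LBINT y:strip. h (y + - (\<epsilon> *\<^sub>R z))) = (LBINT y:strip. h y)"
      by (rule set_integral_strip_shift[OF hm hp])
    then show "(LINT y|lborel. indicator strip y * (K z * f (y + 0 *\<^sub>R z) * \<psi> (y - \<epsilon> *\<^sub>R z)))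
        = (LINT y|lborel. indicator strip y * (K z * f (y + \<epsilon> *\<^sub>R z) * \<psi> y))"
      unfolding h_def set_lebesgue_integral_def by simp
  qed
  also have "\<dots> = (LINT y|lborel. LINT z|lborel. indicator strip y * (K z * f (y + \<epsilon> *\<^sub>R z) * \<psi> y))"
    by (rule lborel_pair.Fubini_integral, rule int2) (use B in auto)
  also have "\<dots> = (LINT y|lborel. indicator strip y *\<^sub>R (mol (\<lambda>z. K (- z)) \<epsilon> f y * \<psi> y))"
  proof (rule Bochner_Integration.integral_cong[OF refl])
    fix y :: "real \<times> (real ^ 'd)"
    have "(LINT z|lborel. K z * f (y + \<epsilon> *\<^sub>R z)) = mol (\<lambda>z. K (- z)) \<epsilon> f y"
      unfolding mol_def using lborel_integral_rescale[of "\<lambda>z. K z * f (y + \<epsilon> *\<^sub>R z)" 1 0] by simp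
    then show "(LINT z|lborel. indicator strip y * (K z * f (y + \<epsilon> *\<^sub>R z) * \<psi> y)) = indicator strip y *\<^sub>R (mol (\<lambda>z. K (- z)) \<epsilon> f y * \<psi> y)"
      by simp
  qed
  finally show ?thesis unfolding set_lebesgue_integral_def .
qed

lemma dir_deriv_even:
  assumes "C1 K" "\<And>z. K (- z) = K z" shows "dir_deriv v K (- z) = - dir_deriv v K z"
proof -
  have "((\<lambda>z. - z) has_derivative (\<lambda>h. - h)) (at z)" by (auto intro!: derivative_eq_intros)
  from has_derivative_compose[OF this C1_has_derivative[OF assms(1)]]
  have "(K has_derivative (\<lambda>h. dir_deriv (- h) K (- z))) (at z)" using assms(2) by simp
  then have "dir_deriv v K z = dir_deriv (- v) K (- z)" by (rule dir_deriv_eqI)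
  moreover have "dir_deriv (- v) K (- z) = - dir_deriv v K (- z)"
    using linear_neg[OF linear_dir_deriv[of K "- z"], of v] assms(1) unfolding C1_def by simp
  ultimately show ?thesis by simp
qed

text \<open>
  Moves the mollification from the test function to the field while the derivative stays: the
  derivative of an even kernel is odd, so the adjoint costs a sign, which integration by parts takes
  back.
\<close>
lemma integral_dir_deriv_mol:
  fixes f \<psi> :: "real \<times> (real ^ 'd) \<Rightarrow> real"
  assumes K: "bump_kernel K" and even: "\<And>z. K (- z) = K z" and \<epsilon>: "0 < \<epsilon>"
    and fm: "f \<in> borel_measurable borel" and perf: "space_periodic f" and int: "set_integrable lborel strip f"
    and C1: "C1 \<psi>" and perp: "space_periodic \<psi>" and supp: "time_supp a b \<psi>"
  shows "(LBINT y:strip. f y * dir_deriv v (mol K \<epsilon> \<psi>) y) = (LBINT y:strip. mol K \<epsilon> f y * dir_deriv v \<psi> y)"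
proof -
  have pc: "continuous_on UNIV \<psi>" by (rule C1_continuous[OF C1])
  have pm: "\<psi> \<in> borel_measurable borel" by (rule borel_measurable_continuous_onI[OF pc])
  obtain B where B: "\<And>y. \<bar>\<psi> y\<bar> \<le> B" using periodic_bounded[OF pc perp supp] by auto
  have lf: "loc_int f" by (rule loc_int_periodic[OF fm perf int])
  have lp: "loc_int \<psi>" by (rule loc_int_periodic[OF pm perp strip_integrable_C1[OF pc perp supp]])
  have Cm: "C1 (mol K \<epsilon> f)" by (rule smooth_C1[OF mol_smooth[OF K lf \<epsilon>]])
  have perm: "space_periodic (mol K \<epsilon> f)" by (rule space_periodic_mol[OF perf])
  have d: "dir_deriv v (mol K \<epsilon> f) y = (1 / \<epsilon>) * mol (dir_deriv v K) \<epsilon> f y" for y by (rule dir_deriv_mol[OF K lf \<epsilon>])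
  have odd: "mol (\<lambda>z. dir_deriv v K (- z)) \<epsilon> f y = - (\<epsilon> * dir_deriv v (mol K \<epsilon> f) y)" for y
    unfolding d dir_deriv_even[OF bump_kernel_C1[OF K] even] using \<epsilon> by (simp add: mol_def)
  have "(LBINT y:strip. f y * dir_deriv v (mol K \<epsilon> \<psi>) y) = (1 / \<epsilon>) * (LBINT y:strip. f y * mol (dir_deriv v K) \<epsilon> \<psi> y)"
    unfolding dir_deriv_mol[OF K lp \<epsilon>] set_lebesgue_integral_def by (simp flip: integral_mult_right_zero add: mult_ac)
  also have "\<dots> = (1 / \<epsilon>) * (LBINT y:strip. - (\<epsilon> * dir_deriv v (mol K \<epsilon> f) y) * \<psi> y)"
    unfolding mol_adjoint[OF bump_kernel_dir_deriv[OF K] fm perf int pm perp B] odd ..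
  also have "\<dots> = - (LBINT y:strip. dir_deriv v (mol K \<epsilon> f) y * \<psi> y)"
    unfolding set_lebesgue_integral_def using \<epsilon> by (simp flip: integral_mult_right_zero integral_minus add: mult_ac)
  also have "\<dots> = (LBINT y:strip. mol K \<epsilon> f y * dir_deriv v \<psi> y)"
  proof -
    have s: "time_supp a b (\<lambda>y. mol K \<epsilon> f y * \<psi> y)" using supp unfolding time_supp_def by auto
    have p: "space_periodic (\<lambda>y. mol K \<epsilon> f y * \<psi> y)" using perm perp unfolding space_periodic_def by auto
    have 0: "(LBINT y:strip. dir_deriv v (\<lambda>y. mol K \<epsilon> f y * \<psi> y) y) = 0"
      by (rule integral_dir_deriv_zero[OF C1_mult[OF Cm C1] p s])
    have i1: "set_integrable lborel strip (\<lambda>y. mol K \<epsilon> f y * dir_deriv v \<psi> y)"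
    proof (rule strip_integrable_C1)
      show "space_periodic (\<lambda>y. mol K \<epsilon> f y * dir_deriv v \<psi> y)"
        using perm space_periodic_dir_deriv[OF C1 perp] unfolding space_periodic_def by auto
      show "time_supp a b (\<lambda>y. mol K \<epsilon> f y * dir_deriv v \<psi> y)"
        using time_supp_dir_deriv[OF supp, of v] unfolding time_supp_def by auto
    qed (intro continuous_intros C1_continuous[OF Cm] C1_dir_deriv_continuous[OF C1])
    have i2: "set_integrable lborel strip (\<lambda>y. dir_deriv v (mol K \<epsilon> f) y * \<psi> y)"
    proof (rule strip_integrable_C1)
      show "space_periodic (\<lambda>y. dir_deriv v (mol K \<epsilon> f) y * \<psi> y)"
        using perp space_periodic_dir_deriv[OF Cm perm] unfolding space_periodic_def by auto
      show "time_supp a b (\<lambda>y. dir_deriv v (mol K \<epsilon> f) y * \<psi> y)"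
        using supp unfolding time_supp_def by auto
    qed (intro continuous_intros C1_continuous[OF C1] C1_dir_deriv_continuous[OF Cm])
    show ?thesis using 0 set_integral_add(2)[OF i1 i2] unfolding dir_deriv_mult[OF Cm C1] by simp
  qed
  finally show ?thesis .
qed

section \<open>Pointwise commutator estimates\<close>

text \<open>
  Size in terms of the scale \<open>\<epsilon>\<close> and of a weight \<open>h\<close>. Products add
  the exponents of both; a term with \<open>h\<close>-exponent at most 1 is integrable when the weight
  is. This is Hoelder's inequality in pointwise form.
\<close>
definition bd :: "real \<Rightarrow> real \<Rightarrow> real \<Rightarrow> real \<Rightarrow> real \<Rightarrow> real \<Rightarrow> bool" where
  "bd \<epsilon> h A k e x \<longleftrightarrow> \<bar>x\<bar> \<le> A * (\<epsilon> powr k * h powr e)"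

lemma bd_mult:
  assumes "bd \<epsilon> h A k e x" "bd \<epsilon> h A' k' e' x'"
  shows "bd \<epsilon> h (A * A') (k + k') (e + e') (x * x')"
proof -
  have "\<bar>x * x'\<bar> \<le> (A * (\<epsilon> powr k * h powr e)) * (A' * (\<epsilon> powr k' * h powr e'))"
    using assms unfolding bd_def abs_mult by (intro mult_mono) auto
  then show ?thesis unfolding bd_def powr_add by (simp add: mult_ac)
qed

lemma bd_weaken:
  assumes "bd \<epsilon> h A k e x" "A \<le> A'" "0 \<le> A'" "k' \<le> k" "e \<le> e'" "0 < \<epsilon>" "\<epsilon> \<le> 1" "1 \<le> h"
  shows "bd \<epsilon> h A' k' e' x"
proof -
  have "\<epsilon> powr k \<le> \<epsilon> powr k'" using assms by (intro powr_mono') auto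
  moreover have "h powr e \<le> h powr e'" using assms by (intro powr_mono) auto
  ultimately have "A * (\<epsilon> powr k * h powr e) \<le> A' * (\<epsilon> powr k' * h powr e')"
    using assms by (intro mult_mono) auto
  then show ?thesis using assms(1) unfolding bd_def by linarith
qed

lemma bd_add:
  assumes "bd \<epsilon> h A k e x" "bd \<epsilon> h A' k e x'"
  shows "bd \<epsilon> h (A + A') k e (x + x')"
  using assms unfolding bd_def by (simp add: distrib_right)

lemma bd_minus: "bd \<epsilon> h A k e (- x) \<longleftrightarrow> bd \<epsilon> h A k e x"
  unfolding bd_def by simp

lemma bd_diff:
  assumes "bd \<epsilon> h A k e x" "bd \<epsilon> h A' k e x'"
  shows "bd \<epsilon> h (A + A') k e (x - x')"
  using bd_add[OF assms(1), of A' "- x'"] assms(2) by (simp add: bd_minus)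

lemma bd_sum:
  assumes "\<And>i. i \<in> I \<Longrightarrow> bd \<epsilon> h A k e (f i)"
  shows "bd \<epsilon> h (real (card I) * A) k e (\<Sum>i\<in>I. f i)"
proof -
  have "\<bar>\<Sum>i\<in>I. f i\<bar> \<le> (\<Sum>i\<in>I. A * (\<epsilon> powr k * h powr e))"
    using assms unfolding bd_def by (intro order_trans[OF sum_abs] sum_mono) auto
  then show ?thesis unfolding bd_def by simp
qed

lemma powr_le_one_plus: "0 \<le> x \<Longrightarrow> 0 \<le> e \<Longrightarrow> e \<le> 1 \<Longrightarrow> x powr e \<le> 1 + (x::real)"
proof (cases "x \<le> 1")
  case True
  assume "0 \<le> x" "0 \<le> e"
  then have "x powr e \<le> 1 powr e" using True by (intro powr_mono2) auto
  then show ?thesis using \<open>0 \<le> x\<close> by simp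
next
  case False
  assume "e \<le> 1"
  then have "x powr e \<le> x powr 1" using False by (intro powr_mono) auto
  then show ?thesis using False by simp
qed

definition unit_ball_measure :: "'a::euclidean_space itself \<Rightarrow> real" where
  "unit_ball_measure T = measure lborel (cball (0 :: 'a) 1)"

text \<open>
  Since the power \<open>e\<close> is at most 1, averaging costs no more than Jensen would, up to a
  constant: the exponents of the weight thus survive mollification.
\<close>
lemma
  fixes K F w :: "'a::euclidean_space \<Rightarrow> real"
  assumes Km[measurable]: "K \<in> borel_measurable borel" and K: "\<And>z. \<bar>K z\<bar> \<le> c * indicator (cball 0 1) z"
    and Fm[measurable]: "F \<in> borel_measurable borel" and wm[measurable]: "w \<in> borel_measurable borel"
    and w: "\<And>z. 0 \<le> w z" and wh: "(\<integral>\<^sup>+z. indicator (cball 0 1) z * ennreal (w z) \<partial>lborel) \<le> ennreal h"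
    and h: "0 < h" and e: "0 \<le> e" "e \<le> 1" and c: "0 \<le> c" and A: "0 \<le> A"
    and F: "AE z in lborel. z \<in> cball 0 1 \<longrightarrow> \<bar>F z\<bar> \<le> A * w z powr e"
  shows kernel_average_integrable: "integrable lborel (\<lambda>z. K z * F z)"
    and kernel_average_bound: "\<bar>LINT z|lborel. K z * F z\<bar> \<le> c * (unit_ball_measure TYPE('a) + 1) * A * h powr e"
proof -
  define \<omega> where "\<omega> = unit_ball_measure TYPE('a)"
  have [measurable]: "cball (0 :: 'a) 1 \<in> sets borel" by simp
  have iw: "integrable lborel (\<lambda>z. indicator (cball 0 1) z * w z)"
  proof (rule integrableI_bounded)
    have "(\<integral>\<^sup>+z. ennreal (norm (indicator (cball 0 1) z * w z)) \<partial>lborel) = (\<integral>\<^sup>+z. indicator (cball 0 1) z * ennreal (w z) \<partial>lborel)"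
      using w by (intro nn_integral_cong) (auto simp: indicator_def)
    then show "(\<integral>\<^sup>+z. ennreal (norm (indicator (cball 0 1) z * w z)) \<partial>lborel) < \<infinity>"
      using wh by (simp add: order_le_less_trans ennreal_less_top)
  qed measurable
  have Iw: "(LINT z|lborel. indicator (cball 0 1) z * w z) \<le> h"
  proof -
    have "ennreal (LINT z|lborel. indicator (cball 0 1) z * w z) = (\<integral>\<^sup>+z. ennreal (indicator (cball 0 1) z * w z) \<partial>lborel)"
      using iw w by (intro nn_integral_eq_integral[symmetric]) auto
    also have "\<dots> = (\<integral>\<^sup>+z. indicator (cball 0 1) z * ennreal (w z) \<partial>lborel)"
      by (intro nn_integral_cong) (auto simp: indicator_def)
    finally have "ennreal (LINT z|lborel. indicator (cball 0 1) z * w z) \<le> ennreal h" using wh by simp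
    then show ?thesis using h by (simp add: ennreal_le_iff)
  qed
  have ic: "integrable lborel (indicator (cball (0::'a) 1) :: 'a \<Rightarrow> real)"
    using emeasure_bounded_finite[OF bounded_cball, of "0 :: 'a" 1] by (intro integrable_real_indicator) auto
  define G where "G z = (c * A * h powr e) * (indicator (cball 0 1) z + (1 / h) * (indicator (cball 0 1) z * w z))" for z
  have iG: "integrable lborel G" unfolding G_def using ic iw by auto
  have KG: "AE z in lborel. norm (K z * F z) \<le> G z"
    using F
  proof eventually_elim
    case (elim z)
    show ?case
    proof (cases "z \<in> cball 0 1")
      case False then show ?thesis using K[of z] by (simp add: G_def)
    next
      case True
      \<comment> \<open>Normalizing by \<open>h\<close> turns \<open>x powr e \<le> 1 + x\<close> into a substitute for Jensen's inequality.\<close>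
      have "w z powr e = (h * (w z / h)) powr e" using h by simp
      also have "\<dots> = h powr e * (w z / h) powr e" by (rule powr_mult)
      also have "\<dots> \<le> h powr e * (1 + w z / h)"
        using h w[of z] e by (intro mult_left_mono powr_le_one_plus) auto
      finally have "A * w z powr e \<le> A * (h powr e * (1 + w z / h))" using A by (intro mult_left_mono)
      then have "\<bar>F z\<bar> \<le> A * (h powr e * (1 + w z / h))" using elim True by auto
      then have "\<bar>K z\<bar> * \<bar>F z\<bar> \<le> c * (A * (h powr e * (1 + w z / h)))"
        using K[of z] True c by (intro mult_mono) auto
      then show ?thesis using True unfolding G_def by (simp add: abs_mult mult_ac)
    qed
  qed
  have "AE z in lborel. norm (K z * F z) \<le> norm (G z)" using KG by eventually_elim simp
  then show i: "integrable lborel (\<lambda>z. K z * F z)"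
    by (intro Bochner_Integration.integrable_bound[OF iG]) measurable
  have "\<bar>LINT z|lborel. K z * F z\<bar> \<le> (LINT z|lborel. norm (K z * F z))"
    using integral_norm_bound[of lborel "\<lambda>z. K z * F z"] by simp
  also have "\<dots> \<le> (LINT z|lborel. G z)"
    using i iG KG by (intro integral_mono_AE) auto
  also have "\<dots> = (c * A * h powr e) * (\<omega> + (1 / h) * (LINT z|lborel. indicator (cball 0 1) z * w z))"
    unfolding G_def using ic iw by (simp add: \<omega>_def unit_ball_measure_def)
  also have "\<dots> \<le> (c * A * h powr e) * (\<omega> + (1 / h) * h)"
    using Iw h c A by (intro mult_left_mono add_left_mono) auto
  also have "\<dots> = c * (\<omega> + 1) * A * h powr e" using h by (simp add: mult_ac)
  finally show "\<bar>LINT z|lborel. K z * F z\<bar> \<le> c * (unit_ball_measure TYPE('a) + 1) * A * h powr e"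
    unfolding \<omega>_def .
qed

lemma integral_odd_zero:
  fixes f :: "'a::euclidean_space \<Rightarrow> real"
  assumes [measurable]: "f \<in> borel_measurable borel" and "\<And>z. f (- z) = - f z"
  shows "(LINT z|lborel. f z) = 0"
  using lborel_integral_rescale[of f 1 0] assms(2) by simp

text \<open>
  A point at which the oscillations of all fields at scale \<open>\<epsilon>\<close> are controlled by
  powers of one function \<open>w\<close> of the rescaled increment, whose integral is at most
  \<open>h\<close>. The set \<open>V\<close> collects the directions in which derivatives are taken.
\<close>
locale weighted_point =
  fixes K :: "'a::euclidean_space \<Rightarrow> real" and c \<epsilon> h B :: real and w :: "'a \<Rightarrow> real" and y :: 'a and V :: "'a set"
  assumes K: "bump_kernel K" and even: "\<And>z. K (- z) = K z" and nonneg: "\<And>z. 0 \<le> K z"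
    and K1: "(LINT z|lborel. K z) = 1"
    and c: "0 \<le> c" "\<And>z. \<bar>K z\<bar> \<le> c * indicator (cball 0 1) z"
      "\<And>v z. v \<in> V \<Longrightarrow> \<bar>dir_deriv v K z\<bar> \<le> c * indicator (cball 0 1) z"
    and \<epsilon>: "0 < \<epsilon>" "\<epsilon> \<le> 1" and h: "1 \<le> h" and B: "0 \<le> B"
    and wm[measurable]: "w \<in> borel_measurable borel" and w1: "\<And>z. 1 \<le> w z"
    and wh: "(\<integral>\<^sup>+z. indicator (cball 0 1) z * ennreal (w z) \<partial>lborel) \<le> ennreal h"
begin

text \<open>
  Regularity of order \<open>k\<close> at the point, with \<open>e\<close> in the role of the
  reciprocal integrability exponent.
\<close>
definition osc :: "real \<Rightarrow> real \<Rightarrow> ('a \<Rightarrow> real) \<Rightarrow> bool" where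
  "osc k e f \<longleftrightarrow> loc_int f \<and> (AE z in lborel. z \<in> cball 0 1 \<longrightarrow>
     \<bar>f (y - \<epsilon> *\<^sub>R z) - f y\<bar> \<le> (B * \<epsilon> powr k) * w z powr e)"

definition "LK = c * (unit_ball_measure TYPE('a) + 1)"

lemma LK_nonneg: "0 \<le> LK" unfolding LK_def unit_ball_measure_def using c by simp

lemmas average_bound = kernel_average_bound[where 'a = 'a and c = c, folded LK_def]

lemma w0: "0 \<le> w z" using w1[of z] by linarith

lemma h0: "0 < h" using h by linarith

lemma Km[measurable]: "K \<in> borel_measurable borel" by (rule bump_kernel_borel[OF K])

lemma osc_borel: "osc k e f \<Longrightarrow> f \<in> borel_measurable borel"
  unfolding osc_def using loc_int_borel by blast

lemma K_integrable: "integrable lborel K"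
  using kernel_average_integrable[OF Km c(2), of "\<lambda>_. 1" w h 1 1] wm w0 wh h0 c(1) w1 by auto

lemma mol_difference:
  assumes "osc k e f"
  shows "mol K \<epsilon> f y - f y = (LINT z|lborel. K z * (f (y - \<epsilon> *\<^sub>R z) - f y))"
proof -
  have i: "integrable lborel (\<lambda>z. K z * f (y - \<epsilon> *\<^sub>R z))"
    using loc_int_kernel_integrable(1)[OF K _ \<epsilon>(1)] assms unfolding osc_def by blast
  show ?thesis unfolding mol_def right_diff_distrib
    using i K_integrable K1 by (simp add: Bochner_Integration.integral_diff)
qed

lemma mol_error:
  assumes f: "osc k e f" and e: "0 \<le> e" "e \<le> 1"
  shows "bd \<epsilon> h (LK * B) k e (mol K \<epsilon> f y - f y)"
proof -
  note [measurable] = osc_borel[OF f]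
  have "\<bar>LINT z|lborel. K z * (f (y - \<epsilon> *\<^sub>R z) - f y)\<bar> \<le> LK * (B * \<epsilon> powr k) * h powr e"
    by (rule average_bound[OF Km c(2) _ wm w0 wh h0 e c(1)])
       (use f B in \<open>auto simp: osc_def\<close>)
  then show ?thesis unfolding bd_def mol_difference[OF f] by (simp add: mult_ac)
qed

text \<open>
  The derivative of the kernel has mean 0, so that the field may be replaced by its increment;
  rescaling the kernel costs the factor \<open>1 / \<epsilon>\<close>.
\<close>
lemma dir_deriv_mol_bound:
  assumes f: "osc k e f" and e: "0 \<le> e" "e \<le> 1" and v: "v \<in> V"
  shows "bd \<epsilon> h (LK * B) (k - 1) e (dir_deriv v (mol K \<epsilon> f) y)"
proof -
  note fm[measurable] = osc_borel[OF f]
  have lf: "loc_int f" using f unfolding osc_def by blast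
  have Kd: "bump_kernel (dir_deriv v K)" by (rule bump_kernel_dir_deriv[OF K])
  note dm[measurable] = bump_kernel_borel[OF Kd]
  have id: "integrable lborel (dir_deriv v K)"
    using kernel_average_integrable[OF dm c(3)[OF v], of "\<lambda>_. 1" w h 1 1] wm w0 wh h0 c(1) w1 by auto
  have z: "(LINT z|lborel. dir_deriv v K z) = 0"
    by (rule integral_odd_zero[OF dm]) (rule dir_deriv_even[OF bump_kernel_C1[OF K] even])
  have i: "integrable lborel (\<lambda>z. dir_deriv v K z * f (y - \<epsilon> *\<^sub>R z))"
    by (rule loc_int_kernel_integrable(1)[OF Kd lf \<epsilon>(1)])
  have "mol (dir_deriv v K) \<epsilon> f y = (LINT z|lborel. dir_deriv v K z * (f (y - \<epsilon> *\<^sub>R z) - f y))"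
    unfolding mol_def right_diff_distrib using i id z by (simp add: Bochner_Integration.integral_diff)
  also have "\<bar>\<dots>\<bar> \<le> LK * (B * \<epsilon> powr k) * h powr e"
    by (rule average_bound[OF dm c(3)[OF v] _ wm w0 wh h0 e c(1)])
       (use f B in \<open>auto simp: osc_def\<close>)
  finally have "(1 / \<epsilon>) * \<bar>mol (dir_deriv v K) \<epsilon> f y\<bar> \<le> (1 / \<epsilon>) * (LK * (B * \<epsilon> powr k) * h powr e)"
    using \<epsilon> by (intro mult_left_mono) auto
  then show ?thesis unfolding bd_def dir_deriv_mol[OF K lf \<epsilon>(1)] powr_diff using \<epsilon> by (simp add: abs_mult mult_ac)
qed

text \<open>
  The identity of Constantin, E and Titi: the commutator is the mollified product of the increments
  minus the product of the mollification errors, and both are quadratic in the oscillations.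
\<close>
lemma commutator_bound:
  assumes f: "osc k1 e1 f" and g: "osc k2 e2 g" and fg: "loc_int (\<lambda>y. f y * g y)"
    and e: "0 \<le> e1" "0 \<le> e2" "e1 + e2 \<le> 1"
  shows "bd \<epsilon> h (LK * B * B + (LK * B) * (LK * B)) (k1 + k2) (e1 + e2)
    (mol K \<epsilon> (\<lambda>y. f y * g y) y - mol K \<epsilon> f y * mol K \<epsilon> g y)"
proof -
  note [measurable] = osc_borel[OF f] osc_borel[OF g]
  have lf: "loc_int f" "loc_int g" using f g unfolding osc_def by blast+
  note i = loc_int_kernel_integrable(1)[OF K lf(1) \<epsilon>(1), of y] loc_int_kernel_integrable(1)[OF K lf(2) \<epsilon>(1), of y]
    loc_int_kernel_integrable(1)[OF K fg \<epsilon>(1), of y]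
  define X where "X = (LINT z|lborel. K z * ((f (y - \<epsilon> *\<^sub>R z) - f y) * (g (y - \<epsilon> *\<^sub>R z) - g y)))"
  have "X = (LINT z|lborel. K z * (f (y - \<epsilon> *\<^sub>R z) * g (y - \<epsilon> *\<^sub>R z)) - g y * (K z * f (y - \<epsilon> *\<^sub>R z))
      - f y * (K z * g (y - \<epsilon> *\<^sub>R z)) + f y * g y * K z)"
    unfolding X_def by (rule Bochner_Integration.integral_cong) (auto simp: algebra_simps)
  also have "\<dots> = mol K \<epsilon> (\<lambda>y. f y * g y) y - g y * mol K \<epsilon> f y - f y * mol K \<epsilon> g y + f y * g y"
    unfolding mol_def using i K_integrable K1 by simp
  finally have X: "mol K \<epsilon> (\<lambda>y. f y * g y) y - mol K \<epsilon> f y * mol K \<epsilon> g y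
    = X - (mol K \<epsilon> f y - f y) * (mol K \<epsilon> g y - g y)" by (simp add: algebra_simps)
  have "\<bar>X\<bar> \<le> LK * ((B * \<epsilon> powr k1) * (B * \<epsilon> powr k2)) * h powr (e1 + e2)"
    unfolding X_def
  proof (rule average_bound[OF Km c(2) _ wm w0 wh h0 _ e(3) c(1)])
    have "AE z in lborel. z \<in> cball 0 1 \<longrightarrow> \<bar>f (y - \<epsilon> *\<^sub>R z) - f y\<bar> \<le> (B * \<epsilon> powr k1) * w z powr e1"
      "AE z in lborel. z \<in> cball 0 1 \<longrightarrow> \<bar>g (y - \<epsilon> *\<^sub>R z) - g y\<bar> \<le> (B * \<epsilon> powr k2) * w z powr e2"
      using f g unfolding osc_def by blast+
    then show "AE z in lborel. z \<in> cball 0 1 \<longrightarrow> \<bar>(f (y - \<epsilon> *\<^sub>R z) - f y) * (g (y - \<epsilon> *\<^sub>R z) - g y)\<bar>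
        \<le> (B * \<epsilon> powr k1) * (B * \<epsilon> powr k2) * w z powr (e1 + e2)"
    proof eventually_elim
      case (elim z)
      show ?case
      proof
        assume "z \<in> cball 0 1"
        then have "\<bar>f (y - \<epsilon> *\<^sub>R z) - f y\<bar> * \<bar>g (y - \<epsilon> *\<^sub>R z) - g y\<bar>
          \<le> ((B * \<epsilon> powr k1) * w z powr e1) * ((B * \<epsilon> powr k2) * w z powr e2)"
          using elim B by (intro mult_mono) auto
        then show "\<bar>(f (y - \<epsilon> *\<^sub>R z) - f y) * (g (y - \<epsilon> *\<^sub>R z) - g y)\<bar>
          \<le> (B * \<epsilon> powr k1) * (B * \<epsilon> powr k2) * w z powr (e1 + e2)"
          by (simp add: abs_mult powr_add mult_ac)
      qed
    qed
  qed (use e B in auto)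
  then have "bd \<epsilon> h (LK * B * B) (k1 + k2) (e1 + e2) X" unfolding bd_def by (simp add: powr_add mult_ac)
  moreover have "bd \<epsilon> h ((LK * B) * (LK * B)) (k1 + k2) (e1 + e2) ((mol K \<epsilon> f y - f y) * (mol K \<epsilon> g y - g y))"
    by (rule bd_mult[OF mol_error[OF f] mol_error[OF g]]) (use e in auto)
  ultimately show ?thesis unfolding X by (rule bd_diff)
qed

lemma mol_range:
  assumes lf: "loc_int f" and r: "\<And>z. z \<in> cball 0 1 \<Longrightarrow> f (y - \<epsilon> *\<^sub>R z) \<in> {lo..hi}"
  shows "mol K \<epsilon> f y \<in> {lo..hi}"
proof -
  have i: "integrable lborel (\<lambda>z. K z * f (y - \<epsilon> *\<^sub>R z))" by (rule loc_int_kernel_integrable(1)[OF K lf \<epsilon>(1)])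
  have K0: "K z = 0" if "z \<notin> cball 0 1" for z using c(2)[of z] that by simp
  have "(LINT z|lborel. K z * lo) \<le> mol K \<epsilon> f y" unfolding mol_def
  proof (rule integral_mono)
    show "K z * lo \<le> K z * f (y - \<epsilon> *\<^sub>R z)" for z
      using K0[of z] r[of z] nonneg[of z] by (cases "z \<in> cball 0 1") (auto intro!: mult_left_mono)
  qed (use i K_integrable in auto)
  moreover have "mol K \<epsilon> f y \<le> (LINT z|lborel. K z * hi)" unfolding mol_def
  proof (rule integral_mono)
    show "K z * f (y - \<epsilon> *\<^sub>R z) \<le> K z * hi" for z
      using K0[of z] r[of z] nonneg[of z] by (cases "z \<in> cball 0 1") (auto intro!: mult_left_mono)
  qed (use i K_integrable in auto)
  ultimately show ?thesis using K1 by simp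
qed

text \<open>
  The commutator of mollification with a function whose derivative is Hoelder continuous of order
  \<open>\<gamma> - 1\<close> is of order \<open>\<gamma>\<close>, not only 1, in the oscillation.
\<close>
lemma pressure_commutator_bound:
  assumes f: "osc \<beta> b f" and lg: "loc_int G"
    and r: "\<And>z. z \<in> cball 0 1 \<Longrightarrow> f (y - \<epsilon> *\<^sub>R z) \<in> {lo..hi} \<and> G (y - \<epsilon> *\<^sub>R z) = p (f (y - \<epsilon> *\<^sub>R z))"
    and taylor: "\<And>s t. s \<in> {lo..hi} \<Longrightarrow> t \<in> {lo..hi} \<Longrightarrow> \<bar>p s - p t - g t * (s - t)\<bar> \<le> C * \<bar>s - t\<bar> powr \<gamma>"
    and C: "0 \<le> C" and e: "0 \<le> b" "\<gamma> * b \<le> 1" and \<gamma>: "1 \<le> \<gamma>"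
  shows "bd \<epsilon> h (LK * (C * (B + LK * B) powr \<gamma>) * (unit_ball_measure TYPE('a) + 1)) (\<gamma> * \<beta>) (\<gamma> * b)
    (mol K \<epsilon> G y - p (mol K \<epsilon> f y))"
proof -
  define \<omega> where "\<omega> = unit_ball_measure TYPE('a)"
  have \<omega>: "0 \<le> \<omega>" unfolding \<omega>_def unit_ball_measure_def by simp
  note [measurable] = osc_borel[OF f] loc_int_borel[OF lg]
  have [measurable]: "cball (0 :: 'a) 1 \<in> sets borel" by simp
  have lf: "loc_int f" using f unfolding osc_def by blast
  have b1: "b \<le> 1" using e \<gamma> mult_right_mono[of 1 \<gamma> b] by linarith
  define R where "R = mol K \<epsilon> f y"
  have R: "R \<in> {lo..hi}" unfolding R_def by (rule mol_range[OF lf]) (use r in auto)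
  \<comment> \<open>Subtracting the linear Taylor term costs nothing, since \<open>f (y - \<epsilon> z) - R\<close> has weighted mean zero.\<close>
  define F where "F z = G (y - \<epsilon> *\<^sub>R z) - p R - g R * (f (y - \<epsilon> *\<^sub>R z) - R)" for z
  have [measurable]: "F \<in> borel_measurable borel" unfolding F_def by measurable
  note i = loc_int_kernel_integrable(1)[OF K lf \<epsilon>(1), of y] loc_int_kernel_integrable(1)[OF K lg \<epsilon>(1), of y]
  have "(LINT z|lborel. K z * F z) = (LINT z|lborel. K z * G (y - \<epsilon> *\<^sub>R z) - p R * K z - (g R * (K z * f (y - \<epsilon> *\<^sub>R z)) - g R * R * K z))"
    unfolding F_def by (rule Bochner_Integration.integral_cong) (auto simp: algebra_simps)
  also have "\<dots> = mol K \<epsilon> G y - p R"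
    unfolding mol_def using i K_integrable K1 by (simp add: R_def[unfolded mol_def, symmetric])
  finally have eq: "mol K \<epsilon> G y - p R = (LINT z|lborel. K z * F z)" by simp
  \<comment> \<open>The increment \<open>f (y - \<epsilon> z) - R\<close> splits at \<open>f y\<close>; its two parts are controlled by \<open>w z\<close> and by \<open>h\<close>, hence
     both by the weight \<open>w'\<close>.\<close>
  define w' where "w' z = w z + h" for z
  have "\<bar>LINT z|lborel. K z * F z\<bar> \<le> LK * (C * ((B + LK * B) * \<epsilon> powr \<beta>) powr \<gamma>) * ((\<omega> + 1) * h) powr (\<gamma> * b)"
  proof (rule average_bound[OF Km c(2), where w=w'])
    show "w' \<in> borel_measurable borel" unfolding w'_def by measurable
    have "(\<integral>\<^sup>+z. indicator (cball 0 1) z * ennreal (w' z) \<partial>lborel)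
       = (\<integral>\<^sup>+z. indicator (cball (0 :: 'a) 1) z * ennreal (w z) + ennreal h * indicator (cball 0 1) z \<partial>lborel)"
      unfolding w'_def using w0 h0 by (intro nn_integral_cong) (auto simp: indicator_def)
    also have "\<dots> = (\<integral>\<^sup>+z. indicator (cball (0 :: 'a) 1) z * ennreal (w z) \<partial>lborel) + ennreal h * emeasure lborel (cball (0::'a) 1)"
      by (subst nn_integral_add) (auto simp: nn_integral_cmult_indicator)
    also have "emeasure lborel (cball (0::'a) 1) = ennreal \<omega>"
      unfolding \<omega>_def unit_ball_measure_def using emeasure_bounded_finite[OF bounded_cball, of "0 :: 'a" 1] by (simp add: emeasure_eq_ennreal_measure)
    also have "(\<integral>\<^sup>+z. indicator (cball (0 :: 'a) 1) z * ennreal (w z) \<partial>lborel) + ennreal h * ennreal \<omega> \<le> ennreal h + ennreal h * ennreal \<omega>"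
      by (intro add_right_mono wh)
    also have "\<dots> = ennreal ((\<omega> + 1) * h)"
      using h0 \<omega> by (simp add: ennreal_mult[symmetric] ennreal_plus[symmetric] algebra_simps del: ennreal_plus)
    finally show "(\<integral>\<^sup>+z. indicator (cball 0 1) z * ennreal (w' z) \<partial>lborel) \<le> ennreal ((\<omega> + 1) * h)" .
    have RB: "\<bar>R - f y\<bar> \<le> (LK * B) * (\<epsilon> powr \<beta> * h powr b)"
      using mol_error[OF f e(1) b1] unfolding bd_def R_def .
    have "AE z in lborel. z \<in> cball 0 1 \<longrightarrow> \<bar>f (y - \<epsilon> *\<^sub>R z) - f y\<bar> \<le> (B * \<epsilon> powr \<beta>) * w z powr b"
      using f unfolding osc_def by blast
    then show "AE z in lborel. z \<in> cball 0 1 \<longrightarrow> \<bar>F z\<bar> \<le> (C * ((B + LK * B) * \<epsilon> powr \<beta>) powr \<gamma>) * w' z powr (\<gamma> * b)"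
    proof eventually_elim
      case (elim z)
      show ?case
      proof
        assume z: "z \<in> cball 0 1"
        define s where "s = f (y - \<epsilon> *\<^sub>R z)"
        have ww: "w z powr b \<le> w' z powr b" "h powr b \<le> w' z powr b"
          unfolding w'_def using w0[of z] h0 e by (auto intro!: powr_mono2)
        have "\<bar>s - R\<bar> \<le> \<bar>s - f y\<bar> + \<bar>R - f y\<bar>" by linarith
        also have "\<dots> \<le> (B * \<epsilon> powr \<beta>) * w z powr b + (LK * B) * (\<epsilon> powr \<beta> * h powr b)"
          using elim z RB unfolding s_def by (intro add_mono) auto
        also have "\<dots> \<le> (B * \<epsilon> powr \<beta>) * w' z powr b + (LK * B) * (\<epsilon> powr \<beta> * w' z powr b)"
          using ww B LK_nonneg by (intro add_mono mult_left_mono) auto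
        also have "\<dots> = ((B + LK * B) * \<epsilon> powr \<beta>) * w' z powr b" by (simp add: algebra_simps)
        finally have sR: "\<bar>s - R\<bar> \<le> ((B + LK * B) * \<epsilon> powr \<beta>) * w' z powr b" .
        have "\<bar>F z\<bar> \<le> C * \<bar>s - R\<bar> powr \<gamma>"
          using taylor[of s R] r[OF z] R unfolding F_def s_def by auto
        also have "\<dots> \<le> C * (((B + LK * B) * \<epsilon> powr \<beta>) * w' z powr b) powr \<gamma>"
          using sR \<gamma> C by (intro mult_left_mono powr_mono2) auto
        also have "\<dots> = (C * ((B + LK * B) * \<epsilon> powr \<beta>) powr \<gamma>) * w' z powr (\<gamma> * b)"
          using B LK_nonneg w0[of z] h0 by (simp add: powr_mult powr_powr mult_ac w'_def)
        finally show "\<bar>F z\<bar> \<le> (C * ((B + LK * B) * \<epsilon> powr \<beta>) powr \<gamma>) * w' z powr (\<gamma> * b)" .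
      qed
    qed
  qed (use w0 h0 e \<gamma> \<omega> c(1) C in \<open>auto simp: w'_def intro!: add_nonneg_nonneg less_imp_le\<close>)
  also have "\<dots> \<le> LK * (C * ((B + LK * B) * \<epsilon> powr \<beta>) powr \<gamma>) * ((\<omega> + 1) * h powr (\<gamma> * b))"
  proof -
    have "((\<omega> + 1) * h) powr (\<gamma> * b) = (\<omega> + 1) powr (\<gamma> * b) * h powr (\<gamma> * b)"
      by (rule powr_mult)
    also have "\<dots> \<le> (\<omega> + 1) powr 1 * h powr (\<gamma> * b)"
      using \<omega> e by (intro mult_right_mono powr_mono) auto
    finally have "((\<omega> + 1) * h) powr (\<gamma> * b) \<le> (\<omega> + 1) * h powr (\<gamma> * b)" using \<omega> by simp
    then show ?thesis using LK_nonneg C by (intro mult_left_mono) auto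
  qed
  also have "\<dots> = (LK * (C * (B + LK * B) powr \<gamma>) * (\<omega> + 1)) * (\<epsilon> powr (\<gamma> * \<beta>) * h powr (\<gamma> * b))"
    using B LK_nonneg \<epsilon> by (simp add: powr_mult powr_powr mult_ac)
  finally show ?thesis unfolding bd_def eq[unfolded R_def] \<omega>_def .
qed

end

text \<open>
  The capital letters stand for the mollified fields, \<open>A\<close>, \<open>q\<close> and
  \<open>k\<close> for the regularized enthalpy, pressure and second derivative of the potential at
  the mollified density. Each difference is expanded into products with at least one small factor. The
  four upper bounds on \<open>\<kappa>\<close> are the four orders that occur: mollification errors of
  velocity and density, quadratic commutators against one derivative of the velocity, and pressure
  terms. The pressure order arises three times: from the pressure commutator and from the truncated
  pressure, both against the divergence of the velocity, and from \<open>k\<close> times the momentum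
  commutator times the density gradient, where \<open>\<beta> (\<gamma> - 2) + (\<alpha> + \<beta>) +
  (\<beta> - 1) = \<alpha> + \<gamma> \<beta> - 1\<close>.
\<close>
lemma energy_defect_bounds:
  fixes u U m M :: "'d::finite \<Rightarrow> real" and Q DU :: "'d \<Rightarrow> 'd \<Rightarrow> real" and D0U DR :: "'d \<Rightarrow> real"
  assumes \<epsilon>: "0 < \<epsilon>" "\<epsilon> \<le> 1" and h: "1 \<le> h" and L: "1 \<le> L"
    and ab: "0 \<le> a" "0 \<le> b" "2 * a + b \<le> 1" "a + 2 * b \<le> 1"
    and \<gamma>: "1 < \<gamma>" "\<gamma> < 2" and \<alpha>\<beta>: "0 \<le> \<alpha>" "0 \<le> \<beta>"
    and \<kappa>: "\<kappa> \<le> \<alpha>" "\<kappa> \<le> \<beta>" "\<kappa> \<le> 2 * \<alpha> + \<beta> - 1" "\<kappa> \<le> \<alpha> + \<gamma> * \<beta> - 1"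
    and mu: "\<And>i. m i = \<rho> * u i"
    and u: "\<And>i. bd \<epsilon> h L 0 a (u i)" and U: "\<And>i. bd \<epsilon> h L 0 a (U i)" and dU: "\<And>i. bd \<epsilon> h L \<alpha> a (U i - u i)"
    and D0U: "\<And>i. bd \<epsilon> h L (\<alpha> - 1) a (D0U i)" and DU: "\<And>i j. bd \<epsilon> h L (\<alpha> - 1) a (DU i j)"
    and \<rho>: "bd \<epsilon> h L 0 0 \<rho>" and R: "bd \<epsilon> h L 0 0 R" and dR: "bd \<epsilon> h L \<beta> b (R - \<rho>)"
    and DR: "\<And>j. bd \<epsilon> h L (\<beta> - 1) b (DR j)"
    and m: "\<And>i. bd \<epsilon> h L 0 b (m i)" and dM: "\<And>i. bd \<epsilon> h L \<beta> b (M i - m i)"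
    and r: "\<And>i. bd \<epsilon> h L (\<alpha> + \<beta>) (a + b) (M i - R * U i)"
    and s: "\<And>i j. bd \<epsilon> h L (\<alpha> + \<beta>) (a + b) (Q i j - M j * U i)"
    and \<theta>: "bd \<epsilon> h L (\<gamma> * \<beta>) (\<gamma> * b) (Pm - pR)" and \<tau>: "bd \<epsilon> h L (\<gamma> * \<beta>) 0 (q - pR)"
    and A: "bd \<epsilon> h L 0 0 A" and k: "bd \<epsilon> h L (\<beta> * (\<gamma> - 2)) 0 k"
    and p: "bd \<epsilon> h L 0 0 p\<rho>" and dp: "bd \<epsilon> h L \<beta> b (pR - p\<rho>)"
    and P0: "bd \<epsilon> h L 0 0 P0" and X: "bd \<epsilon> h L \<beta> b (R * A - q - P0)"
  defines "C \<equiv> L ^ 4 * (10 + 10 * real CARD('d)) ^ 2"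
  shows "bd \<epsilon> h C \<kappa> 1 ((\<Sum>i\<in>UNIV. M i * U i) - R * (\<Sum>i\<in>UNIV. U i * U i) / 2 + (R * A - q)
      - (\<rho> * (\<Sum>i\<in>UNIV. u i * u i) / 2 + P0))"
    and "bd \<epsilon> h C \<kappa> 1 ((\<Sum>i\<in>UNIV. Q i j * U i) + Pm * U j - M j * (\<Sum>i\<in>UNIV. U i * U i) / 2 + M j * A - q * U j
      - (\<rho> * (\<Sum>i\<in>UNIV. u i * u i) / 2 + p\<rho> + P0) * u j)"
    and "bd \<epsilon> h C \<kappa> 1 ((\<Sum>i\<in>UNIV. (M i - R * U i) * D0U i) + (\<Sum>i\<in>UNIV. \<Sum>j\<in>UNIV. (Q i j - M j * U i) * DU i j)
      + (\<Sum>i\<in>UNIV. DU i i) * (Pm - q) + k * (\<Sum>j\<in>UNIV. (M j - R * U j) * DR j))"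
proof -
  define N where "N = real CARD('d)"
  have N: "1 \<le> N" unfolding N_def by (simp add: Suc_leI)
  define T where "T = bd \<epsilon> h (L ^ 4) \<kappa> 1"
  have \<gamma>\<beta>: "\<beta> \<le> \<gamma> * \<beta>" "\<gamma> * b \<le> 2 * b" using mult_right_mono[of 1 \<gamma> \<beta>] mult_right_mono[of \<gamma> 2 b] \<gamma> \<alpha>\<beta> ab by auto
  have pw: "L \<le> L ^ 4" "L * L \<le> L ^ 4" "L * L * L \<le> L ^ 4" "L * L * L * L \<le> L ^ 4" "0 \<le> L ^ 4"
    using L power_increasing[of 1 4 L] power_increasing[of 2 4 L] power_increasing[of 3 4 L]
    by (simp_all add: power2_eq_square power3_eq_cube power4_eq_xxxx)
  have T1: "T x" if "bd \<epsilon> h L k1 e1 x" "\<kappa> \<le> k1" "e1 \<le> 1" for x k1 e1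
    unfolding T_def using bd_weaken[OF that(1) pw(1) pw(5) that(2,3) \<epsilon> h] .
  have T2: "T (x1 * x2)" if "bd \<epsilon> h L k1 e1 x1" "bd \<epsilon> h L k2 e2 x2" "\<kappa> \<le> k1 + k2" "e1 + e2 \<le> 1" for x1 x2 k1 k2 e1 e2
    unfolding T_def using bd_weaken[OF bd_mult[OF that(1,2)] pw(2) pw(5) that(3,4) \<epsilon> h] .
  have T3: "T (x1 * x2 * x3)" if "bd \<epsilon> h L k1 e1 x1" "bd \<epsilon> h L k2 e2 x2" "bd \<epsilon> h L k3 e3 x3"
      "\<kappa> \<le> k1 + k2 + k3" "e1 + e2 + e3 \<le> 1" for x1 x2 x3 k1 k2 k3 e1 e2 e3
    unfolding T_def using bd_weaken[OF bd_mult[OF bd_mult[OF that(1,2)] that(3)] pw(3) pw(5) that(4,5) \<epsilon> h] .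
  have fin: "bd \<epsilon> h C \<kappa> 1 x" if "bd \<epsilon> h (n * L ^ 4) \<kappa> 1 x" "n \<le> (10 + 10 * N) ^ 2" for x n
  proof (rule bd_weaken[OF that(1) _ _ _ _ \<epsilon> h])
    show "n * L ^ 4 \<le> C" unfolding C_def N_def[symmetric] using mult_right_mono[OF that(2) pw(5)] by (simp add: mult.commute)
    show "0 \<le> C" unfolding C_def using pw(5) by auto
  qed auto
  have add: "bd \<epsilon> h ((n1 + n2) * L ^ 4) \<kappa> 1 (x + y)" if "bd \<epsilon> h (n1 * L ^ 4) \<kappa> 1 x" "bd \<epsilon> h (n2 * L ^ 4) \<kappa> 1 y" for n1 n2 x y
    using bd_add[OF that] by (simp add: distrib_right)
  have half: "bd \<epsilon> h (n * L ^ 4) \<kappa> 1 (- x / 2)" if "bd \<epsilon> h (n * L ^ 4) \<kappa> 1 x" "0 \<le> n" for n x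
    using that unfolding bd_def by simp
  have one: "bd \<epsilon> h (1 * L ^ 4) \<kappa> 1 x" if "T x" for x using that unfolding T_def by simp
  have S: "bd \<epsilon> h ((N * n) * L ^ 4) \<kappa> 1 (\<Sum>i\<in>(UNIV :: 'd set). f i)" if "\<And>i. bd \<epsilon> h (n * L ^ 4) \<kappa> 1 (f i)" for f n
    using bd_sum[of UNIV \<epsilon> h "n * L ^ 4" \<kappa> 1 f] that unfolding N_def by (simp add: mult_ac)
  have NN: "0 \<le> N * N" by simp
  have e1: "(\<Sum>i\<in>UNIV. M i * U i) - R * (\<Sum>i\<in>UNIV. U i * U i) / 2 + (R * A - q) - (\<rho> * (\<Sum>i\<in>UNIV. u i * u i) / 2 + P0)
    = (\<Sum>i\<in>UNIV. ((M i - m i) * U i + m i * (U i - u i))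
        + - ((R - \<rho>) * U i * U i + (\<rho> * (U i - u i) * U i + \<rho> * (U i - u i) * u i)) / 2) + (R * A - q - P0)"
  proof -
    have "(\<Sum>i\<in>UNIV. ((M i - m i) * U i + m i * (U i - u i))
        + - ((R - \<rho>) * U i * U i + (\<rho> * (U i - u i) * U i + \<rho> * (U i - u i) * u i)) / 2)
      = (\<Sum>i\<in>UNIV. M i * U i - R * (U i * U i) / 2 - \<rho> * (u i * u i) / 2)"
      by (intro sum.cong refl) (simp add: mu field_simps)
    then show ?thesis by (simp add: sum_subtractf sum_distrib_left sum_divide_distrib)
  qed
  have b1: "bd \<epsilon> h ((N * ((1 + 1) + (1 + (1 + 1))) + 1) * L ^ 4) \<kappa> 1 ((\<Sum>i\<in>UNIV. ((M i - m i) * U i + m i * (U i - u i))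
        + - ((R - \<rho>) * U i * U i + (\<rho> * (U i - u i) * U i + \<rho> * (U i - u i) * u i)) / 2) + (R * A - q - P0))"
    by (intro add S half one T1[OF X] T2[OF dM U] T2[OF m dU] T3[OF dR U U] T3[OF \<rho> dU U] T3[OF \<rho> dU u])
       (use \<kappa> ab \<alpha>\<beta> in auto)
  show "bd \<epsilon> h C \<kappa> 1 ((\<Sum>i\<in>UNIV. M i * U i) - R * (\<Sum>i\<in>UNIV. U i * U i) / 2 + (R * A - q)
      - (\<rho> * (\<Sum>i\<in>UNIV. u i * u i) / 2 + P0))"
    unfolding e1 by (rule fin[OF b1]) (use N NN in \<open>simp add: power2_eq_square algebra_simps\<close>)
  \<comment> \<open>Every summand below contains a commutator or a difference between a field and its mollification.\<close>
  have e2: "(\<Sum>i\<in>UNIV. Q i j * U i) + Pm * U j - M j * (\<Sum>i\<in>UNIV. U i * U i) / 2 + M j * A - q * U j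
      - (\<rho> * (\<Sum>i\<in>UNIV. u i * u i) / 2 + p\<rho> + P0) * u j
    = (\<Sum>i\<in>UNIV. (Q i j - M j * U i) * U i
          + ((M j - m j) * U i * U i + (m j * (U i - u i) * U i + m j * (U i - u i) * u i)) / 2)
      + ((Pm - pR) * U j + ((pR - p\<rho>) * U j + (p\<rho> * (U j - u j) + ((M j - R * U j) * A
      + ((R * A - q - P0) * U j + P0 * (U j - u j))))))"
  proof -
    have "(\<Sum>i\<in>UNIV. (Q i j - M j * U i) * U i
          + ((M j - m j) * U i * U i + (m j * (U i - u i) * U i + m j * (U i - u i) * u i)) / 2)
      = (\<Sum>i\<in>UNIV. Q i j * U i - M j * (U i * U i) / 2 - \<rho> * u j * (u i * u i) / 2)"
      by (intro sum.cong refl) (simp add: mu field_simps)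
    also have "\<dots> = (\<Sum>i\<in>UNIV. Q i j * U i) - M j * (\<Sum>i\<in>UNIV. U i * U i) / 2 - \<rho> * u j * (\<Sum>i\<in>UNIV. u i * u i) / 2"
      by (simp add: sum_subtractf sum_distrib_left sum_divide_distrib)
    finally show ?thesis by (simp add: algebra_simps)
  qed
  have half': "bd \<epsilon> h (n * L ^ 4) \<kappa> 1 (x / 2)" if "bd \<epsilon> h (n * L ^ 4) \<kappa> 1 x" "0 \<le> n" for n x
    using half[OF that] unfolding bd_def by simp
  have b2: "bd \<epsilon> h ((N * (1 + (1 + (1 + 1))) + (1 + (1 + (1 + (1 + (1 + 1)))))) * L ^ 4) \<kappa> 1 ((\<Sum>i\<in>UNIV. (Q i j - M j * U i) * U i
          + ((M j - m j) * U i * U i + (m j * (U i - u i) * U i + m j * (U i - u i) * u i)) / 2)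
      + ((Pm - pR) * U j + ((pR - p\<rho>) * U j + (p\<rho> * (U j - u j) + ((M j - R * U j) * A
      + ((R * A - q - P0) * U j + P0 * (U j - u j)))))))"
    by (intro add S half' one T2[OF s U] T3[OF dM U U] T3[OF m dU U] T3[OF m dU u] T2[OF \<theta> U] T2[OF dp U] T2[OF p dU]
         T2[OF r A] T2[OF X U] T2[OF P0 dU])
       (use \<kappa> ab \<alpha>\<beta> \<gamma>\<beta> in auto)
  show "bd \<epsilon> h C \<kappa> 1 ((\<Sum>i\<in>UNIV. Q i j * U i) + Pm * U j - M j * (\<Sum>i\<in>UNIV. U i * U i) / 2 + M j * A - q * U j
      - (\<rho> * (\<Sum>i\<in>UNIV. u i * u i) / 2 + p\<rho> + P0) * u j)"
    unfolding e2 by (rule fin[OF b2]) (use N NN in \<open>simp add: power2_eq_square algebra_simps\<close>)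
  have e3: "(\<Sum>i\<in>UNIV. (M i - R * U i) * D0U i) + (\<Sum>i\<in>UNIV. \<Sum>j\<in>UNIV. (Q i j - M j * U i) * DU i j)
      + (\<Sum>i\<in>UNIV. DU i i) * (Pm - q) + k * (\<Sum>j\<in>UNIV. (M j - R * U j) * DR j)
    = (\<Sum>i\<in>UNIV. (M i - R * U i) * D0U i) + ((\<Sum>i\<in>UNIV. \<Sum>j\<in>UNIV. (Q i j - M j * U i) * DU i j)
      + ((\<Sum>i\<in>UNIV. DU i i * (Pm - pR) + - (DU i i * (q - pR))) + (\<Sum>j\<in>UNIV. k * (M j - R * U j) * DR j)))"
    by (simp add: sum_distrib_left sum_distrib_right sum.distrib sum_subtractf algebra_simps)
  have neg: "bd \<epsilon> h (n * L ^ 4) \<kappa> 1 (- x)" if "bd \<epsilon> h (n * L ^ 4) \<kappa> 1 x" for n x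
    using that unfolding bd_def by simp
  have b3: "bd \<epsilon> h ((N * 1 + (N * (N * 1) + (N * (1 + 1) + N * 1))) * L ^ 4) \<kappa> 1
     ((\<Sum>i\<in>UNIV. (M i - R * U i) * D0U i) + ((\<Sum>i\<in>UNIV. \<Sum>j\<in>UNIV. (Q i j - M j * U i) * DU i j)
      + ((\<Sum>i\<in>UNIV. DU i i * (Pm - pR) + - (DU i i * (q - pR))) + (\<Sum>j\<in>UNIV. k * (M j - R * U j) * DR j))))"
    by (intro add S neg one T2[OF r D0U] T2[OF s DU] T2[OF DU \<theta>] T2[OF DU \<tau>] T3[OF k r DR])
       (use \<kappa> ab \<alpha>\<beta> \<gamma>\<beta> in \<open>auto simp: algebra_simps\<close>)
  show "bd \<epsilon> h C \<kappa> 1 ((\<Sum>i\<in>UNIV. (M i - R * U i) * D0U i) + (\<Sum>i\<in>UNIV. \<Sum>j\<in>UNIV. (Q i j - M j * U i) * DU i j)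
      + (\<Sum>i\<in>UNIV. DU i i) * (Pm - q) + k * (\<Sum>j\<in>UNIV. (M j - R * U j) * DR j))"
    unfolding e3 by (rule fin[OF b3]) (use N NN in \<open>simp add: power2_eq_square algebra_simps\<close>)
qed

section \<open>The energy identity for mollified fields\<close>

definition "time_dir = (1 :: real, 0 :: real ^ 'd)"
definition space_dir :: "'d \<Rightarrow> real \<times> (real ^ 'd)" where "space_dir j = (0, axis j 1)"

text \<open>
  The product rule, sorted by which derivative falls on the test function. The factor of
  \<open>\<phi>\<close> itself collects the commutators; it vanishes when mollification commutes with
  the nonlinearities.
\<close>
lemma energy_identity_pointwise:
  fixes U M U0 d DR :: "'d::finite \<Rightarrow> real" and Q DU :: "'d \<Rightarrow> 'd \<Rightarrow> real"
  shows "(\<Sum>i\<in>UNIV. M i * (\<phi> * U0 i + d0 * U i) + (\<Sum>j\<in>UNIV. Q i j * (\<phi> * DU i j + d j * U i)) + Pm * (\<phi> * DU i i + d i * U i))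
    - 1 / 2 * (R * (\<phi> * (\<Sum>i\<in>UNIV. U i * U0 i + U0 i * U i) + d0 * (\<Sum>i\<in>UNIV. U i * U i))
        + (\<Sum>j\<in>UNIV. M j * (\<phi> * (\<Sum>i\<in>UNIV. U i * DU i j + DU i j * U i) + d j * (\<Sum>i\<in>UNIV. U i * U i))))
    + (R * (\<phi> * (k * D0R) + d0 * A) + (\<Sum>j\<in>UNIV. M j * (\<phi> * (k * DR j) + d j * A)))
    - (\<phi> * (R * k * D0R) + d0 * q)
    - (\<Sum>j\<in>UNIV. (\<phi> * q) * DU j j + (\<phi> * (R * k * DR j) + d j * q) * U j)
    = d0 * ((\<Sum>i\<in>UNIV. M i * U i) - R * (\<Sum>i\<in>UNIV. U i * U i) / 2 + (R * A - q))
    + (\<Sum>j\<in>UNIV. d j * ((\<Sum>i\<in>UNIV. Q i j * U i) + Pm * U j - M j * (\<Sum>i\<in>UNIV. U i * U i) / 2 + M j * A - q * U j))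
    + \<phi> * ((\<Sum>i\<in>UNIV. (M i - R * U i) * U0 i) + (\<Sum>i\<in>UNIV. \<Sum>j\<in>UNIV. (Q i j - M j * U i) * DU i j)
      + (\<Sum>i\<in>UNIV. DU i i) * (Pm - q) + k * (\<Sum>j\<in>UNIV. (M j - R * U j) * DR j))"
proof -
  define SUU where "SUU = (\<Sum>i\<in>UNIV. U i * U i)"
  define SUU0 where "SUU0 = (\<Sum>i\<in>UNIV. U i * U0 i)"
  define SMU0 where "SMU0 = (\<Sum>i\<in>UNIV. M i * U0 i)"
  define SMU where "SMU = (\<Sum>i\<in>UNIV. M i * U i)"
  define SQDU where "SQDU = (\<Sum>i\<in>UNIV. \<Sum>j\<in>UNIV. Q i j * DU i j)"
  define SQdU where "SQdU = (\<Sum>i\<in>UNIV. \<Sum>j\<in>UNIV. Q i j * d j * U i)"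
  define SMUDU where "SMUDU = (\<Sum>i\<in>UNIV. \<Sum>j\<in>UNIV. M j * U i * DU i j)"
  define Sdiv where "Sdiv = (\<Sum>i\<in>UNIV. DU i i)"
  define SdU where "SdU = (\<Sum>i\<in>UNIV. d i * U i)"
  define SMd where "SMd = (\<Sum>i\<in>UNIV. M i * d i)"
  define SMDR where "SMDR = (\<Sum>i\<in>UNIV. M i * DR i)"
  define SUDR where "SUDR = (\<Sum>i\<in>UNIV. U i * DR i)"
  note defs = SUU0_def SMU0_def SMU_def SQDU_def SQdU_def SMUDU_def Sdiv_def SdU_def SMd_def SMDR_def SUDR_def
  note S = sum.distrib sum_distrib_left sum_subtractf algebra_simps
  have 1: "(\<Sum>i\<in>UNIV. M i * (\<phi> * U0 i + d0 * U i) + (\<Sum>j\<in>UNIV. Q i j * (\<phi> * DU i j + d j * U i)) + Pm * (\<phi> * DU i i + d i * U i))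
    = \<phi> * SMU0 + d0 * SMU + \<phi> * SQDU + SQdU + Pm * (\<phi> * Sdiv + SdU)"
    unfolding defs by (simp add: S)
  have 2: "(\<Sum>i\<in>UNIV. U i * U0 i + U0 i * U i) = 2 * SUU0" unfolding defs by (simp add: S)
  have sw: "(\<Sum>j\<in>UNIV. \<Sum>i\<in>UNIV. M j * U i * DU i j) = SMUDU" unfolding defs by (rule sum.swap)
  have 3: "(\<Sum>j\<in>UNIV. M j * (\<phi> * (\<Sum>i\<in>UNIV. U i * DU i j + DU i j * U i) + d j * SUU)) = 2 * \<phi> * SMUDU + SMd * SUU"
  proof -
    have "(\<Sum>j\<in>UNIV. M j * (\<phi> * (\<Sum>i\<in>UNIV. U i * DU i j + DU i j * U i) + d j * SUU))
      = (\<Sum>j\<in>UNIV. 2 * \<phi> * (\<Sum>i\<in>UNIV. M j * U i * DU i j) + (M j * d j) * SUU)"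
    proof (rule sum.cong[OF refl])
      fix j
      have "(\<Sum>i\<in>UNIV. U i * DU i j + DU i j * U i) = 2 * (\<Sum>i\<in>UNIV. U i * DU i j)" by (simp add: S)
      moreover have "(\<Sum>i\<in>UNIV. M j * U i * DU i j) = M j * (\<Sum>i\<in>UNIV. U i * DU i j)" by (simp add: S)
      ultimately show "M j * (\<phi> * (\<Sum>i\<in>UNIV. U i * DU i j + DU i j * U i) + d j * SUU)
        = 2 * \<phi> * (\<Sum>i\<in>UNIV. M j * U i * DU i j) + (M j * d j) * SUU" by (simp add: algebra_simps)
    qed
    also have "\<dots> = 2 * \<phi> * (\<Sum>j\<in>UNIV. \<Sum>i\<in>UNIV. M j * U i * DU i j) + SMd * SUU"
      unfolding sum.distrib sum_distrib_left[symmetric] sum_distrib_right[symmetric] SMd_def ..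
    finally show ?thesis unfolding sw .
  qed
  have 4: "(\<Sum>j\<in>UNIV. M j * (\<phi> * (k * DR j) + d j * A)) = \<phi> * k * SMDR + SMd * A"
    unfolding defs by (simp add: S)
  have 5: "(\<Sum>j\<in>UNIV. (\<phi> * q) * DU j j + (\<phi> * (R * k * DR j) + d j * q) * U j) = \<phi> * q * Sdiv + \<phi> * R * k * SUDR + q * SdU"
    unfolding defs by (simp add: S)
  have sw2: "(\<Sum>j\<in>UNIV. d j * (\<Sum>i\<in>UNIV. Q i j * U i)) = SQdU"
    unfolding SQdU_def sum_distrib_left by (subst sum.swap) (simp add: mult_ac)
  have 6: "(\<Sum>j\<in>UNIV. d j * ((\<Sum>i\<in>UNIV. Q i j * U i) + Pm * U j - M j * SUU / 2 + M j * A - q * U j))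
    = SQdU + Pm * SdU - SMd * SUU / 2 + SMd * A - q * SdU"
  proof -
    have "(\<Sum>j\<in>UNIV. d j * ((\<Sum>i\<in>UNIV. Q i j * U i) + Pm * U j - M j * SUU / 2 + M j * A - q * U j))
      = (\<Sum>j\<in>UNIV. d j * (\<Sum>i\<in>UNIV. Q i j * U i) + Pm * (d j * U j) - (M j * d j) * (SUU / 2) + (M j * d j) * A - q * (d j * U j))"
      by (rule sum.cong[OF refl]) (simp add: algebra_simps)
    also have "\<dots> = SQdU + Pm * SdU - SMd * (SUU / 2) + SMd * A - q * SdU"
      unfolding sum.distrib sum_subtractf sw2 sum_distrib_left[symmetric] sum_distrib_right[symmetric] SMd_def SdU_def ..
    finally show ?thesis by simp
  qed
  have 7: "(\<Sum>i\<in>UNIV. (M i - R * U i) * U0 i) = SMU0 - R * SUU0" unfolding defs by (simp add: S)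
  have 8: "(\<Sum>i\<in>UNIV. \<Sum>j\<in>UNIV. (Q i j - M j * U i) * DU i j) = SQDU - SMUDU"
    unfolding defs by (simp add: left_diff_distrib sum_subtractf)
  have 9: "(\<Sum>j\<in>UNIV. (M j - R * U j) * DR j) = SMDR - R * SUDR" unfolding defs by (simp add: S)
  show ?thesis unfolding SUU_def[symmetric] Sdiv_def[symmetric] SMU_def[symmetric] 1 2 3 4 5 6 7 8 9
    by (simp add: algebra_simps)
qed

definition test_fun :: "real \<Rightarrow> real \<Rightarrow> (real \<times> (real ^ 'd) \<Rightarrow> real) \<Rightarrow> bool" where
  "test_fun a b \<psi> \<longleftrightarrow> C1 \<psi> \<and> space_periodic \<psi> \<and> time_supp a b \<psi>"

text \<open>
  Closed under sums and under products with periodic continuous functions, and contained in the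
  integrable functions.
\<close>
definition tame :: "real \<Rightarrow> real \<Rightarrow> (real \<times> (real ^ 'd) \<Rightarrow> real) \<Rightarrow> bool" where
  "tame a b g \<longleftrightarrow> continuous_on UNIV g \<and> space_periodic g \<and> time_supp a b g"

lemma tame_integrable: "tame a b g \<Longrightarrow> set_integrable lborel strip g"
  unfolding tame_def using strip_integrable_C1 by blast

lemma tame_add: "tame a b f \<Longrightarrow> tame a b g \<Longrightarrow> tame a b (\<lambda>y. f y + g y)"
  unfolding tame_def time_supp_def space_periodic_def by (auto intro!: continuous_intros) (metis add.right_neutral)+

lemma tame_sum: "(\<And>i. i \<in> I \<Longrightarrow> tame a b (f i)) \<Longrightarrow> tame a b (\<lambda>y. \<Sum>i\<in>I. f i y)"
proof (induction I rule: infinite_finite_induct)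
  case (insert x F)
  then show ?case by (simp add: tame_add)
qed (auto simp: tame_def time_supp_def space_periodic_def)

lemma tame_mult:
  assumes "continuous_on UNIV f" "space_periodic f" "tame a b g" shows "tame a b (\<lambda>y. f y * g y)"
  using assms unfolding tame_def time_supp_def space_periodic_def by (auto intro!: continuous_intros)

lemma tame_dir_deriv: "test_fun a b \<psi> \<Longrightarrow> tame a b (dir_deriv v \<psi>)"
  unfolding test_fun_def tame_def by (auto intro!: C1_dir_deriv_continuous space_periodic_dir_deriv time_supp_dir_deriv)

lemma test_fun_mult: "test_fun a b \<phi> \<Longrightarrow> C1 f \<Longrightarrow> space_periodic f \<Longrightarrow> test_fun a b (\<lambda>y. \<phi> y * f y)"
  unfolding test_fun_def by (auto intro!: C1_mult) (auto simp: time_supp_def space_periodic_def)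

lemma integral_dir_deriv_test_fun: "test_fun a b \<psi> \<Longrightarrow> (LBINT y:strip. dir_deriv v \<psi> y) = 0"
  unfolding test_fun_def using integral_dir_deriv_zero by blast

lemma set_integral_sum_zero:
  assumes "\<And>i. i \<in> I \<Longrightarrow> set_integrable lborel strip (f i)" "\<And>i. i \<in> I \<Longrightarrow> (LBINT y:strip. f i y) = (0 :: real)"
  shows "(LBINT y:strip. (\<Sum>i\<in>I. f i y)) = 0"
  using assms by (simp add: set_lebesgue_integral_def set_integrable_def sum_distrib_left)

text \<open>
  The momentum equation is tested with \<open>\<phi> U\<close>, the mass equation with \<open>- \<phi>
  |U|\<^sup>2 / 2\<close> and with \<open>\<phi> A(R)\<close>; the derivatives of \<open>\<phi>
  q(R)\<close> and \<open>\<phi> q(R) U\<close>, which integrate to 0, turn the gradient of the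
  regularized pressure into a divergence of the velocity.
\<close>
lemma energy_balance:
  fixes R Pm \<phi> :: "real \<times> (real ^ 'd) \<Rightarrow> real" and U M :: "'d \<Rightarrow> real \<times> (real ^ 'd) \<Rightarrow> real"
    and Q :: "'d \<Rightarrow> 'd \<Rightarrow> real \<times> (real ^ 'd) \<Rightarrow> real"
  assumes R: "C1 R" "space_periodic R" and U: "\<And>i. C1 (U i)" "\<And>i. space_periodic (U i)"
    and M: "\<And>i. continuous_on UNIV (M i)" "\<And>i. space_periodic (M i)"
    and Q: "\<And>i j. continuous_on UNIV (Q i j)" "\<And>i j. space_periodic (Q i j)"
    and Pm: "continuous_on UNIV Pm" "space_periodic Pm"
    and \<phi>: "test_fun a b \<phi>"
    and mass: "\<And>\<psi>. test_fun a b \<psi> \<Longrightarrow>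
      (LBINT y:strip. R y * dir_deriv time_dir \<psi> y + (\<Sum>j\<in>UNIV. M j y * dir_deriv (space_dir j) \<psi> y)) = 0"
    and momentum: "\<And>i \<psi>. test_fun a b \<psi> \<Longrightarrow>
      (LBINT y:strip. M i y * dir_deriv time_dir \<psi> y + (\<Sum>j\<in>UNIV. Q i j y * dir_deriv (space_dir j) \<psi> y) + Pm y * dir_deriv (space_dir i) \<psi> y) = 0"
    and A: "\<And>s. (A has_real_derivative k s) (at s)" and q: "\<And>s. (q has_real_derivative s * k s) (at s)"
    and k: "continuous_on UNIV k"
  shows "(LBINT y:strip. dir_deriv time_dir \<phi> y * ((\<Sum>i\<in>UNIV. M i y * U i y) - R y * (\<Sum>i\<in>UNIV. U i y * U i y) / 2 + (R y * A (R y) - q (R y)))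
    + (\<Sum>j\<in>UNIV. dir_deriv (space_dir j) \<phi> y * ((\<Sum>i\<in>UNIV. Q i j y * U i y) + Pm y * U j y
        - M j y * (\<Sum>i\<in>UNIV. U i y * U i y) / 2 + M j y * A (R y) - q (R y) * U j y))
    + \<phi> y * ((\<Sum>i\<in>UNIV. (M i y - R y * U i y) * dir_deriv time_dir (U i) y) + (\<Sum>i\<in>UNIV. \<Sum>j\<in>UNIV. (Q i j y - M j y * U i y) * dir_deriv (space_dir j) (U i) y)
      + (\<Sum>i\<in>UNIV. dir_deriv (space_dir i) (U i) y) * (Pm y - q (R y)) + k (R y) * (\<Sum>j\<in>UNIV. (M j y - R y * U j y) * dir_deriv (space_dir j) R y))) = 0"
    (is "(LBINT y:strip. ?Z y) = 0")
proof -
  define mas where "mas \<psi> y = R y * dir_deriv time_dir \<psi> y + (\<Sum>j\<in>UNIV. M j y * dir_deriv (space_dir j) \<psi> y)" for \<psi> y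
  define mom where "mom i \<psi> y = M i y * dir_deriv time_dir \<psi> y + (\<Sum>j\<in>UNIV. Q i j y * dir_deriv (space_dir j) \<psi> y) + Pm y * dir_deriv (space_dir i) \<psi> y" for i \<psi> y
  have mas: "tame a b (mas \<psi>)" "(LBINT y:strip. mas \<psi> y) = 0" if "test_fun a b \<psi>" for \<psi>
    unfolding mas_def using mass[OF that]
    by (auto intro!: tame_add tame_sum tame_mult C1_continuous R M tame_dir_deriv that)
  have mom: "tame a b (mom i \<psi>)" "(LBINT y:strip. mom i \<psi> y) = 0" if "test_fun a b \<psi>" for i \<psi>
    unfolding mom_def using momentum[OF that]
    by (auto intro!: tame_add tame_sum tame_mult Q M Pm tame_dir_deriv that)
  have C1\<phi>: "C1 \<phi>" using \<phi> unfolding test_fun_def by blast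
  define E where "E y = (\<Sum>i\<in>UNIV. U i y * U i y)" for y
  have E: "C1 E" "space_periodic E"
    unfolding E_def using U(2) by (auto intro!: C1_sum C1_mult U simp: space_periodic_def)
  have dE: "dir_deriv v E y = (\<Sum>i\<in>UNIV. U i y * dir_deriv v (U i) y + dir_deriv v (U i) y * U i y)" for v y
    unfolding E_def by (simp add: dir_deriv_sum C1_mult U dir_deriv_mult)
  have sk: "continuous_on UNIV (\<lambda>s. s * k s)" by (intro continuous_intros k)
  have AR: "C1 (\<lambda>y. A (R y))" "space_periodic (\<lambda>y. A (R y))"
    using R(2) by (auto intro!: C1_compose[OF A k R(1)] simp: space_periodic_def)
  have qR: "C1 (\<lambda>y. q (R y))" "space_periodic (\<lambda>y. q (R y))"
    using R(2) by (auto intro!: C1_compose[OF q sk R(1)] simp: space_periodic_def)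
  have t1: "test_fun a b (\<lambda>y. \<phi> y * U i y)" for i by (rule test_fun_mult[OF \<phi> U])
  have t2: "test_fun a b (\<lambda>y. \<phi> y * E y)" by (rule test_fun_mult[OF \<phi> E])
  have t3: "test_fun a b (\<lambda>y. \<phi> y * A (R y))" by (rule test_fun_mult[OF \<phi> AR])
  have t4: "test_fun a b (\<lambda>y. \<phi> y * q (R y))" by (rule test_fun_mult[OF \<phi> qR])
  have t5: "test_fun a b (\<lambda>y. (\<phi> y * q (R y)) * U j y)" for j by (rule test_fun_mult[OF t4 U])
  define Z1 where "Z1 y = (\<Sum>i\<in>UNIV. mom i (\<lambda>y. \<phi> y * U i y) y)" for y
  define Z2 where "Z2 = mas (\<lambda>y. \<phi> y * E y)"
  define Z3 where "Z3 = mas (\<lambda>y. \<phi> y * A (R y))"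
  define Z4 where "Z4 = dir_deriv time_dir (\<lambda>y. \<phi> y * q (R y))"
  define Z5 where "Z5 y = (\<Sum>j\<in>UNIV. dir_deriv (space_dir j) (\<lambda>y. (\<phi> y * q (R y)) * U j y) y)" for y
  have i: "set_integrable lborel strip Z1" "set_integrable lborel strip Z2" "set_integrable lborel strip Z3"
    "set_integrable lborel strip Z4" "set_integrable lborel strip Z5"
    unfolding Z1_def Z2_def Z3_def Z4_def Z5_def
    by (intro tame_integrable[of a b] tame_sum mom(1) mas(1) tame_dir_deriv t1 t2 t3 t4 t5)+
  have z: "(LBINT y:strip. Z1 y) = 0" "(LBINT y:strip. Z2 y) = 0" "(LBINT y:strip. Z3 y) = 0"
    "(LBINT y:strip. Z4 y) = 0" "(LBINT y:strip. Z5 y) = 0"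
    unfolding Z1_def Z2_def Z3_def Z4_def Z5_def
    by (intro set_integral_sum_zero mom(2) mas(2) integral_dir_deriv_test_fun[of a b] tame_integrable[of a b] mom(1) tame_dir_deriv t1 t2 t3 t4 t5)+
  have "?Z y = Z1 y - 1 / 2 * Z2 y + Z3 y - Z4 y - Z5 y" for y
    unfolding Z1_def Z2_def Z3_def Z4_def Z5_def mom_def mas_def
      dir_deriv_mult[OF C1\<phi> U(1)] dir_deriv_mult[OF C1\<phi> E(1)] dir_deriv_mult[OF C1\<phi> AR(1)] dir_deriv_mult[OF C1\<phi> qR(1)]
      dir_deriv_mult[OF C1_mult[OF C1\<phi> qR(1)] U(1)] dir_deriv_compose[OF A R(1)] dir_deriv_compose[OF q R(1)] dE
    unfolding E_def
    by (rule energy_identity_pointwise[symmetric])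
  then have "(LBINT y:strip. ?Z y) = (LBINT y:strip. Z1 y - 1 / 2 * Z2 y + Z3 y - Z4 y - Z5 y)" by simp
  also have "\<dots> = (LBINT y:strip. Z1 y) - 1 / 2 * (LBINT y:strip. Z2 y) + (LBINT y:strip. Z3 y) - (LBINT y:strip. Z4 y) - (LBINT y:strip. Z5 y)"
    using i by (simp add: set_integral_diff set_integral_add)
  finally show ?thesis using z by simp
qed

section \<open>Mollified conservation laws\<close>

lemma strip_integrable_mult_bounded:
  assumes f: "set_integrable lborel strip f" and [measurable]: "f \<in> borel_measurable borel" "g \<in> borel_measurable borel"
    and g: "\<And>y. \<bar>g y\<bar> \<le> (B::real)"
  shows "set_integrable lborel strip (\<lambda>y. f y * g y)"
  unfolding set_integrable_def
proof (rule Bochner_Integration.integrable_bound)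
  show "integrable lborel (\<lambda>y. (indicator strip y *\<^sub>R f y) * B)"
    using f unfolding set_integrable_def by (intro integrable_mult_left)
  have "\<bar>f y\<bar> * \<bar>g y\<bar> \<le> \<bar>f y\<bar> * \<bar>B\<bar>" for y using g[of y] by (intro mult_left_mono) auto
  then show "AE y in lborel. norm (indicator strip y *\<^sub>R (f y * g y)) \<le> norm ((indicator strip y *\<^sub>R f y) * B)"
    by (intro AE_I2) (auto simp: abs_mult indicator_def)
qed measurable

lemma set_integral_sum_strip:
  assumes "\<And>i. i \<in> I \<Longrightarrow> set_integrable lborel strip (f i :: _ \<Rightarrow> real)"
  shows "(LBINT y:strip. (\<Sum>i\<in>I. f i y)) = (\<Sum>i\<in>I. LBINT y:strip. f i y)"
    and "set_integrable lborel strip (\<lambda>y. \<Sum>i\<in>I. f i y)"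
  using assms by (auto simp: set_lebesgue_integral_def set_integrable_def sum_distrib_left)

lemma test_fun_bounded_dir_deriv:
  assumes "test_fun a b \<psi>" shows "\<exists>S\<ge>0. \<forall>y. \<bar>dir_deriv v \<psi> y\<bar> \<le> S"
  using periodic_bounded[of "dir_deriv v \<psi>" a b] tame_dir_deriv[OF assms, of v] unfolding tame_def by blast

locale mollification =
  fixes \<eta> :: "real \<times> (real ^ 'd) \<Rightarrow> real"
  assumes \<eta>: "bump_kernel \<eta>" and \<eta>_even: "\<And>z. \<eta> (- z) = \<eta> z" and \<eta>_nonneg: "\<And>z. 0 \<le> \<eta> z"
    and \<eta>_one: "(LINT z|lborel. \<eta> z) = 1"
begin

definition admissible :: "(real \<times> (real ^ 'd) \<Rightarrow> real) \<Rightarrow> bool" where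
  "admissible f \<longleftrightarrow> f \<in> borel_measurable borel \<and> space_periodic f \<and> set_integrable lborel strip f"

lemma admissibleD: "admissible f \<Longrightarrow> f \<in> borel_measurable borel" "admissible f \<Longrightarrow> space_periodic f"
  "admissible f \<Longrightarrow> set_integrable lborel strip f" "admissible f \<Longrightarrow> loc_int f"
  unfolding admissible_def using loc_int_periodic by auto

lemma mol_test_function:
  assumes \<psi>: "test_fun a b \<psi>" and \<epsilon>: "0 < \<epsilon>" "\<epsilon> < a" "b + \<epsilon> < T"
  shows "mol \<eta> \<epsilon> \<psi> \<in> test_functions T" "test_fun (a - \<epsilon>) (b + \<epsilon>) (mol \<eta> \<epsilon> \<psi>)"
proof -
  have p: "C1 \<psi>" "space_periodic \<psi>" "time_supp a b \<psi>" using \<psi> unfolding test_fun_def by auto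
  have lp: "loc_int \<psi>"
    by (rule loc_int_periodic[OF borel_measurable_continuous_onI[OF C1_continuous[OF p(1)]] p(2)
          strip_integrable_C1[OF C1_continuous[OF p(1)] p(2,3)]])
  have s: "smooth (mol \<eta> \<epsilon> \<psi>)" "space_periodic (mol \<eta> \<epsilon> \<psi>)" "time_supp (a - \<epsilon>) (b + \<epsilon>) (mol \<eta> \<epsilon> \<psi>)"
    by (rule mol_smooth[OF \<eta> lp \<epsilon>(1)], rule space_periodic_mol[OF p(2)], rule time_supp_mol[OF \<eta> p(3) \<epsilon>(1)])
  then show "mol \<eta> \<epsilon> \<psi> \<in> test_functions T"
    unfolding test_functions_def time_supp_def using \<epsilon> by (intro CollectI conjI exI[of _ "a - \<epsilon>"] exI[of _ "b + \<epsilon>"]) auto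
  show "test_fun (a - \<epsilon>) (b + \<epsilon>) (mol \<eta> \<epsilon> \<psi>)"
    unfolding test_fun_def using s smooth_C1 by auto
qed

lemma mollified_pairing:
  assumes f: "admissible f" and \<psi>: "test_fun a b \<psi>" and \<epsilon>: "0 < \<epsilon>"
  shows "(LBINT y:strip. f y * dir_deriv v (mol \<eta> \<epsilon> \<psi>) y) = (LBINT y:strip. mol \<eta> \<epsilon> f y * dir_deriv v \<psi> y)"
    and "set_integrable lborel strip (\<lambda>y. f y * dir_deriv v (mol \<eta> \<epsilon> \<psi>) y)"
    and "set_integrable lborel strip (\<lambda>y. mol \<eta> \<epsilon> f y * dir_deriv v \<psi> y)"
proof -
  have p: "C1 \<psi>" "space_periodic \<psi>" "time_supp a b \<psi>" using \<psi> unfolding test_fun_def by auto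
  show "(LBINT y:strip. f y * dir_deriv v (mol \<eta> \<epsilon> \<psi>) y) = (LBINT y:strip. mol \<eta> \<epsilon> f y * dir_deriv v \<psi> y)"
    by (rule integral_dir_deriv_mol[OF \<eta> \<eta>_even \<epsilon> admissibleD(1-3)[OF f] p])
  have lp: "loc_int \<psi>"
    by (rule loc_int_periodic[OF borel_measurable_continuous_onI[OF C1_continuous[OF p(1)]] p(2)
          strip_integrable_C1[OF C1_continuous[OF p(1)] p(2,3)]])
  have tm: "test_fun (a - \<epsilon>) (b + \<epsilon>) (mol \<eta> \<epsilon> \<psi>)"
    unfolding test_fun_def using smooth_C1[OF mol_smooth[OF \<eta> lp \<epsilon>]] space_periodic_mol[OF p(2)] time_supp_mol[OF \<eta> p(3) \<epsilon>] by blast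
  obtain S where S: "\<And>y. \<bar>dir_deriv v (mol \<eta> \<epsilon> \<psi>) y\<bar> \<le> S" using test_fun_bounded_dir_deriv[OF tm] by blast
  have "continuous_on UNIV (dir_deriv v (mol \<eta> \<epsilon> \<psi>))" using tm C1_dir_deriv_continuous unfolding test_fun_def by blast
  then show "set_integrable lborel strip (\<lambda>y. f y * dir_deriv v (mol \<eta> \<epsilon> \<psi>) y)"
    by (intro strip_integrable_mult_bounded[OF admissibleD(3)[OF f] admissibleD(1)[OF f] _ S] borel_measurable_continuous_onI)
  show "set_integrable lborel strip (\<lambda>y. mol \<eta> \<epsilon> f y * dir_deriv v \<psi> y)"
    by (intro tame_integrable[of a b] tame_mult tame_dir_deriv \<psi> C1_continuous smooth_C1 mol_smooth[OF \<eta> admissibleD(4)[OF f] \<epsilon>]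
        space_periodic_mol admissibleD(2)[OF f])
qed

lemma mollified_law:
  assumes f: "admissible f" "\<And>j. admissible (F j)" "admissible G" and \<psi>: "test_fun a b \<psi>"
    and \<epsilon>: "0 < \<epsilon>" "\<epsilon> < a" "b + \<epsilon> < T"
    and law: "\<And>\<phi>. \<phi> \<in> test_functions T \<Longrightarrow>
      (LBINT y:strip. f y * dir_deriv v \<phi> y + (\<Sum>j\<in>(UNIV :: 'd set). F j y * dir_deriv (w j) \<phi> y) + G y * dir_deriv v' \<phi> y) = 0"
  shows "(LBINT y:strip. mol \<eta> \<epsilon> f y * dir_deriv v \<psi> y + (\<Sum>j\<in>UNIV. mol \<eta> \<epsilon> (F j) y * dir_deriv (w j) \<psi> y)
    + mol \<eta> \<epsilon> G y * dir_deriv v' \<psi> y) = 0"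
proof -
  note P = mollified_pairing[OF _ \<psi> \<epsilon>(1)]
  have "(LBINT y:strip. mol \<eta> \<epsilon> f y * dir_deriv v \<psi> y + (\<Sum>j\<in>UNIV. mol \<eta> \<epsilon> (F j) y * dir_deriv (w j) \<psi> y) + mol \<eta> \<epsilon> G y * dir_deriv v' \<psi> y)
    = (LBINT y:strip. mol \<eta> \<epsilon> f y * dir_deriv v \<psi> y) + (\<Sum>j\<in>UNIV. (LBINT y:strip. mol \<eta> \<epsilon> (F j) y * dir_deriv (w j) \<psi> y))
      + (LBINT y:strip. mol \<eta> \<epsilon> G y * dir_deriv v' \<psi> y)"
    by (subst set_integral_add(2), (intro set_integral_add(1) set_integral_sum_strip(2) P(3) f)+)
       (subst set_integral_add(2), (intro set_integral_add(1) set_integral_sum_strip(2) P(3) f)+,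
        subst set_integral_sum_strip(1), (intro P(3) f)+, simp)
  also have "\<dots> = (LBINT y:strip. f y * dir_deriv v (mol \<eta> \<epsilon> \<psi>) y) + (\<Sum>j\<in>UNIV. (LBINT y:strip. F j y * dir_deriv (w j) (mol \<eta> \<epsilon> \<psi>) y))
      + (LBINT y:strip. G y * dir_deriv v' (mol \<eta> \<epsilon> \<psi>) y)"
    using P(1) f by simp
  also have "\<dots> = (LBINT y:strip. f y * dir_deriv v (mol \<eta> \<epsilon> \<psi>) y + (\<Sum>j\<in>UNIV. F j y * dir_deriv (w j) (mol \<eta> \<epsilon> \<psi>) y)
      + G y * dir_deriv v' (mol \<eta> \<epsilon> \<psi>) y)"
    by (subst set_integral_add(2), (intro set_integral_add(1) set_integral_sum_strip(2) P(2) f)+)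
       (subst set_integral_add(2), (intro set_integral_add(1) set_integral_sum_strip(2) P(2) f)+,
        subst set_integral_sum_strip(1), (intro P(2) f)+, simp)
  also have "\<dots> = 0" by (rule law[OF mol_test_function(1)[OF \<psi> \<epsilon>]])
  finally show ?thesis .
qed

end

lemma ennreal_gauge_bound:
  assumes "2 \<le> q" "0 \<le> t" "Lq_gauge q t \<le> W" "1 \<le> W" "W \<noteq> \<infinity>"
  shows "t \<le> enn2real W powr (1 / enn2real q)"
proof (rule Lq_gauge_inverse_bound[OF assms(1,2)])
  show "Lq_gauge q t \<le> ennreal (enn2real W)" using assms(3,5) by (simp add: top.not_eq_extremum)
  show "1 \<le> enn2real W" using assms(4,5) by (cases W) (auto simp: ennreal_le_iff ennreal_1[symmetric] simp del: ennreal_1)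
qed

lemma Lq_gauge_scaled_bound:
  assumes "2 \<le> q" "0 \<le> t" "0 < S" "Lq_gauge q (t / S) \<le> W" "1 \<le> W" "W \<noteq> \<infinity>"
  shows "t \<le> S * enn2real W powr (1 / enn2real q)"
  using ennreal_gauge_bound[OF assms(1) _ assms(4-6)] assms(2,3) by (simp add: field_simps)

section \<open>Weights for a periodic flow\<close>

lemma borel_measurable_vec_component[measurable]:
  "f \<in> borel_measurable M \<Longrightarrow> (\<lambda>y. (f y :: real ^ 'n) $ i) \<in> borel_measurable M"
  by (erule measurable_compose) (intro borel_measurable_continuous_onI continuous_intros)

lemma spacetime_in_borel[measurable]: "spacetime T \<in> sets borel"
  unfolding spacetime_def using borel_Times[of "{0<..<T}" cell] by simp

text \<open>
  The Euler system for Borel representatives that vanish outside \<open>(0,T)\<close>, with the Besov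
  and Lebesgue norms in gauge form, one common constant \<open>B\<close> for all of them, and the
  pressure in the form of its regularization.
\<close>
locale periodic_flow = mollification \<eta>
  for \<eta> :: "real \<times> (real ^ 'd) \<Rightarrow> real" +
  fixes T \<alpha> \<beta> \<gamma> B lo hi C c\<eta> :: real and r q :: ennreal and p g P0 :: "real \<Rightarrow> real"
    and \<rho> :: "real \<times> (real ^ 'd) \<Rightarrow> real" and u :: "real \<times> (real ^ 'd) \<Rightarrow> real ^ 'd"
  assumes \<alpha>: "0 \<le> \<alpha>" "\<alpha> \<le> 1" and \<beta>: "0 \<le> \<beta>" "\<beta> \<le> 1" and \<gamma>: "1 < \<gamma>" "\<gamma> < 2"
    and \<alpha>\<beta>: "\<alpha> + \<gamma> * \<beta> > 1" "2 * \<alpha> + \<beta> > 1"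
    and rq: "2 \<le> r" "2 \<le> q"
    and exponents: "1 / enn2real r + 2 * (1 / enn2real q) \<le> 1" "2 * (1 / enn2real r) + 1 / enn2real q \<le> 1"
    and B: "1 \<le> B" and lohi: "0 \<le> lo" "lo \<le> hi" and C: "0 \<le> C"
    and P0_lip: "\<And>s t. s \<in> {lo..hi} \<Longrightarrow> t \<in> {lo..hi} \<Longrightarrow> \<bar>P0 s - P0 t\<bar> \<le> C * \<bar>s - t\<bar>"
    and p_lip: "\<And>s t. s \<in> {lo..hi} \<Longrightarrow> t \<in> {lo..hi} \<Longrightarrow> \<bar>p s - p t\<bar> \<le> C * \<bar>s - t\<bar>"
    and p_taylor: "\<And>s t. s \<in> {lo..hi} \<Longrightarrow> t \<in> {lo..hi} \<Longrightarrow> \<bar>p s - p t - g t * (s - t)\<bar> \<le> C * \<bar>s - t\<bar> powr \<gamma>"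
    and p_reg: "\<And>\<delta>. 0 < \<delta> \<Longrightarrow> \<delta> \<le> 1 \<Longrightarrow> \<exists>k A q. continuous_on UNIV k \<and>
        (\<forall>s. (A has_real_derivative k s) (at s)) \<and> (\<forall>s. (q has_real_derivative s * k s) (at s)) \<and>
        (\<forall>s\<in>{lo..hi}. \<bar>k s\<bar> \<le> C * \<delta> powr (\<gamma> - 2) \<and> \<bar>A s\<bar> \<le> C \<and> \<bar>q s - p s\<bar> \<le> C * \<delta> powr \<gamma> \<and>
           \<bar>s * A s - q s - P0 s\<bar> \<le> C * \<delta>)"
    and c\<eta>: "0 \<le> c\<eta>" "\<And>z. \<bar>\<eta> z\<bar> \<le> c\<eta> * indicator (cball 0 1) z"
      "\<And>v z. v \<in> insert time_dir (range space_dir) \<Longrightarrow> \<bar>dir_deriv v \<eta> z\<bar> \<le> c\<eta> * indicator (cball 0 1) z"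
    and \<rho>_borel[measurable]: "\<rho> \<in> borel_measurable borel" and u_borel[measurable]: "u \<in> borel_measurable borel"
    and \<rho>_per: "space_periodic \<rho>" and u_per: "space_periodic u"
    and \<rho>_range: "\<And>y. 0 < fst y \<Longrightarrow> fst y < T \<Longrightarrow> \<rho> y \<in> {lo..hi}"
    and zero_outside: "\<And>y. \<not> (0 < fst y \<and> fst y < T) \<Longrightarrow> \<rho> y = 0 \<and> u y = 0"
    and u_Lr: "(\<integral>\<^sup>+y. indicator (spacetime T) y * Lq_gauge r (norm (u y) / B) \<partial>lborel) \<le> 1"
    and m_Lq: "(\<integral>\<^sup>+y. indicator (spacetime T) y * Lq_gauge q (norm (\<rho> y *\<^sub>R u y) / B) \<partial>lborel) \<le> 1"
    and u_besov: "\<And>\<xi>. \<xi> \<noteq> 0 \<Longrightarrow> (\<integral>\<^sup>+y. indicator {y \<in> spacetime T. fst (y + \<xi>) \<in> {0<..<T}} y *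
        Lq_gauge r (norm (u (y + \<xi>) - u y) / (B * norm \<xi> powr \<alpha>)) \<partial>lborel) \<le> 1"
    and \<rho>_besov: "\<And>\<xi>. \<xi> \<noteq> 0 \<Longrightarrow> (\<integral>\<^sup>+y. indicator {y \<in> spacetime T. fst (y + \<xi>) \<in> {0<..<T}} y *
        Lq_gauge q (norm (\<rho> (y + \<xi>) - \<rho> y) / (B * norm \<xi> powr \<beta>)) \<partial>lborel) \<le> 1"
    and m_besov: "\<And>\<xi>. \<xi> \<noteq> 0 \<Longrightarrow> (\<integral>\<^sup>+y. indicator {y \<in> spacetime T. fst (y + \<xi>) \<in> {0<..<T}} y *
        Lq_gauge q (norm (\<rho> (y + \<xi>) *\<^sub>R u (y + \<xi>) - \<rho> y *\<^sub>R u y) / (B * norm \<xi> powr \<beta>)) \<partial>lborel) \<le> 1"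
    and mass: "\<And>\<phi>. \<phi> \<in> test_functions T \<Longrightarrow>
      (LBINT y:strip. \<rho> y * dir_deriv time_dir \<phi> y + (\<Sum>j\<in>UNIV. (\<rho> y * u y $ j) * dir_deriv (space_dir j) \<phi> y)) = 0"
    and momentum: "\<And>i \<phi>. \<phi> \<in> test_functions T \<Longrightarrow>
      (LBINT y:strip. (\<rho> y * u y $ i) * dir_deriv time_dir \<phi> y + (\<Sum>j\<in>UNIV. (\<rho> y * u y $ j * u y $ i) * dir_deriv (space_dir j) \<phi> y)
         + (if 0 < fst y \<and> fst y < T then p (\<rho> y) else 0) * dir_deriv (space_dir i) \<phi> y) = 0"
begin

definition ea :: real where "ea = 1 / enn2real r"
definition eb :: real where "eb = 1 / enn2real q"

lemma ea_eb: "0 \<le> ea" "0 \<le> eb" "2 * ea + eb \<le> 1" "ea + 2 * eb \<le> 1" "ea \<le> 1" "eb \<le> 1" "ea + eb \<le> 1" "\<gamma> * eb \<le> 1"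
proof -
  show 1: "0 \<le> ea" "0 \<le> eb" "2 * ea + eb \<le> 1" "ea + 2 * eb \<le> 1" unfolding ea_def eb_def using exponents by auto
  then show "ea \<le> 1" "eb \<le> 1" "ea + eb \<le> 1" by auto
  have "\<gamma> * eb \<le> 2 * eb" using \<gamma> 1 by (intro mult_right_mono) auto
  then show "\<gamma> * eb \<le> 1" using 1 by linarith
qed

definition clamp :: "real \<Rightarrow> real" where "clamp s = max lo (min hi s)"

text \<open>
  The clamp has no effect on the time interval, where the density already lies in its range; it yields
  measurability from regularity of \<open>f\<close> on the density range alone.
\<close>
definition on_range :: "(real \<Rightarrow> real) \<Rightarrow> real \<times> (real ^ 'd) \<Rightarrow> real" where
  "on_range f y = (if 0 < fst y \<and> fst y < T then f (clamp (\<rho> y)) else 0)"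

lemma clamp_range: "clamp s \<in> {lo..hi}" unfolding clamp_def using lohi by auto

lemma on_range_eq: "0 < fst y \<Longrightarrow> fst y < T \<Longrightarrow> on_range f y = f (\<rho> y)"
  unfolding on_range_def clamp_def using \<rho>_range[of y] by (auto simp: max_def min_def)

lemma on_range_borel:
  assumes "\<And>s t. s \<in> {lo..hi} \<Longrightarrow> t \<in> {lo..hi} \<Longrightarrow> \<bar>f s - f t\<bar> \<le> C * \<bar>s - t\<bar>"
  shows "on_range f \<in> borel_measurable borel"
proof -
  have "C-lipschitz_on UNIV (\<lambda>s. f (clamp s))"
  proof (rule lipschitz_onI)
    fix s t :: real
    have "\<bar>clamp s - clamp t\<bar> \<le> \<bar>s - t\<bar>" unfolding clamp_def by (auto simp: max_def min_def)
    then have "\<bar>f (clamp s) - f (clamp t)\<bar> \<le> C * \<bar>s - t\<bar>"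
      using assms[OF clamp_range clamp_range, of s t] mult_left_mono[of _ _ C] C by (meson order_trans)
    then show "dist (f (clamp s)) (f (clamp t)) \<le> C * dist s t" by (simp add: dist_real_def)
  qed (rule C)
  then have "continuous_on UNIV (\<lambda>s. f (clamp s))" by (rule lipschitz_on_continuous_on)
  then have [measurable]: "(\<lambda>s. f (clamp s)) \<in> borel_measurable borel" by (rule borel_measurable_continuous_onI)
  have [measurable]: "{y :: real \<times> (real ^ 'd). 0 < fst y \<and> fst y < T} \<in> sets borel"
    by (intro borel_open open_Collect_conj open_Collect_less continuous_intros)
  have "on_range f = (\<lambda>y. indicator {y. 0 < fst y \<and> fst y < T} y * f (clamp (\<rho> y)))"
    by (auto simp: on_range_def fun_eq_iff)
  then show ?thesis by simp
qed

lemma on_range_bound: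
  assumes "\<And>s t. s \<in> {lo..hi} \<Longrightarrow> t \<in> {lo..hi} \<Longrightarrow> \<bar>f s - f t\<bar> \<le> C * \<bar>s - t\<bar>" "s \<in> {lo..hi}"
  shows "\<bar>f s\<bar> \<le> \<bar>f lo\<bar> + C * hi"
proof -
  have "\<bar>f s - f lo\<bar> \<le> C * \<bar>s - lo\<bar>" by (rule assms(1)) (use assms lohi in auto)
  also have "\<dots> \<le> C * hi" using assms(2) lohi C by (intro mult_left_mono) auto
  finally show ?thesis by linarith
qed

lemma on_range_periodic: "space_periodic (on_range f)"
  using \<rho>_per unfolding space_periodic_def on_range_def by auto

definition size_gauge :: "real \<times> (real ^ 'd) \<Rightarrow> ennreal" where
  "size_gauge y = 1 + Lq_gauge r (norm (u y) / B) + Lq_gauge q (norm (\<rho> y *\<^sub>R u y) / B)"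

lemma size_gauge_borel[measurable]: "size_gauge \<in> borel_measurable borel"
  unfolding size_gauge_def[abs_def] by measurable

lemma spacetime_finite: "emeasure lborel (spacetime T :: (real \<times> (real ^ 'd)) set) < \<infinity>"
proof -
  have "emeasure lborel (spacetime T :: (real \<times> (real ^ 'd)) set) \<le> emeasure lborel ({0..T} \<times> (cell :: (real ^ 'd) set))"
    by (rule emeasure_mono) (auto simp: spacetime_def)
  then show ?thesis using emeasure_slab_finite[of 0 T] by (rule order_le_less_trans)
qed

lemma size_gauge_integral:
  "(\<integral>\<^sup>+y. indicator (spacetime T) y * size_gauge y \<partial>lborel) \<le> emeasure lborel (spacetime T :: (real \<times> (real ^ 'd)) set) + 2"
proof -
  have "(\<integral>\<^sup>+y. indicator (spacetime T) y * size_gauge y \<partial>lborel)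
    = (\<integral>\<^sup>+y. indicator (spacetime T) y + indicator (spacetime T) y * Lq_gauge r (norm (u y) / B)
         + indicator (spacetime T) y * Lq_gauge q (norm (\<rho> y *\<^sub>R u y) / B) \<partial>lborel)"
    unfolding size_gauge_def by (simp add: distrib_left)
  also have "\<dots> = emeasure lborel (spacetime T :: (real \<times> (real ^ 'd)) set)
     + (\<integral>\<^sup>+y. indicator (spacetime T) y * Lq_gauge r (norm (u y) / B) \<partial>lborel)
     + (\<integral>\<^sup>+y. indicator (spacetime T) y * Lq_gauge q (norm (\<rho> y *\<^sub>R u y) / B) \<partial>lborel)"
    by (simp add: nn_integral_add)
  also have "\<dots> \<le> emeasure lborel (spacetime T :: (real \<times> (real ^ 'd)) set) + 1 + 1"
    by (intro add_mono order_refl u_Lr m_Lq)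
  finally show ?thesis by (simp add: add.assoc one_add_one)
qed

lemma size_bounds:
  assumes "size_gauge y \<le> W" "W \<noteq> \<infinity>"
  shows "1 \<le> enn2real W" "\<bar>u y $ i\<bar> \<le> B * enn2real W powr ea" "\<bar>\<rho> y * u y $ i\<bar> \<le> B * enn2real W powr eb"
proof -
  have W1: "1 \<le> W" using assms(1) unfolding size_gauge_def by (meson add_increasing2 order_refl order_trans zero_le)
  then show "1 \<le> enn2real W" using assms(2) by (cases W) (auto simp: ennreal_le_iff ennreal_1[symmetric] simp del: ennreal_1)
  have g: "Lq_gauge r (norm (u y) / B) \<le> W" "Lq_gauge q (norm (\<rho> y *\<^sub>R u y) / B) \<le> W"
    using assms(1) unfolding size_gauge_def
    by (meson add_increasing add_increasing2 order_refl order_trans zero_le)+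
  have "norm (u y) \<le> B * enn2real W powr ea"
    unfolding ea_def by (rule Lq_gauge_scaled_bound[OF rq(1) _ _ g(1) W1 assms(2)]) (use B in auto)
  then show "\<bar>u y $ i\<bar> \<le> B * enn2real W powr ea" using component_le_norm_cart[of "u y" i] by linarith
  have "norm (\<rho> y *\<^sub>R u y) \<le> B * enn2real W powr eb"
    unfolding eb_def by (rule Lq_gauge_scaled_bound[OF rq(2) _ _ g(2) W1 assms(2)]) (use B in auto)
  then show "\<bar>\<rho> y * u y $ i\<bar> \<le> B * enn2real W powr eb" using component_le_norm_cart[of "\<rho> y *\<^sub>R u y" i] by simp
qed

lemma integrable_of_size_bound:
  assumes fm[measurable]: "f \<in> borel_measurable borel" and A: "0 < A"
    and f: "\<And>y. y \<in> spacetime T \<Longrightarrow> size_gauge y \<noteq> \<infinity> \<Longrightarrow> \<bar>f y\<bar> \<le> A * enn2real (size_gauge y)"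
    and z: "\<And>y. \<not> (0 < fst y \<and> fst y < T) \<Longrightarrow> f y = 0"
  shows "set_integrable lborel strip f"
  unfolding set_integrable_def
proof (rule integrableI_bounded)
  have "(\<integral>\<^sup>+y. ennreal (norm (indicator strip y *\<^sub>R f y)) \<partial>lborel) \<le> (\<integral>\<^sup>+y. ennreal A * (indicator (spacetime T) y * size_gauge y) \<partial>lborel)"
  proof (rule nn_integral_mono)
    fix y
    show "ennreal (norm (indicator strip y *\<^sub>R f y)) \<le> ennreal A * (indicator (spacetime T) y * size_gauge y)"
    proof (cases "y \<in> spacetime T")
      case True
      show ?thesis
      proof (cases "size_gauge y = \<infinity>")
        case True
        then show ?thesis using \<open>y \<in> spacetime T\<close> A by (simp add: ennreal_mult_top)
      next
        case False
        have "ennreal (norm (indicator strip y *\<^sub>R f y)) \<le> ennreal (A * enn2real (size_gauge y))"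
          using f[OF True False] A by (intro ennreal_leI) (auto simp: indicator_def)
        also have "\<dots> = ennreal A * size_gauge y"
          using A False by (simp add: ennreal_mult less_top)
        finally show ?thesis using True by simp
      qed
    next
      case False
      then have "y \<notin> strip \<or> f y = 0" using z[of y] unfolding spacetime_def strip_def by (cases y) auto
      then show ?thesis by auto
    qed
  qed
  also have "\<dots> = ennreal A * (\<integral>\<^sup>+y. indicator (spacetime T) y * size_gauge y \<partial>lborel)"
    by (rule nn_integral_cmult) measurable
  also have "\<dots> \<le> ennreal A * (emeasure lborel (spacetime T :: (real \<times> (real ^ 'd)) set) + 2)"
    by (intro mult_left_mono size_gauge_integral) auto
  also have "\<dots> < \<infinity>" using spacetime_finite by (simp add: ennreal_mult_less_top)
  finally show "(\<integral>\<^sup>+y. ennreal (norm (indicator strip y *\<^sub>R f y)) \<partial>lborel) < \<infinity>" .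
qed measurable

lemma powr_le_self: "1 \<le> h \<Longrightarrow> e \<le> 1 \<Longrightarrow> h powr e \<le> (h :: real)"
  using powr_mono[of e 1 h] by simp

lemma admissible_\<rho>: "admissible \<rho>"
  unfolding admissible_def
proof (intro conjI \<rho>_borel \<rho>_per integrable_of_size_bound[where A="hi + 1"])
  fix y assume "y \<in> spacetime T" "size_gauge y \<noteq> \<infinity>"
  then have 1: "\<rho> y \<in> {lo..hi}" "1 \<le> enn2real (size_gauge y)"
    using \<rho>_range[of y] size_bounds(1)[OF order_refl] unfolding spacetime_def by auto
  have "\<rho> y \<le> (hi + 1) * 1" using 1 by auto
  also have "\<dots> \<le> (hi + 1) * enn2real (size_gauge y)" using lohi 1 by (intro mult_left_mono) auto
  finally show "\<bar>\<rho> y\<bar> \<le> (hi + 1) * enn2real (size_gauge y)" using lohi 1 by auto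
qed (use lohi zero_outside in auto)

lemma admissible_u: "admissible (\<lambda>y. u y $ i)"
  unfolding admissible_def
proof (intro conjI integrable_of_size_bound[where A=B])
  fix y assume y: "y \<in> spacetime T" "size_gauge y \<noteq> \<infinity>"
  have "B * enn2real (size_gauge y) powr ea \<le> B * enn2real (size_gauge y)"
    using B ea_eb size_bounds(1)[OF order_refl y(2)] by (intro mult_left_mono powr_le_self) auto
  then show "\<bar>u y $ i\<bar> \<le> B * enn2real (size_gauge y)" using size_bounds(2)[OF order_refl y(2), of i] by linarith
next
  show "space_periodic (\<lambda>y. u y $ i)" using u_per unfolding space_periodic_def by simp
qed (use B zero_outside in auto)

lemma admissible_m: "admissible (\<lambda>y. \<rho> y * u y $ i)"
  unfolding admissible_def
proof (intro conjI integrable_of_size_bound[where A=B])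
  fix y assume y: "y \<in> spacetime T" "size_gauge y \<noteq> \<infinity>"
  have "B * enn2real (size_gauge y) powr eb \<le> B * enn2real (size_gauge y)"
    using B ea_eb size_bounds(1)[OF order_refl y(2)] by (intro mult_left_mono powr_le_self) auto
  then show "\<bar>\<rho> y * u y $ i\<bar> \<le> B * enn2real (size_gauge y)" using size_bounds(3)[OF order_refl y(2), of i] by linarith
next
  show "space_periodic (\<lambda>y. \<rho> y * u y $ i)" using u_per \<rho>_per unfolding space_periodic_def by simp
qed (use B zero_outside in auto)

lemma admissible_mu: "admissible (\<lambda>y. \<rho> y * u y $ j * u y $ i)"
  unfolding admissible_def
proof (intro conjI integrable_of_size_bound[where A="B * B"])
  fix y assume y: "y \<in> spacetime T" "size_gauge y \<noteq> \<infinity>"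
  define h where "h = enn2real (size_gauge y)"
  have "\<bar>\<rho> y * u y $ j\<bar> * \<bar>u y $ i\<bar> \<le> (B * h powr eb) * (B * h powr ea)"
    unfolding h_def using B by (intro mult_mono size_bounds(2,3)[OF order_refl y(2)]) auto
  also have "\<dots> = B * B * h powr (ea + eb)" by (simp add: powr_add mult_ac)
  also have "\<dots> \<le> B * B * h"
    using B ea_eb size_bounds(1)[OF order_refl y(2)] unfolding h_def by (intro mult_left_mono powr_le_self) auto
  finally show "\<bar>\<rho> y * u y $ j * u y $ i\<bar> \<le> B * B * enn2real (size_gauge y)" unfolding h_def by (simp add: abs_mult)
next
  show "space_periodic (\<lambda>y. \<rho> y * u y $ j * u y $ i)" using u_per \<rho>_per unfolding space_periodic_def by simp
qed (use B zero_outside in auto)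

lemma admissible_on_range:
  assumes "\<And>s t. s \<in> {lo..hi} \<Longrightarrow> t \<in> {lo..hi} \<Longrightarrow> \<bar>f s - f t\<bar> \<le> C * \<bar>s - t\<bar>"
  shows "admissible (on_range f)"
  unfolding admissible_def
proof (intro conjI on_range_borel[OF assms] on_range_periodic integrable_of_size_bound[where A="\<bar>f lo\<bar> + C * hi + 1"])
  show "0 < \<bar>f lo\<bar> + C * hi + 1" using C lohi by (simp add: add_nonneg_pos)
  fix y assume y: "y \<in> spacetime T" "size_gauge y \<noteq> \<infinity>"
  have "\<bar>on_range f y\<bar> \<le> \<bar>f lo\<bar> + C * hi"
    unfolding on_range_def using on_range_bound[OF assms clamp_range] C lohi by auto
  also have "\<dots> \<le> (\<bar>f lo\<bar> + C * hi + 1) * 1" by simp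
  also have "\<dots> \<le> (\<bar>f lo\<bar> + C * hi + 1) * enn2real (size_gauge y)"
    using C lohi size_bounds(1)[OF order_refl y(2)] by (intro mult_left_mono) auto
  finally show "\<bar>on_range f y\<bar> \<le> (\<bar>f lo\<bar> + C * hi + 1) * enn2real (size_gauge y)" .
qed (auto simp: on_range_def)

definition osc_gauge :: "real \<Rightarrow> real \<times> (real ^ 'd) \<Rightarrow> real \<times> (real ^ 'd) \<Rightarrow> ennreal" where
  "osc_gauge \<epsilon> y z = 1 + Lq_gauge r (norm (u (y - \<epsilon> *\<^sub>R z) - u y) / (B * \<epsilon> powr \<alpha>))
     + Lq_gauge q (norm (\<rho> (y - \<epsilon> *\<^sub>R z) - \<rho> y) / (B * \<epsilon> powr \<beta>))
     + Lq_gauge q (norm (\<rho> (y - \<epsilon> *\<^sub>R z) *\<^sub>R u (y - \<epsilon> *\<^sub>R z) - \<rho> y *\<^sub>R u y) / (B * \<epsilon> powr \<beta>))"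

text \<open>
  The common weight for all estimates at scale \<open>\<epsilon>\<close>: it dominates the sizes of
  the fields at the point and the mean of their normalized oscillations around it.
\<close>
definition weight :: "real \<Rightarrow> real \<times> (real ^ 'd) \<Rightarrow> ennreal" where
  "weight \<epsilon> y = size_gauge y + (\<integral>\<^sup>+z. indicator (cball 0 1) z * osc_gauge \<epsilon> y z \<partial>lborel)"

lemma osc_gauge_borel[measurable]: "(\<lambda>(y, z). osc_gauge \<epsilon> y z) \<in> borel_measurable (borel \<Otimes>\<^sub>M borel)"
  unfolding osc_gauge_def split_beta' by measurable

lemma osc_gauge_borel2[measurable]: "osc_gauge \<epsilon> y \<in> borel_measurable borel"
  unfolding osc_gauge_def[abs_def] by measurable

lemma cball_borel[measurable]: "cball (0 :: real \<times> (real ^ 'd)) s \<in> sets borel" by simp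

lemma weight_borel[measurable]: "weight \<epsilon> \<in> borel_measurable borel"
proof -
  have "(\<lambda>y. \<integral>\<^sup>+z. (case (y, z) of (y, z) \<Rightarrow> indicator (cball 0 1) z * osc_gauge \<epsilon> y z) \<partial>lborel) \<in> borel_measurable borel"
    by (rule lborel.borel_measurable_nn_integral) measurable
  then show ?thesis unfolding weight_def[abs_def] by measurable
qed


text \<open>
  Replacing the length of the shift by the larger \<open>\<epsilon>\<close> decreases the gauge.
\<close>
lemma slab_shift_gauge:
  fixes f :: "real \<times> (real ^ 'd) \<Rightarrow> 'b::euclidean_space"
  assumes bes: "\<And>\<xi>. \<xi> \<noteq> 0 \<Longrightarrow> (\<integral>\<^sup>+y. indicator {y \<in> spacetime T. fst (y + \<xi>) \<in> {0<..<T}} y *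
        Lq_gauge s (norm (f (y + \<xi>) - f y) / (B * norm \<xi> powr k)) \<partial>lborel) \<le> 1"
    and \<epsilon>: "0 < \<epsilon>" "\<epsilon> < a0" "b0 + \<epsilon> < T" and k: "0 \<le> k" and z: "z \<in> cball 0 1"
  shows "(\<integral>\<^sup>+y. indicator ({a0..b0} \<times> cell) y * Lq_gauge s (norm (f (y - \<epsilon> *\<^sub>R z) - f y) / (B * \<epsilon> powr k)) \<partial>lborel) \<le> 1"
proof (cases "z = 0")
  case False
  define \<xi> where "\<xi> = - (\<epsilon> *\<^sub>R z)"
  have \<xi>: "\<xi> \<noteq> 0" "0 < norm \<xi>" "norm \<xi> \<le> \<epsilon>" "\<And>y. y - \<epsilon> *\<^sub>R z = y + \<xi>"
    using False \<epsilon> z unfolding \<xi>_def by auto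
  have f\<xi>: "\<bar>fst \<xi>\<bar> \<le> \<epsilon>" using norm_fst_le[of "fst \<xi>" "snd \<xi>"] \<xi>(3) by simp
  have "(\<integral>\<^sup>+y. indicator ({a0..b0} \<times> cell) y * Lq_gauge s (norm (f (y - \<epsilon> *\<^sub>R z) - f y) / (B * \<epsilon> powr k)) \<partial>lborel)
    \<le> (\<integral>\<^sup>+y. indicator {y \<in> spacetime T. fst (y + \<xi>) \<in> {0<..<T}} y * Lq_gauge s (norm (f (y + \<xi>) - f y) / (B * norm \<xi> powr k)) \<partial>lborel)"
  proof (rule nn_integral_mono)
    fix y :: "real \<times> (real ^ 'd)"
    have "y \<in> {a0..b0} \<times> cell \<Longrightarrow> y \<in> {y \<in> spacetime T. fst (y + \<xi>) \<in> {0<..<T}}"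
      using f\<xi> \<epsilon> unfolding spacetime_def by (cases y) auto
    moreover have "Lq_gauge s (norm (f (y + \<xi>) - f y) / (B * \<epsilon> powr k)) \<le> Lq_gauge s (norm (f (y + \<xi>) - f y) / (B * norm \<xi> powr k))"
      using \<xi> B k by (intro Lq_gauge_mono divide_left_mono mult_left_mono powr_mono2 mult_pos_pos) auto
    ultimately show "indicator ({a0..b0} \<times> cell) y * Lq_gauge s (norm (f (y - \<epsilon> *\<^sub>R z) - f y) / (B * \<epsilon> powr k))
      \<le> indicator {y \<in> spacetime T. fst (y + \<xi>) \<in> {0<..<T}} y * Lq_gauge s (norm (f (y + \<xi>) - f y) / (B * norm \<xi> powr k))"
      unfolding \<xi>(4) by (auto simp: indicator_def)
  qed
  also have "\<dots> \<le> 1" by (rule bes[OF \<xi>(1)])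
  finally show ?thesis .
qed simp

text \<open>
  Fubini in the increment and the point: for each increment the Besov bounds give at most 1 per field.
  The bound does not depend on \<open>\<epsilon>\<close>.
\<close>
lemma weight_integral:
  assumes \<epsilon>: "0 < \<epsilon>" "\<epsilon> < a0" "b0 + \<epsilon> < T"
  shows "(\<integral>\<^sup>+y. indicator ({a0..b0} \<times> cell) y * weight \<epsilon> y \<partial>lborel)
    \<le> (emeasure lborel (spacetime T :: (real \<times> (real ^ 'd)) set) + 2)
      + emeasure lborel (cball (0 :: real \<times> (real ^ 'd)) 1) * (emeasure lborel (spacetime T :: (real \<times> (real ^ 'd)) set) + 3)"
proof -
  define D where "D = {a0..b0} \<times> (cell :: (real ^ 'd) set)"
  have [measurable]: "D \<in> sets borel" unfolding D_def by simp
  have DT: "D \<subseteq> spacetime T" unfolding D_def spacetime_def using \<epsilon> by auto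
  have 1: "(\<integral>\<^sup>+y. indicator D y * size_gauge y \<partial>lborel) \<le> emeasure lborel (spacetime T :: (real \<times> (real ^ 'd)) set) + 2"
    using DT by (intro order_trans[OF nn_integral_mono size_gauge_integral]) (auto simp: indicator_def)
  have 2: "(\<integral>\<^sup>+y. indicator D y * osc_gauge \<epsilon> y z \<partial>lborel) \<le> emeasure lborel (spacetime T :: (real \<times> (real ^ 'd)) set) + 3"
    if z: "z \<in> cball 0 1" for z
  proof -
    have "(\<integral>\<^sup>+y. indicator D y * osc_gauge \<epsilon> y z \<partial>lborel)
      = (\<integral>\<^sup>+y. indicator D y + indicator D y * Lq_gauge r (norm (u (y - \<epsilon> *\<^sub>R z) - u y) / (B * \<epsilon> powr \<alpha>))
        + indicator D y * Lq_gauge q (norm (\<rho> (y - \<epsilon> *\<^sub>R z) - \<rho> y) / (B * \<epsilon> powr \<beta>))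
        + indicator D y * Lq_gauge q (norm (\<rho> (y - \<epsilon> *\<^sub>R z) *\<^sub>R u (y - \<epsilon> *\<^sub>R z) - \<rho> y *\<^sub>R u y) / (B * \<epsilon> powr \<beta>)) \<partial>lborel)"
      unfolding osc_gauge_def by (simp add: distrib_left)
    also have "\<dots> = emeasure lborel D + (\<integral>\<^sup>+y. indicator D y * Lq_gauge r (norm (u (y - \<epsilon> *\<^sub>R z) - u y) / (B * \<epsilon> powr \<alpha>)) \<partial>lborel)
        + (\<integral>\<^sup>+y. indicator D y * Lq_gauge q (norm (\<rho> (y - \<epsilon> *\<^sub>R z) - \<rho> y) / (B * \<epsilon> powr \<beta>)) \<partial>lborel)
        + (\<integral>\<^sup>+y. indicator D y * Lq_gauge q (norm (\<rho> (y - \<epsilon> *\<^sub>R z) *\<^sub>R u (y - \<epsilon> *\<^sub>R z) - \<rho> y *\<^sub>R u y) / (B * \<epsilon> powr \<beta>)) \<partial>lborel)"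
      by (simp add: nn_integral_add)
    also have "\<dots> \<le> emeasure lborel (spacetime T :: (real \<times> (real ^ 'd)) set) + 1 + 1 + 1"
      unfolding D_def
      by (intro add_mono slab_shift_gauge[OF u_besov \<epsilon> \<alpha>(1) z] slab_shift_gauge[OF \<rho>_besov \<epsilon> \<beta>(1) z]
          slab_shift_gauge[where f="\<lambda>y. \<rho> y *\<^sub>R u y", OF m_besov \<epsilon> \<beta>(1) z] emeasure_mono DT[unfolded D_def]) auto
    finally show ?thesis by (simp add: add.assoc one_add_one)
  qed
  have "(\<integral>\<^sup>+y. indicator D y * weight \<epsilon> y \<partial>lborel) = (\<integral>\<^sup>+y. indicator D y * size_gauge y
     + (\<integral>\<^sup>+z. indicator D y * (indicator (cball 0 1) z * osc_gauge \<epsilon> y z) \<partial>lborel) \<partial>lborel)"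
    unfolding weight_def by (simp add: distrib_left nn_integral_cmult)
  also have "\<dots> = (\<integral>\<^sup>+y. indicator D y * size_gauge y \<partial>lborel)
     + (\<integral>\<^sup>+y. (\<integral>\<^sup>+z. indicator D y * (indicator (cball 0 1) z * osc_gauge \<epsilon> y z) \<partial>lborel) \<partial>lborel)"
    by (rule nn_integral_add) measurable
  also have "(\<integral>\<^sup>+y. (\<integral>\<^sup>+z. indicator D y * (indicator (cball 0 1) z * osc_gauge \<epsilon> y z) \<partial>lborel) \<partial>lborel)
    = (\<integral>\<^sup>+z. (\<integral>\<^sup>+y. indicator D y * (indicator (cball 0 1) z * osc_gauge \<epsilon> y z) \<partial>lborel) \<partial>lborel)"
    by (rule lborel_pair.Fubini') measurable
  also have "\<dots> \<le> (\<integral>\<^sup>+z. indicator (cball (0 :: real \<times> (real ^ 'd)) 1) z * (emeasure lborel (spacetime T :: (real \<times> (real ^ 'd)) set) + 3) \<partial>lborel)"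
  proof (rule nn_integral_mono)
    fix z :: "real \<times> (real ^ 'd)"
    show "(\<integral>\<^sup>+y. indicator D y * (indicator (cball 0 1) z * osc_gauge \<epsilon> y z) \<partial>lborel)
      \<le> indicator (cball (0 :: real \<times> (real ^ 'd)) 1) z * (emeasure lborel (spacetime T :: (real \<times> (real ^ 'd)) set) + 3)"
      using 2[of z] by (cases "z \<in> cball 0 1") auto
  qed
  also have "\<dots> = emeasure lborel (cball (0 :: real \<times> (real ^ 'd)) 1) * (emeasure lborel (spacetime T :: (real \<times> (real ^ 'd)) set) + 3)"
    by (simp add: nn_integral_multc)
  finally show ?thesis using 1 unfolding D_def by (meson add_mono order_refl order_trans)
qed

definition \<kappa> :: real where "\<kappa> = min (min \<alpha> \<beta>) (min (2 * \<alpha> + \<beta> - 1) (\<alpha> + \<gamma> * \<beta> - 1))"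

lemma \<kappa>_pos: "0 < \<kappa>"
proof -
  have "0 < \<alpha>" using \<alpha>\<beta> \<beta> by linarith
  moreover have "0 < \<beta>" using \<alpha>\<beta> \<alpha> \<beta> \<gamma> by (cases "\<beta> = 0") auto
  ultimately show ?thesis unfolding \<kappa>_def using \<alpha>\<beta> by auto
qed

definition \<omega> :: real where "\<omega> = unit_ball_measure TYPE(real \<times> (real ^ 'd))"

definition LKc :: real where "LKc = c\<eta> * (\<omega> + 1)"

text \<open>
  One constant above all those that appear in the estimates of the individual fields, so that the
  products can be bounded uniformly.
\<close>
definition Lc :: real where
  "Lc = 1 + (B + LKc * B) + (LKc * B * B + LKc * B * (LKc * B)) + hi + LKc * (C * (B + LKc * B) powr \<gamma>) * (\<omega> + 1)
     + C * (1 + LKc * B) + (\<bar>p lo\<bar> + C * hi) + (\<bar>P0 lo\<bar> + C * hi)"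

lemma constants: "0 \<le> \<omega>" "0 \<le> LKc" "1 \<le> Lc" "B \<le> Lc" "B + LKc * B \<le> Lc" "LKc * B \<le> Lc"
  "LKc * B * B + LKc * B * (LKc * B) \<le> Lc" "hi \<le> Lc" "LKc * (C * (B + LKc * B) powr \<gamma>) * (\<omega> + 1) \<le> Lc"
  "C \<le> Lc" "C * (LKc * B) \<le> Lc" "C * (1 + LKc * B) \<le> Lc" "\<bar>p lo\<bar> + C * hi \<le> Lc" "\<bar>P0 lo\<bar> + C * hi \<le> Lc"
proof -
  show w: "0 \<le> \<omega>" unfolding \<omega>_def unit_ball_measure_def by simp
  show l: "0 \<le> LKc" unfolding LKc_def using w c\<eta> by simp
  have n: "0 \<le> LKc * B" "0 \<le> LKc * B * B" "0 \<le> LKc * B * (LKc * B)" "0 \<le> LKc * (C * (B + LKc * B) powr \<gamma>) * (\<omega> + 1)"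
    "0 \<le> C * (LKc * B)" "0 \<le> C * hi" "C * (1 + LKc * B) = C + C * (LKc * B)"
    using w l B C lohi by (auto simp: algebra_simps)
  show "1 \<le> Lc" "B \<le> Lc" "B + LKc * B \<le> Lc" "LKc * B \<le> Lc"
    "LKc * B * B + LKc * B * (LKc * B) \<le> Lc" "hi \<le> Lc" "LKc * (C * (B + LKc * B) powr \<gamma>) * (\<omega> + 1) \<le> Lc"
    "C \<le> Lc" "C * (LKc * B) \<le> Lc" "C * (1 + LKc * B) \<le> Lc" "\<bar>p lo\<bar> + C * hi \<le> Lc" "\<bar>P0 lo\<bar> + C * hi \<le> Lc"
    unfolding Lc_def n(7) using n B C lohi by linarith+
qed

definition CC :: real where "CC = Lc ^ 4 * (10 + 10 * real CARD('d)) ^ 2"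

abbreviation "Rm \<epsilon> \<equiv> mol \<eta> \<epsilon> \<rho>"
abbreviation "Um \<epsilon> i \<equiv> mol \<eta> \<epsilon> (\<lambda>y. u y $ i)"
abbreviation "Mm \<epsilon> i \<equiv> mol \<eta> \<epsilon> (\<lambda>y. \<rho> y * u y $ i)"
abbreviation "Qm \<epsilon> i j \<equiv> mol \<eta> \<epsilon> (\<lambda>y. \<rho> y * u y $ j * u y $ i)"
abbreviation "Pm \<epsilon> \<equiv> mol \<eta> \<epsilon> (on_range p)"

text \<open>
  Where the weight is finite, it controls the oscillations for almost every increment, so that the
  estimates for a weighted point apply with the mean of the oscillations as \<open>h\<close>.
\<close>
lemma good_point_bounds:
  assumes \<epsilon>: "0 < \<epsilon>" "\<epsilon> \<le> 1" "\<epsilon> < fst y" "fst y + \<epsilon> < T" and fin: "weight \<epsilon> y \<noteq> \<infinity>"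
    and kA: "\<And>s. s \<in> {lo..hi} \<Longrightarrow> \<bar>k s\<bar> \<le> C * (\<epsilon> powr \<beta>) powr (\<gamma> - 2) \<and> \<bar>A s\<bar> \<le> C \<and>
      \<bar>qq s - p s\<bar> \<le> C * (\<epsilon> powr \<beta>) powr \<gamma> \<and> \<bar>s * A s - qq s - P0 s\<bar> \<le> C * \<epsilon> powr \<beta>"
  defines "h \<equiv> enn2real (weight \<epsilon> y)"
  shows "bd \<epsilon> h CC \<kappa> 1 ((\<Sum>i\<in>UNIV. Mm \<epsilon> i y * Um \<epsilon> i y) - Rm \<epsilon> y * (\<Sum>i\<in>UNIV. Um \<epsilon> i y * Um \<epsilon> i y) / 2
        + (Rm \<epsilon> y * A (Rm \<epsilon> y) - qq (Rm \<epsilon> y))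
      - (\<rho> y * (\<Sum>i\<in>UNIV. u y $ i * u y $ i) / 2 + P0 (\<rho> y)))"
    and "bd \<epsilon> h CC \<kappa> 1 ((\<Sum>i\<in>UNIV. Qm \<epsilon> i j y * Um \<epsilon> i y) + Pm \<epsilon> y * Um \<epsilon> j y
        - Mm \<epsilon> j y * (\<Sum>i\<in>UNIV. Um \<epsilon> i y * Um \<epsilon> i y) / 2 + Mm \<epsilon> j y * A (Rm \<epsilon> y) - qq (Rm \<epsilon> y) * Um \<epsilon> j y
      - (\<rho> y * (\<Sum>i\<in>UNIV. u y $ i * u y $ i) / 2 + p (\<rho> y) + P0 (\<rho> y)) * u y $ j)"
    and "bd \<epsilon> h CC \<kappa> 1 ((\<Sum>i\<in>UNIV. (Mm \<epsilon> i y - Rm \<epsilon> y * Um \<epsilon> i y) * dir_deriv time_dir (Um \<epsilon> i) y)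
      + (\<Sum>i\<in>UNIV. \<Sum>j\<in>UNIV. (Qm \<epsilon> i j y - Mm \<epsilon> j y * Um \<epsilon> i y) * dir_deriv (space_dir j) (Um \<epsilon> i) y)
      + (\<Sum>i\<in>UNIV. dir_deriv (space_dir i) (Um \<epsilon> i) y) * (Pm \<epsilon> y - qq (Rm \<epsilon> y))
      + k (Rm \<epsilon> y) * (\<Sum>j\<in>UNIV. (Mm \<epsilon> j y - Rm \<epsilon> y * Um \<epsilon> j y) * dir_deriv (space_dir j) (Rm \<epsilon>) y))"
proof -
  define w where "w z = max 1 (enn2real (osc_gauge \<epsilon> y z))" for z
  have og1: "1 \<le> osc_gauge \<epsilon> y z" for z
    unfolding osc_gauge_def by (meson add_increasing2 order_refl zero_le)
  have wle: "ennreal (w z) \<le> osc_gauge \<epsilon> y z" for z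
    unfolding w_def using og1[of z]
    by (cases "osc_gauge \<epsilon> y z") (auto simp: max_def)
  have size_le: "size_gauge y \<le> weight \<epsilon> y" unfolding weight_def by (rule add_increasing2) auto
  have h1: "1 \<le> h" unfolding h_def by (rule size_bounds(1)[OF size_le fin])
  have hW: "ennreal h = weight \<epsilon> y" unfolding h_def using fin by (simp add: less_top)
  have int_le: "(\<integral>\<^sup>+z. indicator (cball 0 1) z * osc_gauge \<epsilon> y z \<partial>lborel) \<le> weight \<epsilon> y"
    unfolding weight_def by (rule add_increasing) auto
  have wm: "w \<in> borel_measurable borel" unfolding w_def by measurable
  interpret wp: weighted_point \<eta> c\<eta> \<epsilon> h B w y "insert time_dir (range space_dir)"
  proof
    show "(\<integral>\<^sup>+z. indicator (cball 0 1) z * ennreal (w z) \<partial>lborel) \<le> ennreal h"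
      unfolding hW by (rule order_trans[OF nn_integral_mono int_le]) (intro mult_left_mono wle, simp)
  qed (use \<eta> \<eta>_even \<eta>_nonneg \<eta>_one c\<eta> \<epsilon> h1 B wm in \<open>auto simp: w_def\<close>)
  have LK: "wp.LK = LKc" unfolding wp.LK_def LKc_def \<omega>_def ..
  have aefin: "AE z in lborel. z \<in> cball 0 1 \<longrightarrow> osc_gauge \<epsilon> y z \<noteq> \<infinity>"
  proof -
    have "AE z in lborel. indicator (cball 0 1) z * osc_gauge \<epsilon> y z \<noteq> \<infinity>"
      by (rule nn_integral_PInf_AE) (use int_le fin in \<open>auto simp: top_unique\<close>)
    then show ?thesis by eventually_elim auto
  qed
  have wf: "w z = enn2real (osc_gauge \<epsilon> y z)" if "osc_gauge \<epsilon> y z \<noteq> \<infinity>" for z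
    using og1[of z] that unfolding w_def by (cases "osc_gauge \<epsilon> y z") (auto simp: max_def)
  have pos: "0 < B * \<epsilon> powr \<alpha>" "0 < B * \<epsilon> powr \<beta>" using B \<epsilon> by auto
  have gle: "Lq_gauge r (norm (u (y - \<epsilon> *\<^sub>R z) - u y) / (B * \<epsilon> powr \<alpha>)) \<le> osc_gauge \<epsilon> y z"
    "Lq_gauge q (norm (\<rho> (y - \<epsilon> *\<^sub>R z) - \<rho> y) / (B * \<epsilon> powr \<beta>)) \<le> osc_gauge \<epsilon> y z"
    "Lq_gauge q (norm (\<rho> (y - \<epsilon> *\<^sub>R z) *\<^sub>R u (y - \<epsilon> *\<^sub>R z) - \<rho> y *\<^sub>R u y) / (B * \<epsilon> powr \<beta>)) \<le> osc_gauge \<epsilon> y z" for z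
    unfolding osc_gauge_def by (intro add_increasing2 add_increasing order_refl zero_le; simp)+
  have osc\<rho>: "wp.osc \<beta> eb \<rho>"
    unfolding wp.osc_def
  proof (intro conjI admissibleD(4)[OF admissible_\<rho>])
    show "AE z in lborel. z \<in> cball 0 1 \<longrightarrow> \<bar>\<rho> (y - \<epsilon> *\<^sub>R z) - \<rho> y\<bar> \<le> B * \<epsilon> powr \<beta> * w z powr eb"
      using aefin
    proof eventually_elim
      case (elim z)
      then show ?case using Lq_gauge_scaled_bound[OF rq(2) _ pos(2) gle(2) og1, of z] wf[of z] unfolding eb_def by auto
    qed
  qed
  have oscu: "wp.osc \<alpha> ea (\<lambda>y. u y $ i)" for i
    unfolding wp.osc_def
  proof (intro conjI admissibleD(4)[OF admissible_u])
    show "AE z in lborel. z \<in> cball 0 1 \<longrightarrow> \<bar>u (y - \<epsilon> *\<^sub>R z) $ i - u y $ i\<bar> \<le> B * \<epsilon> powr \<alpha> * w z powr ea"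
      using aefin
    proof eventually_elim
      case (elim z)
      then show ?case using Lq_gauge_scaled_bound[OF rq(1) _ pos(1) gle(1) og1, of z] wf[of z]
          component_le_norm_cart[of "u (y - \<epsilon> *\<^sub>R z) - u y" i] unfolding ea_def by auto
    qed
  qed
  have oscm: "wp.osc \<beta> eb (\<lambda>y. \<rho> y * u y $ i)" for i
    unfolding wp.osc_def
  proof (intro conjI admissibleD(4)[OF admissible_m])
    show "AE z in lborel. z \<in> cball 0 1 \<longrightarrow> \<bar>\<rho> (y - \<epsilon> *\<^sub>R z) * u (y - \<epsilon> *\<^sub>R z) $ i - \<rho> y * u y $ i\<bar> \<le> B * \<epsilon> powr \<beta> * w z powr eb"
      using aefin
    proof eventually_elim
      case (elim z)
      then show ?case using Lq_gauge_scaled_bound[OF rq(2) _ pos(2) gle(3) og1, of z] wf[of z]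
          component_le_norm_cart[of "\<rho> (y - \<epsilon> *\<^sub>R z) *\<^sub>R u (y - \<epsilon> *\<^sub>R z) - \<rho> y *\<^sub>R u y" i] unfolding eb_def by auto
    qed
  qed
  have win: "0 < fst (y - \<epsilon> *\<^sub>R z) \<and> fst (y - \<epsilon> *\<^sub>R z) < T" if "z \<in> cball 0 1" for z
  proof -
    have "\<bar>fst z\<bar> \<le> 1" using norm_fst_le[of "fst z" "snd z"] that by simp
    then have "\<bar>\<epsilon> * fst z\<bar> \<le> \<epsilon>" using \<epsilon> by (simp add: abs_mult)
    then show ?thesis using \<epsilon> by auto
  qed
  have range: "\<rho> (y - \<epsilon> *\<^sub>R z) \<in> {lo..hi} \<and> on_range p (y - \<epsilon> *\<^sub>R z) = p (\<rho> (y - \<epsilon> *\<^sub>R z))" if "z \<in> cball 0 1" for z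
    using win[OF that] \<rho>_range on_range_eq by auto
  have \<rho>r: "\<rho> y \<in> {lo..hi}" using \<rho>_range[of y] \<epsilon> by auto
  define R where "R = Rm \<epsilon> y"
  have Rr: "R \<in> {lo..hi}"
    unfolding R_def by (rule wp.mol_range[OF admissibleD(4)[OF admissible_\<rho>]]) (use range in auto)
  note W = bd_weaken[OF _ _ _ _ _ \<epsilon>(1,2) h1]
  have L0: "0 \<le> Lc" using constants by linarith
  have pw1: "\<epsilon> powr 0 = 1" "h powr 0 = 1" using \<epsilon> h1 by auto
  have b_u: "bd \<epsilon> h Lc 0 ea (u y $ i)" for i
  proof (rule W)
    show "bd \<epsilon> h B 0 ea (u y $ i)" using size_bounds(2)[OF size_le fin, of i] unfolding bd_def pw1 h_def by simp
  qed (use constants L0 in auto)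
  have b_dU: "bd \<epsilon> h (LKc * B) \<alpha> ea (Um \<epsilon> i y - u y $ i)" for i
    using wp.mol_error[OF oscu ea_eb(1,5)] unfolding LK .
  have b_dM: "bd \<epsilon> h (LKc * B) \<beta> eb (Mm \<epsilon> i y - \<rho> y * u y $ i)" for i
    using wp.mol_error[OF oscm ea_eb(2,6)] unfolding LK .
  have b_dR: "bd \<epsilon> h (LKc * B) \<beta> eb (R - \<rho> y)"
    using wp.mol_error[OF osc\<rho> ea_eb(2,6)] unfolding LK R_def .
  have b_U: "bd \<epsilon> h Lc 0 ea (Um \<epsilon> i y)" for i
  proof (rule W)
    have "bd \<epsilon> h B 0 ea (u y $ i)" using size_bounds(2)[OF size_le fin, of i] unfolding bd_def pw1 h_def by simp
    moreover have "bd \<epsilon> h (LKc * B) 0 ea (Um \<epsilon> i y - u y $ i)"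
      by (rule W[OF b_dU]) (use constants B \<alpha> in auto)
    ultimately show "bd \<epsilon> h (B + LKc * B) 0 ea (Um \<epsilon> i y)" using bd_add by fastforce
  qed (use constants L0 in auto)
  have b_D: "bd \<epsilon> h Lc (\<alpha> - 1) ea (dir_deriv v (Um \<epsilon> i) y)" "bd \<epsilon> h Lc (\<beta> - 1) eb (dir_deriv v (Rm \<epsilon>) y)"
    if "v \<in> insert time_dir (range space_dir)" for v i
    by (rule W[OF wp.dir_deriv_mol_bound[OF oscu ea_eb(1,5) that]]; use constants L0 LK in simp)
       (rule W[OF wp.dir_deriv_mol_bound[OF osc\<rho> ea_eb(2,6) that]]; use constants L0 LK in simp)
  have b_\<rho>: "bd \<epsilon> h Lc 0 0 (\<rho> y)" "bd \<epsilon> h Lc 0 0 R"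
    using \<rho>r Rr lohi constants unfolding bd_def pw1 by auto
  have b_m: "bd \<epsilon> h Lc 0 eb (\<rho> y * u y $ i)" for i
  proof (rule W)
    show "bd \<epsilon> h B 0 eb (\<rho> y * u y $ i)" using size_bounds(3)[OF size_le fin, of i] unfolding bd_def pw1 h_def by simp
  qed (use constants L0 in auto)
  have b_r: "bd \<epsilon> h Lc (\<alpha> + \<beta>) (ea + eb) (Mm \<epsilon> i y - R * Um \<epsilon> i y)" for i
    unfolding R_def
    by (rule W[OF wp.commutator_bound[OF osc\<rho> oscu admissibleD(4)[OF admissible_m]]]) (use ea_eb constants L0 LK in auto)
  have b_s: "bd \<epsilon> h Lc (\<alpha> + \<beta>) (ea + eb) (Qm \<epsilon> i j y - Mm \<epsilon> j y * Um \<epsilon> i y)" for i j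
    by (rule W[OF wp.commutator_bound[OF oscm oscu admissibleD(4)[OF admissible_mu]]]) (use ea_eb constants L0 LK in auto)
  have b_\<theta>: "bd \<epsilon> h Lc (\<gamma> * \<beta>) (\<gamma> * eb) (Pm \<epsilon> y - p R)"
    unfolding R_def
    by (rule W[OF wp.pressure_commutator_bound[OF osc\<rho> admissibleD(4)[OF admissible_on_range[OF p_lip]] range p_taylor C ea_eb(2,8)]])
       (use \<gamma> constants L0 LK in \<open>auto simp: \<omega>_def\<close>)
  have pp: "(\<epsilon> powr \<beta>) powr s = \<epsilon> powr (s * \<beta>)" for s by (simp add: powr_powr mult.commute)
  have b_\<tau>: "bd \<epsilon> h Lc (\<gamma> * \<beta>) 0 (qq R - p R)"
  proof (rule W)
    show "bd \<epsilon> h C (\<gamma> * \<beta>) 0 (qq R - p R)" using kA[OF Rr] unfolding bd_def pw1 pp by simp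
  qed (use constants L0 in auto)
  have b_k: "bd \<epsilon> h Lc (\<beta> * (\<gamma> - 2)) 0 (k R)"
  proof (rule W)
    show "bd \<epsilon> h C (\<beta> * (\<gamma> - 2)) 0 (k R)" using kA[OF Rr] unfolding bd_def pw1 pp by (simp add: mult.commute)
  qed (use constants L0 in auto)
  have b_A: "bd \<epsilon> h Lc 0 0 (A R)" using kA[OF Rr] constants unfolding bd_def pw1 by auto
  have b_p: "bd \<epsilon> h Lc 0 0 (p (\<rho> y))" using on_range_bound[OF p_lip \<rho>r] constants unfolding bd_def pw1 by auto
  have b_P: "bd \<epsilon> h Lc 0 0 (P0 (\<rho> y))" using on_range_bound[OF P0_lip \<rho>r] constants unfolding bd_def pw1 by auto
  have lipR: "bd \<epsilon> h (C * (LKc * B)) \<beta> eb (f R - f (\<rho> y))" if "\<bar>f R - f (\<rho> y)\<bar> \<le> C * \<bar>R - \<rho> y\<bar>" for f :: "real \<Rightarrow> real"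
    using that mult_left_mono[OF b_dR[unfolded bd_def] C] unfolding bd_def by (simp add: mult_ac)
  have b_dp: "bd \<epsilon> h Lc \<beta> eb (p R - p (\<rho> y))"
    by (rule W[OF lipR[OF p_lip[OF Rr \<rho>r]]]) (use constants L0 in auto)
  have b_X: "bd \<epsilon> h Lc \<beta> eb (R * A R - qq R - P0 (\<rho> y))"
  proof (rule W)
    have "bd \<epsilon> h C \<beta> 0 (R * A R - qq R - P0 R)" using kA[OF Rr] unfolding bd_def pw1 by simp
    then have "bd \<epsilon> h C \<beta> eb (R * A R - qq R - P0 R)" by (rule W) (use ea_eb C in auto)
    from bd_add[OF this lipR[OF P0_lip[OF Rr \<rho>r]]]
    show "bd \<epsilon> h (C * (1 + LKc * B)) \<beta> eb (R * A R - qq R - P0 (\<rho> y))" by (simp add: algebra_simps)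
  qed (use constants L0 in auto)
  have b_dU': "bd \<epsilon> h Lc \<alpha> ea (Um \<epsilon> i y - u y $ i)" for i by (rule W[OF b_dU]) (use constants L0 in auto)
  have b_dM': "bd \<epsilon> h Lc \<beta> eb (Mm \<epsilon> i y - \<rho> y * u y $ i)" for i by (rule W[OF b_dM]) (use constants L0 in auto)
  have b_dR': "bd \<epsilon> h Lc \<beta> eb (R - \<rho> y)" by (rule W[OF b_dR]) (use constants L0 in auto)
  have \<kappa>: "\<kappa> \<le> \<alpha>" "\<kappa> \<le> \<beta>" "\<kappa> \<le> 2 * \<alpha> + \<beta> - 1" "\<kappa> \<le> \<alpha> + \<gamma> * \<beta> - 1" unfolding \<kappa>_def by auto
  note E = energy_defect_bounds[where m="\<lambda>i. \<rho> y * u y $ i" and M="\<lambda>i. Mm \<epsilon> i y" and Q="\<lambda>i j. Qm \<epsilon> i j y"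
      and U="\<lambda>i. Um \<epsilon> i y" and u="\<lambda>i. u y $ i" and ?D0U.0="\<lambda>i. dir_deriv time_dir (Um \<epsilon> i) y" and DU="\<lambda>i j. dir_deriv (space_dir j) (Um \<epsilon> i) y"
      and DR="\<lambda>j. dir_deriv (space_dir j) (Rm \<epsilon>) y",
      OF \<epsilon>(1,2) h1 constants(3) ea_eb(1-4) \<gamma> \<alpha>(1) \<beta>(1) \<kappa> refl b_u b_U b_dU' b_D(1)[of time_dir] b_D(1) b_\<rho> b_dR' b_D(2) b_m b_dM' b_r b_s
        b_\<theta> b_\<tau> b_A b_k b_p b_dp b_P b_X, folded CC_def]
  show "bd \<epsilon> h CC \<kappa> 1 ((\<Sum>i\<in>UNIV. Mm \<epsilon> i y * Um \<epsilon> i y) - Rm \<epsilon> y * (\<Sum>i\<in>UNIV. Um \<epsilon> i y * Um \<epsilon> i y) / 2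
        + (Rm \<epsilon> y * A (Rm \<epsilon> y) - qq (Rm \<epsilon> y))
      - (\<rho> y * (\<Sum>i\<in>UNIV. u y $ i * u y $ i) / 2 + P0 (\<rho> y)))"
    unfolding R_def[symmetric] by (rule E(1)) auto
  show "bd \<epsilon> h CC \<kappa> 1 ((\<Sum>i\<in>UNIV. Qm \<epsilon> i j y * Um \<epsilon> i y) + Pm \<epsilon> y * Um \<epsilon> j y
        - Mm \<epsilon> j y * (\<Sum>i\<in>UNIV. Um \<epsilon> i y * Um \<epsilon> i y) / 2 + Mm \<epsilon> j y * A (Rm \<epsilon> y) - qq (Rm \<epsilon> y) * Um \<epsilon> j y
      - (\<rho> y * (\<Sum>i\<in>UNIV. u y $ i * u y $ i) / 2 + p (\<rho> y) + P0 (\<rho> y)) * u y $ j)"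
    unfolding R_def[symmetric] by (rule E(2)) auto
  show "bd \<epsilon> h CC \<kappa> 1 ((\<Sum>i\<in>UNIV. (Mm \<epsilon> i y - Rm \<epsilon> y * Um \<epsilon> i y) * dir_deriv time_dir (Um \<epsilon> i) y)
      + (\<Sum>i\<in>UNIV. \<Sum>j\<in>UNIV. (Qm \<epsilon> i j y - Mm \<epsilon> j y * Um \<epsilon> i y) * dir_deriv (space_dir j) (Um \<epsilon> i) y)
      + (\<Sum>i\<in>UNIV. dir_deriv (space_dir i) (Um \<epsilon> i) y) * (Pm \<epsilon> y - qq (Rm \<epsilon> y))
      + k (Rm \<epsilon> y) * (\<Sum>j\<in>UNIV. (Mm \<epsilon> j y - Rm \<epsilon> y * Um \<epsilon> j y) * dir_deriv (space_dir j) (Rm \<epsilon>) y))"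
    unfolding R_def[symmetric] by (rule E(3)) auto
qed

end

section \<open>The local energy balance\<close>

context mollification begin

lemma admissible_add:
  assumes "admissible f" "admissible g" shows "admissible (\<lambda>y. f y + g y)"
  using assms unfolding admissible_def by (auto simp: space_periodic_def set_integral_add(1))

lemma admissible_cmult:
  assumes "admissible f" shows "admissible (\<lambda>y. c * f y)"
  using assms unfolding admissible_def by (auto simp: space_periodic_def)

lemma admissible_sum:
  assumes "\<And>i. i \<in> I \<Longrightarrow> admissible (f i)" "finite I" "I \<noteq> {}" shows "admissible (\<lambda>y. \<Sum>i\<in>I. f i y)"
  using assms(2,3,1) by (induction rule: finite_ne_induct) (auto intro: admissible_add)

lemma admissible_pairing_integrable:
  assumes "admissible f" "test_fun a b \<phi>" shows "set_integrable lborel strip (\<lambda>y. dir_deriv v \<phi> y * f y)"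
proof -
  obtain S where S: "\<And>y. \<bar>dir_deriv v \<phi> y\<bar> \<le> S" using test_fun_bounded_dir_deriv[OF assms(2)] by blast
  have "dir_deriv v \<phi> \<in> borel_measurable borel"
    using assms(2) C1_dir_deriv_continuous borel_measurable_continuous_onI unfolding test_fun_def by fast
  from strip_integrable_mult_bounded[OF admissibleD(3,1)[OF assms(1)] this S] show ?thesis by (simp add: mult.commute)
qed

end

context periodic_flow begin

definition energy_density :: "real \<times> (real ^ 'd) \<Rightarrow> real" where
  "energy_density y = (\<Sum>i\<in>UNIV. \<rho> y * u y $ i * u y $ i) / 2 + on_range P0 y"

definition energy_flux :: "'d \<Rightarrow> real \<times> (real ^ 'd) \<Rightarrow> real" where
  "energy_flux j y = ((\<Sum>i\<in>UNIV. \<rho> y * u y $ i * u y $ i) / 2 + on_range p y + on_range P0 y) * u y $ j"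

lemma admissible_energy_density: "admissible energy_density"
proof -
  have "admissible (\<lambda>y. 1 / 2 * (\<Sum>i\<in>UNIV. \<rho> y * u y $ i * u y $ i) + on_range P0 y)"
    by (intro admissible_add admissible_cmult admissible_sum admissible_mu admissible_on_range P0_lip) auto
  then show ?thesis unfolding energy_density_def[abs_def] by simp
qed

text \<open>
  The kinetic energy flux has two velocity factors beside the momentum, whence the condition \<open>2
  / r + 1 / q \<le> 1\<close>.
\<close>
lemma admissible_cubic: "admissible (\<lambda>y. \<rho> y * u y $ i * u y $ i * u y $ j)"
  unfolding admissible_def
proof (intro conjI integrable_of_size_bound[where A="B * B * B"])
  fix y assume y: "y \<in> spacetime T" "size_gauge y \<noteq> \<infinity>"
  define h where "h = enn2real (size_gauge y)"
  have "\<bar>\<rho> y * u y $ i\<bar> * \<bar>u y $ i\<bar> * \<bar>u y $ j\<bar> \<le> (B * h powr eb) * (B * h powr ea) * (B * h powr ea)"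
    unfolding h_def using B by (intro mult_mono size_bounds(2,3)[OF order_refl y(2)]) auto
  also have "\<dots> = B * B * B * h powr (2 * ea + eb)"
  proof -
    have "h powr (2 * ea + eb) = h powr eb * h powr ea * h powr ea" by (simp add: powr_add[symmetric] algebra_simps)
    then show ?thesis by (simp add: mult_ac)
  qed
  also have "\<dots> \<le> B * B * B * h"
    using B ea_eb size_bounds(1)[OF order_refl y(2)] unfolding h_def by (intro mult_left_mono powr_le_self) auto
  finally show "\<bar>\<rho> y * u y $ i * u y $ i * u y $ j\<bar> \<le> B * B * B * enn2real (size_gauge y)" unfolding h_def by (simp add: abs_mult)
next
  show "space_periodic (\<lambda>y. \<rho> y * u y $ i * u y $ i * u y $ j)" using u_per \<rho>_per unfolding space_periodic_def by simp
qed (use B zero_outside in auto)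

lemma admissible_on_range_u:
  assumes "\<And>s t. s \<in> {lo..hi} \<Longrightarrow> t \<in> {lo..hi} \<Longrightarrow> \<bar>f s - f t\<bar> \<le> C * \<bar>s - t\<bar>"
  shows "admissible (\<lambda>y. on_range f y * u y $ j)"
  unfolding admissible_def
proof (intro conjI)
  note f = admissible_on_range[OF assms] and v = admissible_u[of j]
  have "\<bar>on_range f y\<bar> \<le> \<bar>f lo\<bar> + C * hi" for y
    unfolding on_range_def using on_range_bound[OF assms clamp_range] C lohi by auto
  from strip_integrable_mult_bounded[OF admissibleD(3,1)[OF v] admissibleD(1)[OF f] this]
  show "set_integrable lborel strip (\<lambda>y. on_range f y * u y $ j)" by (simp add: mult.commute)
  show "(\<lambda>y. on_range f y * u y $ j) \<in> borel_measurable borel"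
    by (intro borel_measurable_times admissibleD(1)[OF f] admissibleD(1)[OF v])
  show "space_periodic (\<lambda>y. on_range f y * u y $ j)"
    using admissibleD(2)[OF f] admissibleD(2)[OF v] unfolding space_periodic_def by simp
qed

lemma admissible_energy_flux: "admissible (energy_flux j)"
proof -
  have "admissible (\<lambda>y. 1 / 2 * (\<Sum>i\<in>UNIV. \<rho> y * u y $ i * u y $ i * u y $ j) + on_range p y * u y $ j + on_range P0 y * u y $ j)"
    by (intro admissible_add admissible_cmult admissible_sum admissible_cubic admissible_on_range_u p_lip P0_lip) auto
  moreover have "energy_flux j = (\<lambda>y. 1 / 2 * (\<Sum>i\<in>UNIV. \<rho> y * u y $ i * u y $ i * u y $ j) + on_range p y * u y $ j + on_range P0 y * u y $ j)"
    by (simp add: fun_eq_iff energy_flux_def sum_distrib_right distrib_right)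
  ultimately show ?thesis by simp
qed

lemma mollified_mass:
  assumes \<psi>: "test_fun a b \<psi>" and \<epsilon>: "0 < \<epsilon>" "\<epsilon> < a" "b + \<epsilon> < T"
  shows "(LBINT y:strip. Rm \<epsilon> y * dir_deriv time_dir \<psi> y + (\<Sum>j\<in>UNIV. Mm \<epsilon> j y * dir_deriv (space_dir j) \<psi> y)) = 0"
proof -
  have z: "admissible (\<lambda>y. 0)" using admissible_cmult[OF admissible_\<rho>, of 0] by simp
  have "(LBINT y:strip. Rm \<epsilon> y * dir_deriv time_dir \<psi> y + (\<Sum>j\<in>UNIV. Mm \<epsilon> j y * dir_deriv (space_dir j) \<psi> y)
      + mol \<eta> \<epsilon> (\<lambda>y. 0) y * dir_deriv time_dir \<psi> y) = 0"
    by (rule mollified_law[OF admissible_\<rho> admissible_m z \<psi> \<epsilon>]) (use mass in simp)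
  then show ?thesis by (simp add: mol_def)
qed

lemma mollified_momentum:
  assumes \<psi>: "test_fun a b \<psi>" and \<epsilon>: "0 < \<epsilon>" "\<epsilon> < a" "b + \<epsilon> < T"
  shows "(LBINT y:strip. Mm \<epsilon> i y * dir_deriv time_dir \<psi> y + (\<Sum>j\<in>UNIV. Qm \<epsilon> i j y * dir_deriv (space_dir j) \<psi> y) + Pm \<epsilon> y * dir_deriv (space_dir i) \<psi> y) = 0"
proof (rule mollified_law[OF admissible_m admissible_mu admissible_on_range[OF p_lip] \<psi> \<epsilon>])
  fix \<phi> :: "real \<times> (real ^ 'd) \<Rightarrow> real" assume "\<phi> \<in> test_functions T"
  moreover have "on_range p = (\<lambda>y. if 0 < fst y \<and> fst y < T then p (\<rho> y) else 0)"
    using on_range_eq[of _ p] by (auto simp: fun_eq_iff on_range_def)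
  ultimately show "(LBINT y:strip. \<rho> y * u y $ i * dir_deriv time_dir \<phi> y + (\<Sum>j\<in>UNIV. \<rho> y * u y $ j * u y $ i * dir_deriv (space_dir j) \<phi> y)
      + on_range p y * dir_deriv (space_dir i) \<phi> y) = 0"
    using momentum[of \<phi> i] by simp
qed

text \<open>
  The mollified balance differs from the balance itself by at most a constant times \<open>\<epsilon>
  powr \<kappa>\<close> times the weight, and the integral of the weight is bounded; then
  \<open>\<epsilon>\<close> tends to 0. At points of infinite weight the bound is trivial.
\<close>
theorem local_energy_balance:
  assumes \<phi>: "\<phi> \<in> test_functions T"
  shows "(LBINT y:strip. energy_density y * dir_deriv time_dir \<phi> y + (\<Sum>j\<in>UNIV. energy_flux j y * dir_deriv (space_dir j) \<phi> y)) = 0"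
proof -
  obtain a0 b0 where ab: "0 < a0" "b0 < T" "\<And>t x. \<phi> (t, x) \<noteq> 0 \<Longrightarrow> a0 \<le> t \<and> t \<le> b0"
    using \<phi> unfolding test_functions_def by auto
  have tf: "test_fun a0 b0 \<phi>"
    using \<phi> ab(3) smooth_C1 unfolding test_functions_def test_fun_def time_supp_def by auto
  have \<phi>c: "continuous_on UNIV \<phi>" "space_periodic \<phi>" "time_supp a0 b0 \<phi>"
    using tf C1_continuous unfolding test_fun_def by auto
  obtain S0 where S0: "0 \<le> S0" "\<And>y. \<bar>\<phi> y\<bar> \<le> S0" using periodic_bounded[OF \<phi>c] by auto
  obtain S1 where S1: "0 \<le> S1" "\<And>y. \<bar>dir_deriv time_dir \<phi> y\<bar> \<le> S1" using test_fun_bounded_dir_deriv[OF tf] by blast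
  have "\<forall>j. \<exists>S\<ge>0. \<forall>y. \<bar>dir_deriv (space_dir j) \<phi> y\<bar> \<le> S" using test_fun_bounded_dir_deriv[OF tf] by blast
  then obtain S2 where S2: "\<And>j. 0 \<le> S2 j" "\<And>j y. \<bar>dir_deriv (space_dir j) \<phi> y\<bar> \<le> S2 j" by metis
  define S where "S = 1 + S1 + (\<Sum>j\<in>UNIV. S2 j) + S0"
  have S: "0 < S" unfolding S_def using S0(1) S1(1) S2(1) by (simp add: add_pos_nonneg sum_nonneg)
  define tgt where "tgt y = energy_density y * dir_deriv time_dir \<phi> y + (\<Sum>j\<in>UNIV. energy_flux j y * dir_deriv (space_dir j) \<phi> y)" for y
  have tgt_alt: "tgt = (\<lambda>y. dir_deriv time_dir \<phi> y * energy_density y + (\<Sum>j\<in>UNIV. dir_deriv (space_dir j) \<phi> y * energy_flux j y))"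
    unfolding tgt_def by (simp add: mult.commute)
  have tgt_int: "set_integrable lborel strip tgt"
    unfolding tgt_alt by (intro set_integral_add(1) set_integral_sum_strip(2)
        admissible_pairing_integrable[OF _ tf] admissible_energy_density admissible_energy_flux)
  define Kw where "Kw = (emeasure lborel (spacetime T :: (real \<times> (real ^ 'd)) set) + 2)
      + emeasure lborel (cball (0 :: real \<times> (real ^ 'd)) 1) * (emeasure lborel (spacetime T :: (real \<times> (real ^ 'd)) set) + 3)"
  have Kw: "Kw < \<infinity>" unfolding Kw_def
    using spacetime_finite emeasure_bounded_finite[OF bounded_cball, of "0 :: real \<times> (real ^ 'd)" 1]
    by (simp add: ennreal_mult_less_top)
  have CC: "0 < CC" unfolding CC_def using constants(3) by (intro mult_pos_pos zero_less_power) (auto intro: add_pos_nonneg)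
  define \<epsilon>0 where "\<epsilon>0 = min 1 (min a0 (T - b0))"
  have \<epsilon>0: "0 < \<epsilon>0" unfolding \<epsilon>0_def using ab by auto
  have est: "\<bar>LBINT y:strip. tgt y\<bar> \<le> S * CC * \<epsilon> powr \<kappa> * enn2real Kw" if \<epsilon>': "0 < \<epsilon>" "\<epsilon> < \<epsilon>0" for \<epsilon>
  proof -
    have \<epsilon>: "0 < \<epsilon>" "\<epsilon> \<le> 1" "\<epsilon> < a0" "b0 + \<epsilon> < T" using \<epsilon>' unfolding \<epsilon>0_def by auto
    \<comment> \<open>The truncation level \<open>\<epsilon> powr \<beta>\<close> equals the size of the density increments at scale \<open>\<epsilon>\<close>; it
       balances the two errors that the truncation introduces.\<close>
    have \<delta>: "0 < \<epsilon> powr \<beta>" "\<epsilon> powr \<beta> \<le> 1" using \<epsilon> \<beta> by (auto intro!: powr_le1)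
    from p_reg[OF \<delta>] obtain k A qq where kc: "continuous_on UNIV k" and "\<forall>s. (A has_real_derivative k s) (at s)"
      and "\<forall>s. (qq has_real_derivative s * k s) (at s)"
      and "\<forall>s\<in>{lo..hi}. \<bar>k s\<bar> \<le> C * (\<epsilon> powr \<beta>) powr (\<gamma> - 2) \<and> \<bar>A s\<bar> \<le> C \<and>
        \<bar>qq s - p s\<bar> \<le> C * (\<epsilon> powr \<beta>) powr \<gamma> \<and> \<bar>s * A s - qq s - P0 s\<bar> \<le> C * \<epsilon> powr \<beta>"
      by blast
    then have Ad: "\<And>s. (A has_real_derivative k s) (at s)"
      and qd: "\<And>s. (qq has_real_derivative s * k s) (at s)"
      and kA: "\<And>s. s \<in> {lo..hi} \<Longrightarrow> \<bar>k s\<bar> \<le> C * (\<epsilon> powr \<beta>) powr (\<gamma> - 2) \<and> \<bar>A s\<bar> \<le> C \<and>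
        \<bar>qq s - p s\<bar> \<le> C * (\<epsilon> powr \<beta>) powr \<gamma> \<and> \<bar>s * A s - qq s - P0 s\<bar> \<le> C * \<epsilon> powr \<beta>"
      by blast+
    define F0 where "F0 y = (\<Sum>i\<in>UNIV. Mm \<epsilon> i y * Um \<epsilon> i y) - Rm \<epsilon> y * (\<Sum>i\<in>UNIV. Um \<epsilon> i y * Um \<epsilon> i y) / 2
        + (Rm \<epsilon> y * A (Rm \<epsilon> y) - qq (Rm \<epsilon> y))" for y
    define F where "F j y = (\<Sum>i\<in>UNIV. Qm \<epsilon> i j y * Um \<epsilon> i y) + Pm \<epsilon> y * Um \<epsilon> j y
        - Mm \<epsilon> j y * (\<Sum>i\<in>UNIV. Um \<epsilon> i y * Um \<epsilon> i y) / 2 + Mm \<epsilon> j y * A (Rm \<epsilon> y) - qq (Rm \<epsilon> y) * Um \<epsilon> j y" for j y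
    define G where "G y = (\<Sum>i\<in>UNIV. (Mm \<epsilon> i y - Rm \<epsilon> y * Um \<epsilon> i y) * dir_deriv time_dir (Um \<epsilon> i) y)
      + (\<Sum>i\<in>UNIV. \<Sum>j\<in>UNIV. (Qm \<epsilon> i j y - Mm \<epsilon> j y * Um \<epsilon> i y) * dir_deriv (space_dir j) (Um \<epsilon> i) y)
      + (\<Sum>i\<in>UNIV. dir_deriv (space_dir i) (Um \<epsilon> i) y) * (Pm \<epsilon> y - qq (Rm \<epsilon> y))
      + k (Rm \<epsilon> y) * (\<Sum>j\<in>UNIV. (Mm \<epsilon> j y - Rm \<epsilon> y * Um \<epsilon> j y) * dir_deriv (space_dir j) (Rm \<epsilon>) y)" for y
    define Z where "Z y = dir_deriv time_dir \<phi> y * F0 y + (\<Sum>j\<in>UNIV. dir_deriv (space_dir j) \<phi> y * F j y) + \<phi> y * G y" for y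
    have sm: "C1 (mol \<eta> \<epsilon> f)" "space_periodic (mol \<eta> \<epsilon> f)" if "admissible f" for f
      using smooth_C1[OF mol_smooth[OF \<eta> admissibleD(4)[OF that] \<epsilon>(1)]] space_periodic_mol[OF admissibleD(2)[OF that]] by auto
    note smc = C1_continuous[OF sm(1)]
    have Z0: "(LBINT y:strip. Z y) = 0"
      unfolding Z_def F0_def F_def G_def
      by (rule energy_balance[OF sm[OF admissible_\<rho>] sm[OF admissible_u] smc[OF admissible_m] sm(2)[OF admissible_m]
            smc[OF admissible_mu] sm(2)[OF admissible_mu] smc[OF admissible_on_range[OF p_lip]]
            sm(2)[OF admissible_on_range[OF p_lip]] tf mollified_mass[OF _ \<epsilon>(1,3,4)] mollified_momentum[OF _ \<epsilon>(1,3,4)] Ad qd kc])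
    have Ac: "continuous_on UNIV A" "continuous_on UNIV qq"
      using DERIV_isCont[OF Ad] DERIV_isCont[OF qd] by (auto intro: continuous_at_imp_continuous_on)
    have cc: "continuous_on UNIV (\<lambda>y. A (Rm \<epsilon> y))" "continuous_on UNIV (\<lambda>y. qq (Rm \<epsilon> y))" "continuous_on UNIV (\<lambda>y. k (Rm \<epsilon> y))"
      by (rule continuous_on_compose2[OF _ smc[OF admissible_\<rho>]], rule Ac kc, simp)+
    have pc: "space_periodic (\<lambda>y. A (Rm \<epsilon> y))" "space_periodic (\<lambda>y. qq (Rm \<epsilon> y))" "space_periodic (\<lambda>y. k (Rm \<epsilon> y))"
      using sm(2)[OF admissible_\<rho>] by (auto simp: space_periodic_def)
    note cts = smc[OF admissible_\<rho>] smc[OF admissible_u] smc[OF admissible_m] smc[OF admissible_mu]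
      smc[OF admissible_on_range[OF p_lip]] cc C1_dir_deriv_continuous[OF sm(1)[OF admissible_\<rho>]] C1_dir_deriv_continuous[OF sm(1)[OF admissible_u]]
    have dp: "space_periodic (dir_deriv v (Rm \<epsilon>))" "space_periodic (dir_deriv v (Um \<epsilon> i))" for v i
      by (rule space_periodic_dir_deriv[OF sm[OF admissible_\<rho>]], rule space_periodic_dir_deriv[OF sm[OF admissible_u]])
    note pers = sm(2)[OF admissible_\<rho>] sm(2)[OF admissible_u] sm(2)[OF admissible_m] sm(2)[OF admissible_mu]
      sm(2)[OF admissible_on_range[OF p_lip]] pc dp
    have FF: "continuous_on UNIV F0" "continuous_on UNIV (F j)" "continuous_on UNIV G" for j
      unfolding F0_def F_def G_def by (intro continuous_intros cts; simp)+
    have PF: "space_periodic F0" "space_periodic (F j)" "space_periodic G" for j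
      using pers unfolding F0_def F_def G_def space_periodic_def by simp_all
    have t1: "tame a0 b0 (\<lambda>y. dir_deriv v \<phi> y * f y)" if "continuous_on UNIV f" "space_periodic f" for v f
      using tame_mult[OF that tame_dir_deriv[OF tf, of v]] by (simp add: mult.commute)
    have t2: "tame a0 b0 (\<lambda>y. \<phi> y * f y)" if "continuous_on UNIV f" "space_periodic f" for f
      using tame_mult[OF that, of a0 b0 \<phi>] \<phi>c unfolding tame_def by (simp add: mult.commute)
    have "tame a0 b0 Z" unfolding Z_def by (intro tame_add tame_sum t1 t2 FF PF)
    then have Zi: "set_integrable lborel strip Z" by (rule tame_integrable)
    define c where "c = S * CC * \<epsilon> powr \<kappa>"
    have c: "0 < c" unfolding c_def using S CC \<epsilon> by simp
    have pt: "ennreal (norm (indicator strip y *\<^sub>R (tgt y - Z y))) \<le> ennreal c * (indicator ({a0..b0} \<times> cell) y * weight \<epsilon> y)" for y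
    proof (cases "y \<in> {a0..b0} \<times> cell")
      case False
      have "y \<notin> strip \<or> (\<phi> y = 0 \<and> (\<forall>v. dir_deriv v \<phi> y = 0))"
      proof (rule disjCI)
        assume "\<not> (\<phi> y = 0 \<and> (\<forall>v. dir_deriv v \<phi> y = 0))"
        then have "a0 \<le> fst y \<and> fst y \<le> b0"
          using time_suppD[OF \<phi>c(3)] time_suppD[OF time_supp_dir_deriv[OF \<phi>c(3)]] by blast
        then show "y \<notin> strip" using False unfolding strip_def by (cases y) auto
      qed
      then have "indicator strip y *\<^sub>R (tgt y - Z y) = 0"
      proof
        assume z: "\<phi> y = 0 \<and> (\<forall>v. dir_deriv v \<phi> y = 0)"
        then have "dir_deriv v \<phi> y = 0" for v by blast
        then have "tgt y = 0" "Z y = 0" using z unfolding tgt_def Z_def by (simp_all only: mult_zero_right mult_zero_left sum.neutral_const add_0_left)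
        then show ?thesis by simp
      qed simp
      then have "ennreal (norm (indicator strip y *\<^sub>R (tgt y - Z y))) = 0" by (metis norm_zero ennreal_0)
      then show ?thesis by (metis zero_le)
    next
      case True
      then have y: "\<epsilon> < fst y" "fst y + \<epsilon> < T" "0 < fst y" "fst y < T" using \<epsilon> ab by (cases y; auto)+
      show ?thesis
      proof (cases "weight \<epsilon> y = \<infinity>")
        case True
        then show ?thesis using \<open>y \<in> {a0..b0} \<times> cell\<close> c by (simp add: ennreal_mult_top)
      next
        case False
        define h where "h = enn2real (weight \<epsilon> y)"
        have h1: "1 \<le> h" unfolding h_def
          by (rule size_bounds(1)[of y, OF _ False]) (simp add: weight_def add_increasing2)
        have ed: "energy_density y = \<rho> y * (\<Sum>i\<in>UNIV. u y $ i * u y $ i) / 2 + P0 (\<rho> y)"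
          unfolding energy_density_def on_range_eq[OF y(3,4)] by (simp add: sum_distrib_left mult_ac)
        have ef: "energy_flux j y = (\<rho> y * (\<Sum>i\<in>UNIV. u y $ i * u y $ i) / 2 + p (\<rho> y) + P0 (\<rho> y)) * u y $ j" for j
          unfolding energy_flux_def on_range_eq[OF y(3,4)] by (simp add: sum_distrib_left mult_ac)
        note gp = good_point_bounds[OF \<epsilon>(1,2) y(1,2) False kA, folded h_def]
        define e where "e = CC * \<epsilon> powr \<kappa> * h"
        have e: "0 \<le> e" unfolding e_def using CC h1 by simp
        have eq: "CC * (\<epsilon> powr \<kappa> * h powr 1) = e" unfolding e_def using h1 by simp
        have b1: "\<bar>F0 y - energy_density y\<bar> \<le> e" using gp(1) unfolding bd_def eq F0_def ed .
        have b2: "\<bar>F j y - energy_flux j y\<bar> \<le> e" for j using gp(2)[of j] unfolding bd_def eq F_def ef .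
        have b3: "\<bar>G y\<bar> \<le> e" using gp(3) unfolding bd_def eq G_def .
        have diff: "tgt y - Z y = - (dir_deriv time_dir \<phi> y * (F0 y - energy_density y)
            + (\<Sum>j\<in>UNIV. dir_deriv (space_dir j) \<phi> y * (F j y - energy_flux j y)) + \<phi> y * G y)"
          unfolding tgt_alt Z_def by (simp add: right_diff_distrib sum_subtractf)
        have "\<bar>tgt y - Z y\<bar> \<le> \<bar>dir_deriv time_dir \<phi> y * (F0 y - energy_density y)\<bar>
            + \<bar>\<Sum>j\<in>UNIV. dir_deriv (space_dir j) \<phi> y * (F j y - energy_flux j y)\<bar> + \<bar>\<phi> y * G y\<bar>"
          unfolding diff abs_minus_cancel
          by (rule order_trans[OF abs_triangle_ineq add_right_mono[OF abs_triangle_ineq]])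
        also have "\<dots> \<le> S1 * e + (\<Sum>j\<in>UNIV. S2 j * e) + S0 * e"
        proof -
          have "\<bar>dir_deriv time_dir \<phi> y * (F0 y - energy_density y)\<bar> \<le> S1 * e"
            unfolding abs_mult by (rule mult_mono[OF S1(2) b1 S1(1) abs_ge_zero])
          moreover have "\<bar>\<phi> y * G y\<bar> \<le> S0 * e"
            unfolding abs_mult by (rule mult_mono[OF S0(2) b3 S0(1) abs_ge_zero])
          moreover have "\<bar>\<Sum>j\<in>UNIV. dir_deriv (space_dir j) \<phi> y * (F j y - energy_flux j y)\<bar> \<le> (\<Sum>j\<in>UNIV. S2 j * e)"
          proof (rule order_trans[OF sum_abs], rule sum_mono)
            show "\<bar>dir_deriv (space_dir j) \<phi> y * (F j y - energy_flux j y)\<bar> \<le> S2 j * e" for j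
              unfolding abs_mult by (rule mult_mono[OF S2(2) b2 S2(1) abs_ge_zero])
          qed
          ultimately show ?thesis by (intro add_mono)
        qed
        also have "\<dots> \<le> S * e" unfolding S_def sum_distrib_right[symmetric] using e by (simp add: algebra_simps)
        finally have "\<bar>tgt y - Z y\<bar> \<le> c * h" unfolding e_def c_def by (simp add: mult_ac)
        then have "ennreal (norm (indicator strip y *\<^sub>R (tgt y - Z y))) \<le> ennreal (c * h)"
          using c h1 by (intro ennreal_leI) (auto simp: indicator_def)
        also have "\<dots> = ennreal c * weight \<epsilon> y"
          unfolding h_def using c False by (simp add: ennreal_mult less_top)
        finally show ?thesis using \<open>y \<in> {a0..b0} \<times> cell\<close> by simp
      qed
    qed
    have di: "integrable lborel (\<lambda>y. indicator strip y *\<^sub>R (tgt y - Z y))"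
      using set_integral_diff(1)[OF tgt_int Zi] unfolding set_integrable_def .
    have "ennreal \<bar>LBINT y:strip. tgt y\<bar> = ennreal (norm (LINT y|lborel. indicator strip y *\<^sub>R (tgt y - Z y)))"
      using set_integral_diff(2)[OF tgt_int Zi] Z0 unfolding set_lebesgue_integral_def by simp
    also have "\<dots> \<le> (\<integral>\<^sup>+y. ennreal (norm (indicator strip y *\<^sub>R (tgt y - Z y))) \<partial>lborel)"
      by (rule integral_norm_bound_ennreal[OF di])
    also have "\<dots> \<le> (\<integral>\<^sup>+y. ennreal c * (indicator ({a0..b0} \<times> cell) y * weight \<epsilon> y) \<partial>lborel)"
      by (rule nn_integral_mono[OF pt])
    also have "\<dots> = ennreal c * (\<integral>\<^sup>+y. indicator ({a0..b0} \<times> cell) y * weight \<epsilon> y \<partial>lborel)"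
      by (rule nn_integral_cmult) measurable
    also have "\<dots> \<le> ennreal c * Kw"
      unfolding Kw_def by (intro mult_left_mono weight_integral \<epsilon>) auto
    also have "\<dots> = ennreal (c * enn2real Kw)" using c Kw by (simp add: ennreal_mult)
    finally show ?thesis using c unfolding c_def by (simp add: ennreal_le_iff)
  qed
  have "((\<lambda>\<epsilon>. S * CC * \<epsilon> powr \<kappa> * enn2real Kw) \<longlongrightarrow> S * CC * 0 powr \<kappa> * enn2real Kw) (at_right 0)"
    using \<kappa>_pos by (intro tendsto_intros tendsto_powr2) (auto simp: eventually_at_filter)
  then have "((\<lambda>\<epsilon>. S * CC * \<epsilon> powr \<kappa> * enn2real Kw) \<longlongrightarrow> 0) (at_right 0)" by simp
  then have "\<bar>LBINT y:strip. tgt y\<bar> \<le> 0"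
  proof (rule tendsto_lowerbound)
    show "\<forall>\<^sub>F \<epsilon> in at_right 0. \<bar>LBINT y:strip. tgt y\<bar> \<le> S * CC * \<epsilon> powr \<kappa> * enn2real Kw"
      unfolding eventually_at_right_field using \<epsilon>0 est by (intro exI[of _ \<epsilon>0]) auto
  qed simp
  then show ?thesis unfolding tgt_def by simp
qed

end

section \<open>Borel representatives\<close>

lemma AE_lborel_translate:
  fixes P :: "'a::euclidean_space \<Rightarrow> bool"
  assumes "AE y in lborel. P y" shows "AE y in lborel. P (y + c)"
proof -
  have "AE y in distr lborel borel ((+) c). P y" using assms unfolding lborel_distr_plus .
  from AE_distrD[OF _ this] show ?thesis by (simp add: add.commute)
qed

text \<open>
  The exceptional set outside the fundamental cell is a countable union of lattice translates.
\<close>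
lemma AE_periodic:
  fixes P :: "real \<times> (real ^ 'd) \<Rightarrow> bool"
  assumes per: "space_periodic P" and ae: "AE y in lborel. y \<in> spacetime T \<longrightarrow> P y"
  shows "AE y in lborel. 0 < fst y \<and> fst y < T \<longrightarrow> P y"
proof -
  have "AE y in lborel. y - lattice_vec k \<in> spacetime T \<longrightarrow> P (y - lattice_vec k)" for k
    using AE_lborel_translate[OF ae, of "- lattice_vec k"] by simp
  then have "AE y in lborel. \<forall>k. y - lattice_vec k \<in> spacetime T \<longrightarrow> P (y - lattice_vec k)"
    by (simp add: AE_all_countable)
  then show ?thesis
  proof eventually_elim
    case (elim y)
    show ?case
    proof
      assume t: "0 < fst y \<and> fst y < T"
      obtain k where k: "y - lattice_vec k \<in> strip" using lattice_translate_into_strip by blast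
      then have "y - lattice_vec k \<in> spacetime T"
        using t unfolding strip_def spacetime_def lattice_vec_def by (cases y) auto
      then have "P (y - lattice_vec k)" using elim by blast
      then show "P y" using space_periodic_lattice[OF per, of "y - lattice_vec k" k] by simp
    qed
  qed
qed

lemma vec_lambda_axis: "(\<chi> i. f i) = (\<Sum>i\<in>UNIV. f i *\<^sub>R axis i (1 :: real))"
  by (simp add: vec_eq_iff axis_def if_distrib cong: if_cong)

lemma borel_measurable_vec_lambda[measurable]:
  "(\<And>i. f i \<in> borel_measurable M) \<Longrightarrow> (\<lambda>y. (\<chi> i. f i y) :: real ^ 'n) \<in> borel_measurable M"
  unfolding vec_lambda_axis by (intro borel_measurable_sum borel_measurable_scaleR borel_measurable_const)

text \<open>
  A Borel representative on the cell, composed with the Borel projection onto the cell by fractional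
  parts.
\<close>
lemma periodic_borel_representative:
  fixes w :: "real \<times> (real ^ 'd) \<Rightarrow> real"
  assumes per: "space_periodic w" and w: "w \<in> borel_measurable (lebesgue_on (spacetime T))"
  shows "\<exists>w0. w0 \<in> borel_measurable borel \<and> space_periodic w0 \<and> (AE y in lborel. 0 < fst y \<and> fst y < T \<longrightarrow> w y = w0 y)"
proof -
  have "(\<lambda>y. indicator (spacetime T) y *\<^sub>R w y) \<in> borel_measurable lebesgue"
    using w by (subst (asm) borel_measurable_restrict_space_iff) auto
  then obtain g where g[measurable]: "g \<in> borel_measurable borel" and ae: "AE y in lborel. indicator (spacetime T) y *\<^sub>R w y = g y"
    using completion_ex_borel_measurable_real[of "\<lambda>y. indicator (spacetime T) y *\<^sub>R w y" lborel] by auto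
  define fr where "fr y = (fst y, \<chi> i. frac (snd y $ i))" for y :: "real \<times> (real ^ 'd)"
  have fr_borel[measurable]: "fr \<in> borel_measurable borel"
  proof -
    have c: "(\<lambda>y :: real \<times> (real ^ 'd). snd y $ i) \<in> borel_measurable borel" for i
      by (intro borel_measurable_continuous_onI continuous_intros)
    have f: "(\<lambda>y :: real \<times> (real ^ 'd). fst y) \<in> borel_measurable borel"
      by (intro borel_measurable_continuous_onI continuous_intros)
    have "(\<lambda>y :: real \<times> (real ^ 'd). snd y $ i - real_of_int \<lfloor>snd y $ i\<rfloor>) \<in> borel_measurable borel" for i
      using c[of i] by measurable
    then show ?thesis unfolding fr_def[abs_def] frac_def using f by (intro borel_measurable_Pair borel_measurable_vec_lambda)
  qed
  have fr_lat: "fr y = y - lattice_vec (\<chi> i. \<lfloor>snd y $ i\<rfloor>)" for y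
    unfolding fr_def lattice_vec_def by (cases y) (simp add: vec_eq_iff frac_def)
  have fr_per: "fr (t, x + axis i 1) = fr (t, x)" for t x i
    unfolding fr_def by (auto simp: vec_eq_iff axis_def frac_def)
  have fr_id: "fr y = y" if "y \<in> spacetime T" for y
    using that unfolding fr_def spacetime_def cell_def by (cases y) (auto simp: vec_eq_iff frac_eq)
  show ?thesis
  proof (intro exI[of _ "\<lambda>y. g (fr y)"] conjI)
    show "(\<lambda>y. g (fr y)) \<in> borel_measurable borel" by measurable
    show p: "space_periodic (\<lambda>y. g (fr y))" unfolding space_periodic_def fr_per by simp
    show "AE y in lborel. 0 < fst y \<and> fst y < T \<longrightarrow> w y = g (fr y)"
    proof (rule AE_periodic)
      show "space_periodic (\<lambda>y. w y = g (fr y))" using per p unfolding space_periodic_def by simp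
      show "AE y in lborel. y \<in> spacetime T \<longrightarrow> w y = g (fr y)"
        using ae by eventually_elim (auto simp: fr_id)
    qed
  qed
qed

lemma
  fixes X Y :: "'a::euclidean_space \<Rightarrow> 'b::euclidean_space"
  assumes A[measurable]: "A \<in> sets borel" and Y[measurable]: "Y \<in> borel_measurable borel"
    and ae: "AE y in lborel. y \<in> A \<longrightarrow> X y = Y y"
  shows set_integrable_representative: "set_integrable lebesgue A X \<longleftrightarrow> set_integrable lborel A Y"
    and set_integral_representative: "set_lebesgue_integral lebesgue A X = set_lebesgue_integral lborel A Y"
proof -
  have gm: "(\<lambda>y. indicator A y *\<^sub>R Y y) \<in> borel_measurable lborel" by measurable
  then have gl: "(\<lambda>y. indicator A y *\<^sub>R Y y) \<in> borel_measurable lebesgue" by (rule measurable_completion)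
  have "AE y in lborel. indicator A y *\<^sub>R Y y = indicator A y *\<^sub>R X y"
    using ae by eventually_elim (auto simp: indicator_def)
  then have ael: "AE y in lebesgue. indicator A y *\<^sub>R Y y = indicator A y *\<^sub>R X y" by (rule AE_completion)
  have fl: "(\<lambda>y. indicator A y *\<^sub>R X y) \<in> borel_measurable lebesgue" by (rule borel_measurable_AE[OF gl ael])
  show "set_integrable lebesgue A X \<longleftrightarrow> set_integrable lborel A Y"
    unfolding set_integrable_def using integrable_cong_AE[OF gl fl ael] integrable_completion[OF gm] by simp
  show "set_lebesgue_integral lebesgue A X = set_lebesgue_integral lborel A Y"
    unfolding set_lebesgue_integral_def using integral_cong_AE[OF gl fl ael] integral_completion[OF gm] by simp
qed

lemma AE_lebesgue_on_lborel:
  assumes "A \<in> sets borel" "AE y in lborel. y \<in> A \<longrightarrow> P y" shows "AE y in lebesgue_on A. P y"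
  using AE_completion[OF assms(2)] assms(1) by (subst AE_restrict_space_iff) auto

lemma spacetime_positive: assumes "0 < T" shows "emeasure lborel (spacetime T :: (real \<times> (real ^ 'd)) set) \<noteq> 0"
proof -
  define l h where "l = (T / 3, 0 :: real ^ 'd)" and "h = (T / 2, (\<chi> i. 1 / 2) :: real ^ 'd)"
  have "cbox l h \<subseteq> spacetime T"
    unfolding spacetime_def l_def h_def cbox_Pair_eq cell_def using assms
    by (auto simp: mem_box_cart intro: le_less_trans[where y="1 / 2"])
  then have "emeasure lborel (cbox l h) \<le> emeasure lborel (spacetime T :: (real \<times> (real ^ 'd)) set)" by (intro emeasure_mono) auto
  moreover have "emeasure lborel (cbox l h) \<noteq> 0"
  proof -
    have "0 < measure lborel (cbox l h)"
      by (rule content_pos_lt) (use assms in \<open>auto simp: l_def h_def Basis_prod_def Basis_vec_def inner_axis\<close>)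
    then show ?thesis by (auto simp: measure_def)
  qed
  ultimately show ?thesis by auto
qed

lemma reciprocal_exponent:
  assumes "2 \<le> q" shows "(1 :: ennreal) / q = ennreal (1 / enn2real q)" "(2 :: ennreal) / q = ennreal (2 * (1 / enn2real q))"
proof -
  have "(1 :: ennreal) / q = ennreal (1 / enn2real q) \<and> (2 :: ennreal) / q = ennreal (2 * (1 / enn2real q))"
  proof (cases "q = \<infinity>")
    case False
    then have x: "2 \<le> enn2real q" "q = ennreal (enn2real q)" using enn2real_pos_of_ge_2 assms by (auto simp: less_top)
    have "ennreal c / ennreal (enn2real q) = ennreal (c / enn2real q)" if "0 \<le> c" for c
      using x that by (intro divide_ennreal) auto
    from this[of 1] this[of 2] show ?thesis using x(2) by (simp add: ennreal_numeral[symmetric] del: ennreal_numeral)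
  qed auto
  then show "(1 :: ennreal) / q = ennreal (1 / enn2real q)" "(2 :: ennreal) / q = ennreal (2 * (1 / enn2real q))" by auto
qed

lemma exponent_condition:
  assumes "2 \<le> r" "2 \<le> q" "(1 :: ennreal) / r + 2 / q \<le> 1"
  shows "1 / enn2real r + 2 * (1 / enn2real q) \<le> 1"
proof -
  have "ennreal (1 / enn2real r + 2 * (1 / enn2real q)) \<le> ennreal 1"
    using assms(3) unfolding reciprocal_exponent[OF assms(1)] reciprocal_exponent[OF assms(2)] by (simp add: ennreal_plus)
  then show ?thesis by (subst (asm) ennreal_le_iff) auto
qed

lemma dt_grad: "dt \<phi> y = dir_deriv time_dir \<phi> y" "grad \<phi> y $ j = dir_deriv (space_dir j) \<phi> y"
  unfolding dt_def grad_def dir_deriv_def time_dir_def space_dir_def by simp_all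

lemma weak_form_representative:
  fixes f f0 \<phi> :: "real \<times> (real ^ 'd) \<Rightarrow> real" and F F0 :: "real \<times> (real ^ 'd) \<Rightarrow> real ^ 'd"
  assumes ae: "AE y in lborel. 0 < fst y \<and> fst y < T \<longrightarrow> f y = f0 y \<and> F y = F0 y"
    and [measurable]: "f0 \<in> borel_measurable borel" "F0 \<in> borel_measurable borel"
    and \<phi>: "\<phi> \<in> test_functions T"
  shows "set_lebesgue_integral lebesgue (spacetime T) (\<lambda>y. f y * dt \<phi> y + F y \<bullet> grad \<phi> y)
    = (LBINT y:strip. f0 y * dir_deriv time_dir \<phi> y + (\<Sum>j\<in>UNIV. F0 y $ j * dir_deriv (space_dir j) \<phi> y))"
proof -
  have s: "smooth \<phi>" and supp: "\<exists>a b. 0 < a \<and> b < T \<and> time_supp a b \<phi>"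
    using \<phi> unfolding test_functions_def time_supp_def by auto
  have [measurable]: "dir_deriv v \<phi> \<in> borel_measurable borel" for v
    by (rule borel_measurable_continuous_onI[OF C1_dir_deriv_continuous[OF smooth_C1[OF s]]])
  define Y where "Y y = f0 y * dir_deriv time_dir \<phi> y + (\<Sum>j\<in>UNIV. F0 y $ j * dir_deriv (space_dir j) \<phi> y)" for y
  have comp: "(\<lambda>y. F0 y $ j) \<in> borel_measurable borel" for j by measurable
  have Ym: "Y \<in> borel_measurable borel" unfolding Y_def by measurable
  have eq: "f0 y * dt \<phi> y + F0 y \<bullet> grad \<phi> y = Y y" for y
    unfolding Y_def inner_vec_def by (simp add: dt_grad)
  have "AE y in lborel. y \<in> spacetime T \<longrightarrow> f y * dt \<phi> y + F y \<bullet> grad \<phi> y = Y y"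
    using ae by eventually_elim (auto simp: spacetime_def eq)
  from set_integral_representative[OF spacetime_in_borel Ym this]
  have "set_lebesgue_integral lebesgue (spacetime T) (\<lambda>y. f y * dt \<phi> y + F y \<bullet> grad \<phi> y) = (LBINT y:spacetime T. Y y)" .
  also have "\<dots> = (LBINT y:strip. Y y)"
  proof -
    obtain a b where ab: "0 < a" "b < T" "time_supp a b \<phi>" using supp by blast
    have "indicator (spacetime T) y *\<^sub>R Y y = indicator strip y *\<^sub>R Y y" for y :: "real \<times> (real ^ 'd)"
    proof (cases "0 < fst y \<and> fst y < T")
      case True
      then have "y \<in> spacetime T \<longleftrightarrow> y \<in> strip" unfolding spacetime_def strip_def by (cases y) auto
      then show ?thesis by (simp add: indicator_def)
    next
      case False
      then have "dir_deriv v \<phi> y = 0" for v using time_suppD[OF time_supp_dir_deriv[OF ab(3)]] ab by (smt (verit))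
      then have "Y y = 0" unfolding Y_def by (simp only: mult_zero_right sum.neutral_const add_0_left)
      then show ?thesis by simp
    qed
    then have "(\<lambda>y. indicator (spacetime T) y *\<^sub>R Y y) = (\<lambda>y. indicator strip y *\<^sub>R Y y)" by (rule ext)
    then show ?thesis unfolding set_lebesgue_integral_def by (rule arg_cong)
  qed
  finally show ?thesis unfolding Y_def .
qed


lemma (in mollification) admissible_slab_integrable:
  assumes "admissible f" shows "set_integrable lborel ({a..b} \<times> cell) f"
  by (rule set_integrable_subset[OF admissibleD(3)[OF assms]]) (auto simp: strip_def)

lemma set_integrable_vector:
  fixes F :: "'a::euclidean_space \<Rightarrow> real ^ 'n"
  assumes "\<And>j. set_integrable lborel A (\<lambda>y. F y $ j)"
  shows "set_integrable lborel A F"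
proof -
  have "integrable lborel (\<lambda>y. \<Sum>j\<in>UNIV. (indicator A y *\<^sub>R F y $ j) *\<^sub>R axis j (1 :: real))"
    using assms unfolding set_integrable_def by (intro Bochner_Integration.integrable_sum integrable_scaleR_left) auto
  moreover have "(\<Sum>j\<in>UNIV. (indicator A y *\<^sub>R F y $ j) *\<^sub>R axis j (1 :: real)) = indicator A y *\<^sub>R F y" for y
    using vec_lambda_axis[of "\<lambda>j. indicator A y *\<^sub>R F y $ j", symmetric] by (simp add: vec_eq_iff)
  ultimately show ?thesis unfolding set_integrable_def by simp
qed

text \<open>
  Passage to the Borel representatives \<open>\<rho>0\<close> and \<open>u0\<close>, for which the local energy balance is available;
  the multiple \<open>c\<close> of the density in the potential is handled by the mass equation.
\<close>
theorem theorem4p1: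
  fixes T \<gamma> \<alpha> \<beta> \<rho>_lo \<rho>_hi :: real
    and r q :: ennreal
    and \<rho> :: "real \<times> (real ^ 'd) \<Rightarrow> real"
    and u :: "real \<times> (real ^ 'd) \<Rightarrow> real ^ 'd"
    and p :: "real \<Rightarrow> real"
    and \<eta> :: "real \<times> (real ^ 'd) \<Rightarrow> real"
  assumes "0 < T"
    and "1 < \<gamma>" "\<gamma> < 2"
    and "isentropic_euler T p \<rho> u"
    and "u \<in> besov_space T \<alpha> r"
    and "\<rho> \<in> besov_space T \<beta> q"
    and "(\<lambda>y. \<rho> y *\<^sub>R u y) \<in> besov_space T \<beta> q"
    and "0 \<le> \<rho>_lo"
    and "AE y in lebesgue_on (spacetime T). \<rho>_lo \<le> \<rho> y \<and> \<rho> y \<le> \<rho>_hi"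
    and "0 \<le> \<alpha>" "\<alpha> \<le> 1" "0 \<le> \<beta>" "\<beta> \<le> 1"
    and "1 / r + 2 / q \<le> 1"
    and "2 / r + 1 / q \<le> 1"
    and "2 \<le> r" "2 \<le> q"
    and "\<alpha> + \<gamma> * \<beta> > 1"
    and "2 * \<alpha> + \<beta> > 1"
    and "mollifier \<eta>"
    and "\<exists>C \<epsilon>0. 0 < \<epsilon>0 \<and> (\<forall>\<epsilon>. 0 < \<epsilon> \<and> \<epsilon> < \<epsilon>0 \<longrightarrow>
           Lq_norm q (near_vacuum T \<eta> \<epsilon> \<beta> \<rho>)
             (\<lambda>y. (mollify \<eta> \<epsilon> \<rho> y - \<rho> y) / mollify \<eta> \<epsilon> \<rho> y) \<le> ennreal C)"
    and "C1_holder_on (\<gamma> - 1) {\<rho>_lo..\<rho>_hi} p"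
    and "\<rho>_lo = 0 \<Longrightarrow> (p has_real_derivative 0) (at_right 0)"
    and "potential_defined_on p \<rho>_lo \<rho>_hi"
  shows "distributional_conservation_law T
           (\<lambda>y. \<rho> y * (norm (u y))\<^sup>2 / 2 + pressure_potential p (\<rho> y))
           (\<lambda>y. (\<rho> y * (norm (u y))\<^sup>2 / 2 + p (\<rho> y) + pressure_potential p (\<rho> y)) *\<^sub>R u y)"
proof -
  note T = assms(1) and \<gamma> = assms(2,3) and euler = assms(4) and u_bes = assms(5) and \<rho>_bes = assms(6) and m_bes = assms(7)
  define lo hi where "lo = \<rho>_lo" and "hi = \<rho>_hi"
  have per: "space_periodic u" "space_periodic \<rho>"
    using u_bes \<rho>_bes unfolding besov_space_def by auto
  have meas: "u \<in> borel_measurable (lebesgue_on (spacetime T))" "\<rho> \<in> borel_measurable (lebesgue_on (spacetime T))"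
    using u_bes \<rho>_bes unfolding besov_space_def by auto
  have range_st: "AE y in lborel. y \<in> spacetime T \<longrightarrow> \<rho> y \<in> {lo..hi}"
    using assms(9) unfolding lo_def hi_def by (subst (asm) AE_restrict_space_iff) (auto simp: AE_completion_iff)
  have lohi: "0 \<le> lo" "lo \<le> hi"
  proof -
    show "0 \<le> lo" using assms(8) unfolding lo_def .
    show "lo \<le> hi"
    proof (rule ccontr)
      assume neg: "\<not> lo \<le> hi"
      have "AE y in lborel. y \<notin> (spacetime T :: (real \<times> (real ^ 'd)) set)"
        using range_st by eventually_elim (use neg in auto)
      then have "emeasure lborel (spacetime T :: (real \<times> (real ^ 'd)) set) = 0"
        by (subst (asm) AE_iff_measurable[OF _ refl]) auto
      then show False using spacetime_positive[OF T] by blast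
    qed
  qed
  have range_w: "AE y in lborel. 0 < fst y \<and> fst y < T \<longrightarrow> \<rho> y \<in> {lo..hi}"
    by (rule AE_periodic[OF _ range_st]) (use per in \<open>simp add: space_periodic_def\<close>)
  \<comment> \<open>The representatives vanish outside \<open>(0,T)\<close>, so that their mollifications are defined everywhere.\<close>
  define W where "W = {y :: real \<times> (real ^ 'd). 0 < fst y \<and> fst y < T}"
  have Wb[measurable]: "W \<in> sets borel"
    unfolding W_def by (intro borel_open open_Collect_conj open_Collect_less continuous_intros)
  obtain \<rho>1 where \<rho>1[measurable]: "\<rho>1 \<in> borel_measurable borel" and \<rho>1p: "space_periodic \<rho>1"
    and \<rho>1ae: "AE y in lborel. 0 < fst y \<and> fst y < T \<longrightarrow> \<rho> y = \<rho>1 y"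
    using periodic_borel_representative[OF per(2) meas(2)] by blast
  have "\<exists>v. v \<in> borel_measurable borel \<and> space_periodic v \<and> (AE y in lborel. 0 < fst y \<and> fst y < T \<longrightarrow> u y $ i = v y)" for i
  proof (rule periodic_borel_representative)
    show "space_periodic (\<lambda>y. u y $ i)" using per unfolding space_periodic_def by simp
    show "(\<lambda>y. u y $ i) \<in> borel_measurable (lebesgue_on (spacetime T))"
      by (rule borel_measurable_vec_component[OF meas(1)])
  qed
  then have "\<forall>i. \<exists>v. v \<in> borel_measurable borel \<and> space_periodic v \<and> (AE y in lborel. 0 < fst y \<and> fst y < T \<longrightarrow> u y $ i = v y)" ..
  from choice[OF this] obtain v where v[measurable]: "\<And>i. v i \<in> borel_measurable borel" and vp: "\<And>i. space_periodic (v i)"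
    and vae: "\<And>i. AE y in lborel. 0 < fst y \<and> fst y < T \<longrightarrow> u y $ i = v i y" by auto
  define \<rho>0 where "\<rho>0 y = indicator W y * max lo (min hi (\<rho>1 y))" for y
  define u0 where "u0 y = indicator W y *\<^sub>R (\<chi> i. v i y)" for y
  have \<rho>0_borel[measurable]: "\<rho>0 \<in> borel_measurable borel" unfolding \<rho>0_def[abs_def] by measurable
  have "(\<lambda>y. (\<chi> i. v i y)) \<in> borel_measurable borel" by (rule borel_measurable_vec_lambda[OF v])
  then have u0_borel[measurable]: "u0 \<in> borel_measurable borel" unfolding u0_def[abs_def] by measurable
  have \<rho>0p: "space_periodic \<rho>0" using \<rho>1p unfolding space_periodic_def \<rho>0_def W_def by (simp add: indicator_def)
  have u0p: "space_periodic u0" using vp unfolding space_periodic_def u0_def W_def by (simp add: indicator_def)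
  have rep: "AE y in lborel. 0 < fst y \<and> fst y < T \<longrightarrow> \<rho> y = \<rho>0 y \<and> u y = u0 y \<and> \<rho> y \<in> {lo..hi}"
  proof -
    have "AE y in lborel. \<forall>i\<in>UNIV. 0 < fst y \<and> fst y < T \<longrightarrow> u y $ i = v i y"
      by (rule AE_finite_allI) (simp, rule vae)
    then show ?thesis using range_w \<rho>1ae
      by eventually_elim (auto simp: \<rho>0_def u0_def W_def vec_eq_iff)
  qed
  obtain B1 where B1: "1 \<le> B1" "Lq_norm r (spacetime T) u \<le> ennreal B1"
    "\<And>\<xi>. \<xi> \<noteq> 0 \<Longrightarrow> Lq_norm r {y \<in> spacetime T. fst (y + \<xi>) \<in> {0<..<T}} (\<lambda>y. u (y + \<xi>) - u y) \<le> ennreal (B1 * norm \<xi> powr \<alpha>)"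
    by (rule besov_bounds[OF u_bes], rule that)
  obtain B2 where B2: "1 \<le> B2" "Lq_norm q (spacetime T) \<rho> \<le> ennreal B2"
    "\<And>\<xi>. \<xi> \<noteq> 0 \<Longrightarrow> Lq_norm q {y \<in> spacetime T. fst (y + \<xi>) \<in> {0<..<T}} (\<lambda>y. \<rho> (y + \<xi>) - \<rho> y) \<le> ennreal (B2 * norm \<xi> powr \<beta>)"
    by (rule besov_bounds[OF \<rho>_bes], rule that)
  obtain B3 where B3: "1 \<le> B3" "Lq_norm q (spacetime T) (\<lambda>y. \<rho> y *\<^sub>R u y) \<le> ennreal B3"
    "\<And>\<xi>. \<xi> \<noteq> 0 \<Longrightarrow> Lq_norm q {y \<in> spacetime T. fst (y + \<xi>) \<in> {0<..<T}} (\<lambda>y. \<rho> (y + \<xi>) *\<^sub>R u (y + \<xi>) - \<rho> y *\<^sub>R u y)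
        \<le> ennreal (B3 * norm \<xi> powr \<beta>)"
    by (rule besov_bounds[OF m_bes], rule that)
  define B where "B = max B1 (max B2 B3)"
  have B: "1 \<le> B" "B1 \<le> B" "B2 \<le> B" "B3 \<le> B" unfolding B_def using B1(1) by auto
  have scale: "ennreal (b * x) \<le> ennreal (B * x)" if "b \<le> B" "0 \<le> x" for b x
    using that by (intro ennreal_leI mult_right_mono)
  have shift_dom[measurable]: "{y \<in> spacetime T. fst (y + \<xi>) \<in> {0<..<T}} \<in> sets borel" for \<xi> :: "real \<times> (real ^ 'd)"
  proof -
    have "open {y :: real \<times> (real ^ 'd). 0 < fst (y + \<xi>) \<and> fst (y + \<xi>) < T}"
      by (intro open_Collect_conj open_Collect_less continuous_intros)
    then have "spacetime T \<inter> {y :: real \<times> (real ^ 'd). 0 < fst (y + \<xi>) \<and> fst (y + \<xi>) < T} \<in> sets borel"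
      by (intro sets.Int spacetime_in_borel borel_open)
    moreover have "spacetime T \<inter> {y :: real \<times> (real ^ 'd). 0 < fst (y + \<xi>) \<and> fst (y + \<xi>) < T} = {y \<in> spacetime T. fst (y + \<xi>) \<in> {0<..<T}}"
      by auto
    ultimately show ?thesis by simp
  qed
  have shift_rep: "AE y in lebesgue_on {y \<in> spacetime T. fst (y + \<xi>) \<in> {0<..<T}}.
      \<rho> y = \<rho>0 y \<and> u y = u0 y \<and> \<rho> (y + \<xi>) = \<rho>0 (y + \<xi>) \<and> u (y + \<xi>) = u0 (y + \<xi>)" for \<xi>
  proof (rule AE_lebesgue_on_lborel[OF shift_dom])
    show "AE y in lborel. y \<in> {y \<in> spacetime T. fst (y + \<xi>) \<in> {0<..<T}} \<longrightarrow>
      \<rho> y = \<rho>0 y \<and> u y = u0 y \<and> \<rho> (y + \<xi>) = \<rho>0 (y + \<xi>) \<and> u (y + \<xi>) = u0 (y + \<xi>)"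
      using rep AE_lborel_translate[OF rep, of \<xi>] by eventually_elim (auto simp: spacetime_def)
  qed
  have st_rep: "AE y in lebesgue_on (spacetime T). \<rho> y = \<rho>0 y \<and> u y = u0 y"
  proof (rule AE_lebesgue_on_lborel[OF spacetime_in_borel])
    show "AE y in lborel. y \<in> spacetime T \<longrightarrow> \<rho> y = \<rho>0 y \<and> u y = u0 y"
      using rep by eventually_elim (auto simp: spacetime_def)
  qed
  have vac: "(p has_real_derivative 0) (at_right 0)" if "lo = 0" using assms(23) that unfolding lo_def .
  obtain g P0 c C where C: "0 \<le> C"
    and pot: "\<And>s. s \<in> {lo..hi} \<Longrightarrow> pressure_potential p s = P0 s + c * s"
    and P0_lip: "\<And>s t. s \<in> {lo..hi} \<Longrightarrow> t \<in> {lo..hi} \<Longrightarrow> \<bar>P0 s - P0 t\<bar> \<le> C * \<bar>s - t\<bar>"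
    and p_lip: "\<And>s t. s \<in> {lo..hi} \<Longrightarrow> t \<in> {lo..hi} \<Longrightarrow> \<bar>p s - p t\<bar> \<le> C * \<bar>s - t\<bar>"
    and taylor: "\<And>s t. s \<in> {lo..hi} \<Longrightarrow> t \<in> {lo..hi} \<Longrightarrow> \<bar>p s - p t - g t * (s - t)\<bar> \<le> C * \<bar>s - t\<bar> powr \<gamma>"
    and p_reg: "\<And>\<delta>. 0 < \<delta> \<Longrightarrow> \<delta> \<le> 1 \<Longrightarrow> \<exists>k A q. continuous_on UNIV k \<and>
        (\<forall>s. (A has_real_derivative k s) (at s)) \<and> (\<forall>s. (q has_real_derivative s * k s) (at s)) \<and>
        (\<forall>s\<in>{lo..hi}. \<bar>k s\<bar> \<le> C * \<delta> powr (\<gamma> - 2) \<and> \<bar>A s\<bar> \<le> C \<and> \<bar>q s - p s\<bar> \<le> C * \<delta> powr \<gamma> \<and>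
           \<bar>s * A s - q s - P0 s\<bar> \<le> C * \<delta>)"
    by (rule pressure_regularization[OF assms(22)[folded lo_def hi_def] \<gamma> lohi _ assms(24)[folded lo_def hi_def]],
        erule vac, rule that)
  from assms(20)[unfolded mollifier_def]
  have mol: "smooth \<eta>" "\<forall>z. 0 \<le> \<eta> z" "\<forall>y z. norm y = norm z \<longrightarrow> \<eta> y = \<eta> z"
    "integral\<^sup>L lebesgue \<eta> = 1" "\<forall>z. 1 \<le> norm z \<longrightarrow> \<eta> z = 0"
    by - ((elim conjE, assumption)+)
  have \<eta>0: "bump_kernel \<eta>" unfolding bump_kernel_def using mol(1,5) less_imp_le by blast
  have \<eta>e: "\<eta> (- z) = \<eta> z" for z using mol(3)[rule_format, of "- z" z] norm_minus_cancel by blast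
  have \<eta>p: "0 \<le> \<eta> z" for z using mol(2) by blast
  note \<eta> = \<eta>0 \<eta>e \<eta>p
  have \<eta>m: "\<eta> \<in> borel_measurable lborel" using bump_kernel_borel[OF \<eta>0] by simp
  have \<eta>1: "(LINT z|lborel. \<eta> z) = 1" using mol(4) unfolding integral_completion[OF \<eta>m] .
  define V where "V = insert time_dir (range (space_dir :: 'd \<Rightarrow> _))"
  have "finite V" unfolding V_def by simp
  obtain c1 where c1: "0 \<le> c1" "\<And>z. \<bar>\<eta> z\<bar> \<le> c1 * indicator (cball 0 1) z" using bump_kernel_bounded[OF \<eta>(1)] by metis
  have "\<forall>v. \<exists>c\<ge>0. \<forall>z. \<bar>dir_deriv v \<eta> z\<bar> \<le> c * indicator (cball 0 1) z"
    using bump_kernel_bounded[OF bump_kernel_dir_deriv[OF \<eta>(1)]] by blast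
  then obtain c2 where c2: "\<And>v. 0 \<le> c2 v" "\<And>v z. \<bar>dir_deriv v \<eta> z\<bar> \<le> c2 v * indicator (cball 0 1) z" by metis
  define c\<eta> where "c\<eta> = c1 + (\<Sum>v\<in>V. c2 v)"
  have c\<eta>: "0 \<le> c\<eta>" "c1 \<le> c\<eta>" "\<And>v. v \<in> V \<Longrightarrow> c2 v \<le> c\<eta>"
    unfolding c\<eta>_def using c1 c2(1) member_le_sum[OF _ _ \<open>finite V\<close>, of _ c2]
    by (auto intro!: add_nonneg_nonneg sum_nonneg) (metis add_increasing c1(1))
  have mass0: "(LBINT y:strip. \<rho>0 y * dir_deriv time_dir \<phi> y + (\<Sum>j\<in>UNIV. (\<rho>0 y * u0 y $ j) * dir_deriv (space_dir j) \<phi> y)) = 0"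
    if "\<phi> \<in> test_functions T" for \<phi>
  proof -
    have ae: "AE y in lborel. 0 < fst y \<and> fst y < T \<longrightarrow> \<rho> y = \<rho>0 y \<and> \<rho> y *\<^sub>R u y = \<rho>0 y *\<^sub>R u0 y"
      using rep by eventually_elim auto
    have "set_lebesgue_integral lebesgue (spacetime T) (\<lambda>y. \<rho> y * dt \<phi> y + (\<rho> y *\<^sub>R u y) \<bullet> grad \<phi> y) = 0"
      using euler that unfolding isentropic_euler_def distributional_conservation_law_def by blast
    then show ?thesis using weak_form_representative[OF ae _ _ that] by simp
  qed
  \<comment> \<open>The clamp is invisible on \<open>W\<close> and makes the pressure measurable without knowledge of \<open>p\<close> off the range.\<close>
  define pw where "pw y = indicator W y * p (max lo (min hi (\<rho>0 y)))" for y
  have pw_borel[measurable]: "pw \<in> borel_measurable borel"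
  proof -
    have "C-lipschitz_on UNIV (\<lambda>s. p (max lo (min hi s)))"
    proof (rule lipschitz_onI[OF _ C])
      fix s t :: real
      have "\<bar>p (max lo (min hi s)) - p (max lo (min hi t))\<bar> \<le> C * \<bar>max lo (min hi s) - max lo (min hi t)\<bar>"
        by (rule p_lip) (use lohi in auto)
      also have "\<dots> \<le> C * \<bar>s - t\<bar>" using C by (intro mult_left_mono) (auto simp: max_def min_def)
      finally show "dist (p (max lo (min hi s))) (p (max lo (min hi t))) \<le> C * dist s t" by (simp add: dist_real_def)
    qed
    then have [measurable]: "(\<lambda>s. p (max lo (min hi s))) \<in> borel_measurable borel"
      by (intro borel_measurable_continuous_onI lipschitz_on_continuous_on)
    show ?thesis unfolding pw_def[abs_def] by measurable
  qed
  have \<rho>0_range: "\<rho>0 y \<in> {lo..hi}" if "0 < fst y" "fst y < T" for y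
    using that lohi unfolding \<rho>0_def W_def by auto
  have pw: "pw y = (if 0 < fst y \<and> fst y < T then p (\<rho>0 y) else 0)" for y
    unfolding pw_def using \<rho>0_range[of y] by (auto simp: W_def max_def min_def)
  have mom0: "(LBINT y:strip. (\<rho>0 y * u0 y $ i) * dir_deriv time_dir \<phi> y + (\<Sum>j\<in>UNIV. (\<rho>0 y * u0 y $ j * u0 y $ i) * dir_deriv (space_dir j) \<phi> y)
         + (if 0 < fst y \<and> fst y < T then p (\<rho>0 y) else 0) * dir_deriv (space_dir i) \<phi> y) = 0"
    if \<phi>: "\<phi> \<in> test_functions T" for i \<phi>
  proof -
    define F0 where "F0 y = (\<rho>0 y * u0 y $ i) *\<^sub>R u0 y + pw y *\<^sub>R axis i 1" for y
    have [measurable]: "F0 \<in> borel_measurable borel" unfolding F0_def[abs_def] by measurable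
    have ae: "AE y in lborel. 0 < fst y \<and> fst y < T \<longrightarrow> \<rho> y * u y $ i = \<rho>0 y * u0 y $ i \<and>
        (\<rho> y * u y $ i) *\<^sub>R u y + p (\<rho> y) *\<^sub>R axis i 1 = F0 y"
      using rep by eventually_elim (auto simp: F0_def pw)
    have "set_lebesgue_integral lebesgue (spacetime T)
       (\<lambda>y. \<rho> y * u y $ i * dt \<phi> y + ((\<rho> y * u y $ i) *\<^sub>R u y + p (\<rho> y) *\<^sub>R axis i 1) \<bullet> grad \<phi> y) = 0"
      using euler \<phi> unfolding isentropic_euler_def distributional_conservation_law_def by blast
    then have "(LBINT y:strip. \<rho>0 y * u0 y $ i * dir_deriv time_dir \<phi> y + (\<Sum>j\<in>UNIV. F0 y $ j * dir_deriv (space_dir j) \<phi> y)) = 0"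
      using weak_form_representative[OF ae _ _ \<phi>] by simp
    moreover have "(\<Sum>j\<in>UNIV. F0 y $ j * dir_deriv (space_dir j) \<phi> y)
       = (\<Sum>j\<in>UNIV. (\<rho>0 y * u0 y $ j * u0 y $ i) * dir_deriv (space_dir j) \<phi> y) + pw y * dir_deriv (space_dir i) \<phi> y" for y
    proof -
      have "(\<Sum>j\<in>UNIV. F0 y $ j * dir_deriv (space_dir j) \<phi> y)
        = (\<Sum>j\<in>UNIV. (\<rho>0 y * u0 y $ j * u0 y $ i) * dir_deriv (space_dir j) \<phi> y + (if j = i then pw y * dir_deriv (space_dir i) \<phi> y else 0))"
        unfolding F0_def by (intro sum.cong refl) (auto simp: axis_def algebra_simps)
      then show ?thesis by (simp add: sum.distrib)
    qed
    ultimately show ?thesis unfolding pw[symmetric] by (simp add: add.assoc)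
  qed
  interpret flow: periodic_flow \<eta> T \<alpha> \<beta> \<gamma> B lo hi C c\<eta> r q p g P0 \<rho>0 u0
  proof
    show "1 / enn2real r + 2 * (1 / enn2real q) \<le> 1" by (rule exponent_condition[OF assms(16,17,14)])
    show "2 * (1 / enn2real r) + 1 / enn2real q \<le> 1"
      using exponent_condition[OF assms(17,16)] assms(15) by (simp add: add.commute)
    show "\<bar>\<eta> z\<bar> \<le> c\<eta> * indicator (cball 0 1) z" for z
      by (rule order_trans[OF c1(2)]) (intro mult_right_mono c\<eta>, simp)
    show "\<bar>dir_deriv v \<eta> z\<bar> \<le> c\<eta> * indicator (cball 0 1) z" if "v \<in> insert time_dir (range space_dir)" for v z
      by (rule order_trans[OF c2(2)]) (intro mult_right_mono c\<eta>(3), use that in \<open>auto simp: V_def\<close>)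
    have B0: "0 < B" using B by linarith
    have "AE y in lebesgue_on (spacetime T). u y = u0 y" using st_rep by eventually_elim blast
    from Lq_norm_gauge[OF assms(16) spacetime_in_borel u0_borel this B0 order_trans[OF B1(2) ennreal_leI[OF B(2)]]]
    show "(\<integral>\<^sup>+y. indicator (spacetime T) y * Lq_gauge r (norm (u0 y) / B) \<partial>lborel) \<le> 1" .
    have m_borel: "(\<lambda>y. \<rho>0 y *\<^sub>R u0 y) \<in> borel_measurable borel" by measurable
    have "AE y in lebesgue_on (spacetime T). \<rho> y *\<^sub>R u y = \<rho>0 y *\<^sub>R u0 y" using st_rep by eventually_elim simp
    from Lq_norm_gauge[OF assms(17) spacetime_in_borel m_borel this B0 order_trans[OF B3(2) ennreal_leI[OF B(4)]]]
    show "(\<integral>\<^sup>+y. indicator (spacetime T) y * Lq_gauge q (norm (\<rho>0 y *\<^sub>R u0 y) / B) \<partial>lborel) \<le> 1" .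
    fix \<xi> :: "real \<times> (real ^ 'd)" assume \<xi>: "\<xi> \<noteq> 0"
    have Bx: "0 < B * norm \<xi> powr s" for s using B \<xi> by simp
    define S where "S = {y \<in> spacetime T. fst (y + \<xi>) \<in> {0<..<T}}"
    have S: "S \<in> sets borel" unfolding S_def by (rule shift_dom)
    note sr = shift_rep[of \<xi>, folded S_def]
    have b: "(\<lambda>y. u0 (y + \<xi>) - u0 y) \<in> borel_measurable borel" "(\<lambda>y. \<rho>0 (y + \<xi>) - \<rho>0 y) \<in> borel_measurable borel"
      "(\<lambda>y. \<rho>0 (y + \<xi>) *\<^sub>R u0 (y + \<xi>) - \<rho>0 y *\<^sub>R u0 y) \<in> borel_measurable borel" by measurable
    have "AE y in lebesgue_on S. u (y + \<xi>) - u y = u0 (y + \<xi>) - u0 y" using sr by eventually_elim simp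
    from Lq_norm_gauge[OF assms(16) S b(1) this Bx order_trans[OF B1(3)[OF \<xi>, folded S_def] scale[OF B(2)]]]
    show "(\<integral>\<^sup>+y. indicator {y \<in> spacetime T. fst (y + \<xi>) \<in> {0<..<T}} y *
        Lq_gauge r (norm (u0 (y + \<xi>) - u0 y) / (B * norm \<xi> powr \<alpha>)) \<partial>lborel) \<le> 1"
      unfolding S_def by simp
    have "AE y in lebesgue_on S. \<rho> (y + \<xi>) - \<rho> y = \<rho>0 (y + \<xi>) - \<rho>0 y" using sr by eventually_elim simp
    from Lq_norm_gauge[OF assms(17) S b(2) this Bx order_trans[OF B2(3)[OF \<xi>, folded S_def] scale[OF B(3)]]]
    show "(\<integral>\<^sup>+y. indicator {y \<in> spacetime T. fst (y + \<xi>) \<in> {0<..<T}} y *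
        Lq_gauge q (norm (\<rho>0 (y + \<xi>) - \<rho>0 y) / (B * norm \<xi> powr \<beta>)) \<partial>lborel) \<le> 1"
      unfolding S_def by simp
    have "AE y in lebesgue_on S. \<rho> (y + \<xi>) *\<^sub>R u (y + \<xi>) - \<rho> y *\<^sub>R u y = \<rho>0 (y + \<xi>) *\<^sub>R u0 (y + \<xi>) - \<rho>0 y *\<^sub>R u0 y"
      using sr by eventually_elim simp
    from Lq_norm_gauge[OF assms(17) S b(3) this Bx order_trans[OF B3(3)[OF \<xi>, folded S_def] scale[OF B(4)]]]
    show "(\<integral>\<^sup>+y. indicator {y \<in> spacetime T. fst (y + \<xi>) \<in> {0<..<T}} y *
        Lq_gauge q (norm (\<rho>0 (y + \<xi>) *\<^sub>R u0 (y + \<xi>) - \<rho>0 y *\<^sub>R u0 y) / (B * norm \<xi> powr \<beta>)) \<partial>lborel) \<le> 1"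
      unfolding S_def by simp
  next
    show "\<not> (0 < fst y \<and> fst y < T) \<Longrightarrow> \<rho>0 y = 0 \<and> u0 y = 0" for y unfolding \<rho>0_def u0_def W_def by auto
  qed (fact assms(10-13) assms(16-19) \<gamma> \<eta> \<eta>1 B(1) lohi C P0_lip p_lip taylor p_reg c\<eta>(1) \<rho>0_borel u0_borel \<rho>0p u0p \<rho>0_range mass0 mom0)+
  define f0 where "f0 y = flow.energy_density y + c * \<rho>0 y" for y
  define F0 where "F0 y = (\<chi> j. flow.energy_flux j y + c * (\<rho>0 y * u0 y $ j))" for y
  have adm: "flow.admissible f0" "flow.admissible (\<lambda>y. F0 y $ j)" for j
    unfolding f0_def[abs_def] F0_def by (simp_all add: flow.admissible_add flow.admissible_cmult flow.admissible_energy_density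
        flow.admissible_energy_flux flow.admissible_\<rho> flow.admissible_m)
  have f0_borel[measurable]: "f0 \<in> borel_measurable borel" by (rule flow.admissibleD(1)[OF adm(1)])
  have F0_borel[measurable]: "F0 \<in> borel_measurable borel"
    using borel_measurable_vec_lambda[of "\<lambda>j y. F0 y $ j", OF flow.admissibleD(1)[OF adm(2)]] by simp
  define f where "f y = \<rho> y * (norm (u y))\<^sup>2 / 2 + pressure_potential p (\<rho> y)" for y
  define F where "F y = (\<rho> y * (norm (u y))\<^sup>2 / 2 + p (\<rho> y) + pressure_potential p (\<rho> y)) *\<^sub>R u y" for y
  have fF: "AE y in lborel. 0 < fst y \<and> fst y < T \<longrightarrow> f y = f0 y \<and> F y = F0 y"
    using rep
  proof eventually_elim
    case (elim y)
    show ?case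
    proof
      assume t: "0 < fst y \<and> fst y < T"
      then have e: "\<rho> y = \<rho>0 y" "u y = u0 y" "\<rho>0 y \<in> {lo..hi}" using elim by auto
      have n: "(norm (u0 y))\<^sup>2 = (\<Sum>i\<in>UNIV. u0 y $ i * u0 y $ i)"
        by (simp add: dot_square_norm[symmetric] inner_vec_def)
      have s: "(\<Sum>i\<in>UNIV. \<rho>0 y * u0 y $ i * u0 y $ i) = \<rho>0 y * (norm (u0 y))\<^sup>2"
        unfolding n sum_distrib_left by (simp add: mult.assoc)
      have o: "flow.on_range h y = h (\<rho>0 y)" for h using flow.on_range_eq t by blast
      show "f y = f0 y \<and> F y = F0 y"
        unfolding f_def f0_def F_def F0_def flow.energy_density_def flow.energy_flux_def s o e pot[OF e(3)]
        by (simp add: vec_eq_iff algebra_simps)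
    qed
  qed
  have slab: "AE y in lborel. y \<in> {a..b} \<times> cell \<longrightarrow> f y = f0 y \<and> F y = F0 y" if "0 < a" "b < T" for a b :: real
    using fF by eventually_elim (use that in auto)
  show ?thesis
    unfolding distributional_conservation_law_def f_def[symmetric, abs_def] F_def[symmetric, abs_def]
  proof (intro conjI ballI)
    show "locally_integrable T f"
      unfolding locally_integrable_def
    proof (intro allI impI)
      fix a b :: real assume "0 < a \<and> b < T"
      then have "AE y in lborel. y \<in> {a..b} \<times> cell \<longrightarrow> f y = f0 y" using slab[of a b] by auto
      from set_integrable_representative[OF slab_borel f0_borel this]
      show "set_integrable lebesgue ({a..b} \<times> cell) f" using flow.admissible_slab_integrable[OF adm(1)] by simp
    qed
    show "locally_integrable T F"
      unfolding locally_integrable_def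
    proof (intro allI impI)
      fix a b :: real assume "0 < a \<and> b < T"
      then have "AE y in lborel. y \<in> {a..b} \<times> cell \<longrightarrow> F y = F0 y" using slab[of a b] by auto
      from set_integrable_representative[OF slab_borel F0_borel this]
      show "set_integrable lebesgue ({a..b} \<times> cell) F"
        using set_integrable_vector[OF flow.admissible_slab_integrable[OF adm(2)]] by simp
    qed
    fix \<phi> :: "real \<times> (real ^ 'd) \<Rightarrow> real" assume \<phi>: "\<phi> \<in> test_functions T"
    then obtain a0 b0 where tf: "test_fun a0 b0 \<phi>"
      using smooth_C1 unfolding test_functions_def test_fun_def time_supp_def by blast
    have pairing: "set_integrable lborel strip (\<lambda>y. f y * dir_deriv v \<phi> y)" if "flow.admissible f" for f v
      using flow.admissible_pairing_integrable[OF that tf, of v] by (simp add: mult.commute)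
    have i1: "set_integrable lborel strip (\<lambda>y. flow.energy_density y * dir_deriv time_dir \<phi> y + (\<Sum>j\<in>UNIV. flow.energy_flux j y * dir_deriv (space_dir j) \<phi> y))"
      by (intro set_integral_add(1) set_integral_sum_strip(2) pairing flow.admissible_energy_density flow.admissible_energy_flux)
    have i2: "set_integrable lborel strip (\<lambda>y. \<rho>0 y * dir_deriv time_dir \<phi> y + (\<Sum>j\<in>UNIV. (\<rho>0 y * u0 y $ j) * dir_deriv (space_dir j) \<phi> y))"
      by (intro set_integral_add(1) set_integral_sum_strip(2) pairing flow.admissible_\<rho> flow.admissible_m)
    have "set_lebesgue_integral lebesgue (spacetime T) (\<lambda>y. f y * dt \<phi> y + F y \<bullet> grad \<phi> y)
      = (LBINT y:strip. f0 y * dir_deriv time_dir \<phi> y + (\<Sum>j\<in>UNIV. F0 y $ j * dir_deriv (space_dir j) \<phi> y))"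
      by (rule weak_form_representative[OF fF f0_borel F0_borel \<phi>])
    also have "\<dots> = (LBINT y:strip. (flow.energy_density y * dir_deriv time_dir \<phi> y + (\<Sum>j\<in>UNIV. flow.energy_flux j y * dir_deriv (space_dir j) \<phi> y))
        + c * (\<rho>0 y * dir_deriv time_dir \<phi> y + (\<Sum>j\<in>UNIV. (\<rho>0 y * u0 y $ j) * dir_deriv (space_dir j) \<phi> y)))"
      unfolding f0_def F0_def by (simp add: algebra_simps sum.distrib sum_distrib_left)
    also have "\<dots> = (LBINT y:strip. flow.energy_density y * dir_deriv time_dir \<phi> y + (\<Sum>j\<in>UNIV. flow.energy_flux j y * dir_deriv (space_dir j) \<phi> y))
        + c * (LBINT y:strip. \<rho>0 y * dir_deriv time_dir \<phi> y + (\<Sum>j\<in>UNIV. (\<rho>0 y * u0 y $ j) * dir_deriv (space_dir j) \<phi> y))"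
      using set_integral_add(2)[OF i1, of "\<lambda>y. c * (\<rho>0 y * dir_deriv time_dir \<phi> y + (\<Sum>j\<in>UNIV. (\<rho>0 y * u0 y $ j) * dir_deriv (space_dir j) \<phi> y))"] i2
      by simp
    also have "\<dots> = 0" unfolding flow.local_energy_balance[OF \<phi>] mass0[OF \<phi>] by simp
    finally show "set_lebesgue_integral lebesgue (spacetime T) (\<lambda>y. f y * dt \<phi> y + F y \<bullet> grad \<phi> y) = 0" .
  qed
qed

end
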